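(* Let $\underline V={\liminf}_{\#}V^\varepsilon$ be the lower weak semilimit of the value functions $V^\varepsilon$ as $\varepsilon\to 0$, regarded as a function of $(x,t)\in\mathbb R^N\times(0,+\infty)$. Then $\underline V$ is a viscosity supersolution of $$u_t+\overline H(x,Du)=0\quad\text{in }\mathbb R^N\times(0,+\infty),$$ and it satisfies $$\liminf_{(x,t)\to(x_0,0),\ t>0}\underline V(x,t)\ge(\overline u_0)_{\#}(x_0)\qquad\text{for any }x_0\in\mathbb R^N.$$
   Context: Standing assumptions. $N,M$ are positive integers; $A$ is a compact subset of a Euclidean space; $f:\mathbb R^N\times\mathbb R^M\times A\to\mathbb R^N$, $g:\mathbb R^N\times\mathbb R^M\times A\to\mathbb R^M$, $\ell:\mathbb R^N\times\mathbb R^M\times A\to\mathbb R$, $u_0:\mathbb R^N\times\mathbb R^M\to\mathbb R$ are continuous. (1) There is $L_0>0$ with $|f(x_1,y_1,a)-f(x_2,y_2,a)|\le L_0(|x_1-x_2|+|y_1-y_2|)$ and $|g(x_1,y_1,a)-g(x_2,y_2,a)|\le L_0(|x_1-x_2|+|y_1-y_2|)$ for all $(x_i,y_i)$ and $a\in A$; $|f|$ is bounded, with upper bound $Q_0$. (2) For any compact $K\subset\mathbb R^N\times\mathbb R^M$ there is $r=r(K)>0$ such that $B(0,r)\subset\overline{\mathrm{co}}\,g(x,y,A)$ for all $(x,y)\in K$, where $g(x,y,A)=\{g(x,y,a)\mid a\in A\}$ and $\overline{\mathrm{co}}$ is the closed convex hull. (3) For any compact $B\subset\mathbb R^N$, $\lim_{|y|\to+\infty}\min_{(x,a)\in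 B\times A}\ell(x,y,a)=+\infty$. (4) $u_0$ is bounded from below, with $-Q_0$ taken also as lower bound of $u_0$. Controls are measurable functions $\alpha:[0,+\infty)\to A$. For $\varepsilon>0$, the controlled dynamics is $\dot\xi=\varepsilon f(\xi,\eta,\alpha)$, $\dot\eta=g(\xi,\eta,\alpha)$. The value function is $$V^\varepsilon(x,y,t)=\inf_\alpha\Big\{\varepsilon\int_0^{t/\varepsilon}\ell(\xi,\eta,\alpha)\,ds+u_0\big(\xi(t/\varepsilon),\eta(t/\varepsilon)\big)\Big\},$$ where $(\xi,\eta)$ is the trajectory of the dynamics with control $\alpha$ and $(\xi(0),\eta(0))=(x,y)$. Weak semilimit: $({\liminf}_{\#}V^\varepsilon)(x,y,t)=\inf\{\liminf_n V^{\varepsilon_n}(x_n,y_n,t_n)\mid \varepsilon_n\to0,\ (x_n,y_n,t_n)\to(x,y,t)\}$. The $V^\varepsilon$ are locally equibounded, and for $t>0$ this semilimit does not depend on $y$, so it defines a function $\underline V(x,t)$. Hamiltonian: $H(x,y,p,q)=\max_{a\in A}\{-p\cdot f(x,y,a)-q\cdot g(x,y,a)-\ell(x,y,a)\}$. Effective Hamiltonian: $\overline H(x,p)=\inf\{b\in\mathbb R\mid H(x,y,p,Du(y))=b\text{ admits a viscosity subsolution in }\mathbb R^M\}$, where the equation is in the variable $y$ only, with $(x,p)$ frozen (this is a finite quantity). Limit initial datum: $\overline u_0(x)=\inf_{y\in\mathbb R^M}u_0(x,y)$; $(\overline u_0)_{\#}$ denotes its lower semicontinuous envelope, i.e. the maximal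 lower semicontinuous function less than or equal to $\overline u_0$. *)

theory Defs
  imports "HOL-Analysis.Analysis"
begin

section \<open>Semicontinuity and viscosity solutions\<close>

definition lsc_on :: "'a::topological_space set \<Rightarrow> ('a \<Rightarrow> real) \<Rightarrow> bool" where
  "lsc_on S v \<longleftrightarrow> (\<forall>z\<in>S. \<forall>c<v z. \<forall>\<^sub>F w in at z within S. c < v w)"

definition usc_on :: "'a::topological_space set \<Rightarrow> ('a \<Rightarrow> real) \<Rightarrow> bool" where
  "usc_on S v \<longleftrightarrow> (\<forall>z\<in>S. \<forall>c>v z. \<forall>\<^sub>F w in at z within S. v w < c)"

text \<open>The pointwise supremum of lower semicontinuous functions is lower semicontinuous, so this is
  the maximal lower semicontinuous function below \<open>v\<close>, provided \<open>v\<close> has a lower semicontinuous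
  minorant at all (for instance if \<open>v\<close> is bounded from below).\<close>

definition lsc_envelope :: "('a::topological_space \<Rightarrow> real) \<Rightarrow> 'a \<Rightarrow> real" where
  "lsc_envelope v z = (SUP \<phi>\<in>{\<phi>. lsc_on UNIV \<phi> \<and> (\<forall>w. \<phi> w \<le> v w)}. \<phi> z)"

text \<open>\<open>D\<close> is the gradient field of the \<open>C\<^sup>1\<close> function \<open>\<phi>\<close> on the open set \<open>\<Omega>\<close>.\<close>

definition C1_gradient ::
  "'a::euclidean_space set \<Rightarrow> ('a \<Rightarrow> real) \<Rightarrow> ('a \<Rightarrow> 'a) \<Rightarrow> bool" where
  "C1_gradient \<Omega> \<phi> D \<longleftrightarrow> (\<forall>z\<in>\<Omega>. GDERIV \<phi> z :> D z) \<and> continuous_on \<Omega> D"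

text \<open>Viscosity sub- and supersolutions of \<open>F (z, Du) = 0\<close> in an open set \<open>\<Omega>\<close>.\<close>

definition viscosity_subsolution ::
  "'a::euclidean_space set \<Rightarrow> ('a \<Rightarrow> 'a \<Rightarrow> real) \<Rightarrow> ('a \<Rightarrow> real) \<Rightarrow> bool" where
  "viscosity_subsolution \<Omega> F u \<longleftrightarrow>
     usc_on \<Omega> u \<and>
     (\<forall>\<phi> D. C1_gradient \<Omega> \<phi> D \<longrightarrow>
       (\<forall>z\<in>\<Omega>. (\<forall>\<^sub>F w in at z within \<Omega>. u w - \<phi> w \<le> u z - \<phi> z) \<longrightarrow> F z (D z) \<le> 0))"

definition viscosity_supersolution ::
  "'a::euclidean_space set \<Rightarrow> ('a \<Rightarrow> 'a \<Rightarrow> real) \<Rightarrow> ('a \<Rightarrow> real) \<Rightarrow> bool" where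
  "viscosity_supersolution \<Omega> F u \<longleftrightarrow>
     lsc_on \<Omega> u \<and>
     (\<forall>\<phi> D. C1_gradient \<Omega> \<phi> D \<longrightarrow>
       (\<forall>z\<in>\<Omega>. (\<forall>\<^sub>F w in at z within \<Omega>. u w - \<phi> w \<ge> u z - \<phi> z) \<longrightarrow> F z (D z) \<ge> 0))"

section \<open>The control problem\<close>

text \<open>Only the values of a control on \<open>[0, \<infinity>)\<close> matter.\<close>

definition controls :: "'c::euclidean_space set \<Rightarrow> (real \<Rightarrow> 'c) set" where
  "controls A = {\<alpha>. \<alpha> \<in> borel_measurable (lebesgue_on {0..}) \<and> (\<forall>s\<ge>0. \<alpha> s \<in> A)}"

text \<open>Since controls are merely measurable, the differential equation is understood in the sense of
  Caratheodory, that is, as the corresponding integral equation. Continuity of \<open>\<xi>\<close> and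
  \<open>\<eta>\<close> on \<open>[0, \<infinity>)\<close> is part of this, being implied by it.\<close>

definition trajectory ::
  "('x::euclidean_space \<Rightarrow> 'y::euclidean_space \<Rightarrow> 'c \<Rightarrow> 'x) \<Rightarrow> ('x \<Rightarrow> 'y \<Rightarrow> 'c \<Rightarrow> 'y) \<Rightarrow>
    real \<Rightarrow> 'x \<Rightarrow> 'y \<Rightarrow> (real \<Rightarrow> 'c) \<Rightarrow> (real \<Rightarrow> 'x) \<Rightarrow> (real \<Rightarrow> 'y) \<Rightarrow> bool" where
  "trajectory f g \<epsilon> x y \<alpha> \<xi> \<eta> \<longleftrightarrow>
     (\<forall>t\<ge>0. ((\<lambda>s. \<epsilon> *\<^sub>R f (\<xi> s) (\<eta> s) (\<alpha> s)) has_integral (\<xi> t - x)) {0..t} \<and>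
             ((\<lambda>s. g (\<xi> s) (\<eta> s) (\<alpha> s)) has_integral (\<eta> t - y)) {0..t})"

definition value_function ::
  "('x::euclidean_space \<Rightarrow> 'y::euclidean_space \<Rightarrow> 'c::euclidean_space \<Rightarrow> 'x) \<Rightarrow>
    ('x \<Rightarrow> 'y \<Rightarrow> 'c \<Rightarrow> 'y) \<Rightarrow> ('x \<Rightarrow> 'y \<Rightarrow> 'c \<Rightarrow> real) \<Rightarrow> ('x \<Rightarrow> 'y \<Rightarrow> real) \<Rightarrow> 'c set \<Rightarrow>
    real \<Rightarrow> 'x \<Rightarrow> 'y \<Rightarrow> real \<Rightarrow> real" where
  "value_function f g l u0 A \<epsilon> x y t =
     Inf {\<epsilon> * integral {0..t / \<epsilon>} (\<lambda>s. l (\<xi> s) (\<eta> s) (\<alpha> s)) + u0 (\<xi> (t / \<epsilon>)) (\<eta> (t / \<epsilon>))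
          | \<alpha> \<xi> \<eta>. \<alpha> \<in> controls A \<and> trajectory f g \<epsilon> x y \<alpha> \<xi> \<eta>}"

text \<open>The approximating points range over the domain \<open>t \<ge> 0\<close> of the functions \<open>W \<epsilon>\<close>.\<close>

definition lower_semilimit ::
  "(real \<Rightarrow> 'x::topological_space \<Rightarrow> 'y::topological_space \<Rightarrow> real \<Rightarrow> real) \<Rightarrow>
    'x \<Rightarrow> 'y \<Rightarrow> real \<Rightarrow> ereal" where
  "lower_semilimit W x y t =
     Inf {liminf (\<lambda>n. ereal (W (\<epsilon> n) (X n) (Y n) (T n)))
          | \<epsilon> X Y T. (\<forall>n. \<epsilon> n > 0 \<and> T n \<ge> 0) \<and>
              \<epsilon> \<longlonglongrightarrow> 0 \<and> X \<longlonglongrightarrow> x \<and> Y \<longlonglongrightarrow> y \<and> T \<longlonglongrightarrow> t}"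

section \<open>Hamiltonians and limit initial datum\<close>

text \<open>For continuous data and nonempty compact \<open>A\<close> the supremum is a maximum.\<close>

definition hamiltonian ::
  "('x::euclidean_space \<Rightarrow> 'y::euclidean_space \<Rightarrow> 'c \<Rightarrow> 'x) \<Rightarrow> ('x \<Rightarrow> 'y \<Rightarrow> 'c \<Rightarrow> 'y) \<Rightarrow>
    ('x \<Rightarrow> 'y \<Rightarrow> 'c \<Rightarrow> real) \<Rightarrow> 'c set \<Rightarrow> 'x \<Rightarrow> 'y \<Rightarrow> 'x \<Rightarrow> 'y \<Rightarrow> real" where
  "hamiltonian f g l A x y p q = (SUP a\<in>A. - (p \<bullet> f x y a) - q \<bullet> g x y a - l x y a)"

definition effective_hamiltonian ::
  "('x::euclidean_space \<Rightarrow> 'y::euclidean_space \<Rightarrow> 'c \<Rightarrow> 'x) \<Rightarrow> ('x \<Rightarrow> 'y \<Rightarrow> 'c \<Rightarrow> 'y) \<Rightarrow>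
    ('x \<Rightarrow> 'y \<Rightarrow> 'c \<Rightarrow> real) \<Rightarrow> 'c set \<Rightarrow> 'x \<Rightarrow> 'x \<Rightarrow> real" where
  "effective_hamiltonian f g l A x p =
     Inf {b. \<exists>u. viscosity_subsolution UNIV (\<lambda>y q. hamiltonian f g l A x y p q - b) u}"

definition limit_datum :: "('x \<Rightarrow> 'y \<Rightarrow> real) \<Rightarrow> 'x \<Rightarrow> real" where
  "limit_datum u0 x = (INF y. u0 x y)"

end

theory Submission
  imports Defs
begin

text \<open>
  The proof follows trajectories: near-optimal ones for the supersolution property and steered ones
  for the finiteness of the semilimit and its independence of \<open>y\<close>.

  \<^emph>\<open>The fast variable is steerable.\<close> Controllability provides, for each vector \<open>v\<close>, a control value
  for which \<open>g\<close> points against \<open>v\<close> at a definite rate. Holding such values for short times drives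
  \<open>\<eta>\<close> towards any target and then keeps it there (\<open>steering_arc\<close>). Steering forward in time keeps
  \<open>\<eta>\<close> bounded and so bounds the value functions from above uniformly in \<open>\<epsilon>\<close>. Steering backward
  in time shows that the semilimit does not depend on \<open>y\<close>: from a point where the value function
  nearly attains the semilimit one goes back until the fast variable is near the prescribed \<open>y\<close>. Read
  forward, this path ends exactly at the good point, and since it takes bounded fast time, it changes
  cost, slow variable and time only by \<open>O(\<epsilon>)\<close>. What is only approximate is the starting point, and
  there the semilimit permits approximation.

  \<^emph>\<open>Supersolution property.\<close> Let \<open>\<phi>\<close> touch the semilimit from below at \<open>(x0, t0)\<close> with gradient
  \<open>(p, q)\<close>, and let \<open>u\<close> be a subsolution of the cell problem at \<open>(x0, p)\<close> with level \<open>b\<close>. As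
  the effective Hamiltonian is the infimum of such \<open>b\<close>, it suffices to show \<open>q + b \<ge> 0\<close>. The key is
  \<open>running_cost_lower_bound\<close>: along every trajectory whose slow part stays near \<open>x0\<close>, the integral
  of \<open>l + p \<bullet> f + b\<close> over a fast time \<open>T\<close> is at least \<open>- K - \<mu> * T\<close> for a constant \<open>K\<close> and
  arbitrarily small \<open>\<mu>\<close>. Follow a nearly optimal trajectory for a small slow time \<open>s\<close>, chosen such
  that the fast variable is in a fixed ball at that time (\<open>fast_variable_returns\<close>: coercivity of
  \<open>l\<close> makes long absences too expensive). Its cost is at least the cost up to time \<open>s\<close> plus the
  value at the point reached, and the latter is at least the value of \<open>\<phi>\<close> there, up to a small error.
  The increment of \<open>\<phi>\<close> is the integral of \<open>p \<bullet> f\<close> minus \<open>q * s\<close>, up to \<open>o(s)\<close>. If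
  \<open>q + b < 0\<close>, the key estimate is violated as \<open>\<epsilon>\<close> tends to \<open>0\<close>.

  \<^emph>\<open>The key estimate.\<close> A subsolution \<open>u\<close> is only upper semicontinuous and may be unbounded. Its
  sup-convolution has a subgradient with quadratic error at every point, and this subgradient satisfies the
  subsolution inequality for all controls up to \<open>\<mu>\<close>. The inequality can therefore be integrated along
  trajectories with merely measurable controls. To make the function bounded, it is truncated from
  above by \<open>M - \<sigma> * ln (1 + (norm y)\<^sup>2)\<close> and from below by a constant. Both are subsolutions far
  out, where \<open>l\<close> is large; the logarithm is tame enough because \<open>g\<close> grows at most linearly.

  \<^emph>\<open>Initial values.\<close> Up to time \<open>t\<close> the slow variable moves by at most \<open>Q0 * t\<close>, and \<open>l\<close> is
  bounded below for bounded slow variable, so the value functions at time \<open>t\<close> are at least \<open>- C * t\<close>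
  plus the infimum of the limit datum over a small ball, for every \<open>\<epsilon>\<close>.
\<close>

section \<open>Lipschitz differential equations\<close>

text \<open>Picard iteration. Measured with the weight \<open>exp (2 * L * t)\<close>, one iteration halves the distance of
  consecutive iterates, on all of \<open>[0, \<infinity>)\<close> at once; hence the solution is global.
  The factor \<open>t\<close> in the second conclusion makes the displacement linear for short times.\<close>

lemma lipschitz_ode_global_solution:
  fixes F :: "'a::euclidean_space \<Rightarrow> 'a"
  assumes lip: "\<And>z w. norm (F z - F w) \<le> L * norm (z - w)" and L: "L > 0"
  obtains \<zeta> where "\<And>t. t \<ge> 0 \<Longrightarrow> ((\<lambda>s. F (\<zeta> s)) has_integral (\<zeta> t - z0)) {0..t}"
    and "\<And>t. t \<ge> 0 \<Longrightarrow> norm (\<zeta> t - z0) \<le> 2 * norm (F z0) * t * exp (2 * L * t)"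
proof -
  define P where "P = rec_nat (\<lambda>t::real. z0) (\<lambda>k p t. z0 + integral {0..t} (\<lambda>s. F (p s)))"
  have P0: "P 0 t = z0" for t by (simp add: P_def)
  have PS: "P (Suc k) t = z0 + integral {0..t} (\<lambda>s. F (P k s))" for k t by (simp add: P_def)
  have contF: "continuous_on S F" for S
  proof -
    have "L-lipschitz_on S F"
      using lip L by (auto simp: lipschitz_on_def dist_norm)
    then show ?thesis by (rule lipschitz_on_continuous_on)
  qed
  have contP: "continuous_on {0..T} (P k)" for k T
  proof (induction k)
    case 0 show ?case by (simp add: P0[abs_def])
  next
    case (Suc k)
    have "continuous_on {0..T} (\<lambda>s. F (P k s))"
      by (rule continuous_on_compose2[OF contF Suc]) auto
    then show ?case unfolding PS[abs_def]
      by (intro continuous_intros indefinite_integral_continuous_1 integrable_continuous_real)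
  qed
  have contFP: "continuous_on {0..T} (\<lambda>s. F (P k s))" for k T
    by (rule continuous_on_compose2[OF contF contP]) auto
  define M where "M = norm (F z0)"
  have M0: "M \<ge> 0" by (simp add: M_def)
  have bound: "norm (P (Suc k) t - P k t) \<le> M * t * exp (2 * L * t) * (1/2)^k" if "t \<ge> 0" for k t
    using that
  proof (induction k arbitrary: t)
    case 0
    have "norm (P (Suc 0) t - P 0 t) = M * t"
      using 0 by (simp add: PS P0 M_def)
    also have "\<dots> \<le> M * t * exp (2 * L * t)"
      using 0 L M0 mult_left_mono[of 1 "exp (2 * L * t)" "M * t"] by simp
    finally show ?case by simp
  next
    case (Suc k)
    define C where "C = L * (M * t * (1/2)^k)"
    have C0: "C \<ge> 0" using L M0 Suc.prems by (simp add: C_def)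
    have I: "((\<lambda>s. C * exp (2 * L * s)) has_integral
        (C / (2*L) * exp (2 * L * t) - C / (2*L) * exp (2 * L * 0))) {0..t}"
      using Suc.prems L
      by (intro fundamental_theorem_of_calculus)
         (auto intro!: derivative_eq_intros simp flip: has_real_derivative_iff_has_vector_derivative)
    have "P (Suc (Suc k)) t - P (Suc k) t =
        integral {0..t} (\<lambda>s. F (P (Suc k) s) - F (P k s))"
      by (subst integral_diff) (auto simp: PS[of "Suc k"] PS[of k t] intro!: integrable_continuous_real contFP)
    also have "norm \<dots> \<le> integral {0..t} (\<lambda>s. C * exp (2 * L * s))"
    proof (rule integral_norm_bound_integral)
      show "(\<lambda>s. F (P (Suc k) s) - F (P k s)) integrable_on {0..t}"
        by (intro integrable_continuous_real continuous_intros contFP)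
      show "(\<lambda>s. C * exp (2 * L * s)) integrable_on {0..t}" using I by blast
      fix s assume s: "s \<in> {0..t}"
      have "norm (F (P (Suc k) s) - F (P k s)) \<le> L * norm (P (Suc k) s - P k s)" by (rule lip)
      also have "\<dots> \<le> L * (M * s * exp (2 * L * s) * (1/2)^k)"
        using Suc.IH[of s] s L by (intro mult_left_mono) auto
      also have "\<dots> \<le> L * (M * t * exp (2 * L * s) * (1/2)^k)"
        using s L M0 by (intro mult_left_mono mult_right_mono) auto
      finally show "norm (F (P (Suc k) s) - F (P k s)) \<le> C * exp (2 * L * s)"
        by (simp add: C_def mult_ac)
    qed
    also have "\<dots> = C / (2*L) * exp (2 * L * t) - C / (2*L)"
      using integral_unique[OF I] by simp
    also have "\<dots> \<le> C / (2*L) * exp (2 * L * t)" using C0 L by simp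
    also have "\<dots> = M * t * exp (2 * L * t) * (1/2)^Suc k"
      using L by (simp add: C_def field_simps)
    finally show ?case .
  qed
  define \<zeta> where "\<zeta> t = z0 + (\<Sum>i. P (Suc i) t - P i t)" for t
  have Psum: "P n t = z0 + (\<Sum>i<n. P (Suc i) t - P i t)" for n t
    using sum_lessThan_telescope[of "\<lambda>i. P i t" n] by (simp add: P0)
  have summ: "summable (\<lambda>k. c * (1/2::real)^k)" for c
    by (intro summable_mult summable_geometric) auto
  have ulim: "uniform_limit {0..T} P \<zeta> sequentially" for T
  proof -
    have "uniform_limit {0..T} (\<lambda>n t. \<Sum>i<n. P (Suc i) t - P i t) (\<lambda>t. \<Sum>i. P (Suc i) t - P i t) sequentially"
    proof (rule Weierstrass_m_test)
      fix n t assume t: "t \<in> {0..T}"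
      have "norm (P (Suc n) t - P n t) \<le> M * t * exp (2 * L * t) * (1/2)^n" using t bound by auto
      also have "\<dots> \<le> M * T * exp (2 * L * T) * (1/2)^n"
        using t L M0 by (intro mult_right_mono mult_mono) auto
      finally show "norm (P (Suc n) t - P n t) \<le> M * T * exp (2 * L * T) * (1/2)^n" .
    qed (rule summ)
    from uniform_limit_add[OF uniform_limit_const[of "\<lambda>_. z0"] this]
    show ?thesis unfolding \<zeta>_def[abs_def] Psum[symmetric] .
  qed
  have lim: "(\<lambda>n. P n t) \<longlonglongrightarrow> \<zeta> t" if "t \<ge> 0" for t
    using tendsto_uniform_limitI[OF ulim[of t], of t] that by auto
  have int: "((\<lambda>s. F (\<zeta> s)) has_integral (\<zeta> t - z0)) {0..t}" if "t \<ge> 0" for t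
  proof -
    have "uniform_limit {0..t} (\<lambda>n s. F (P n s)) (\<lambda>s. F (\<zeta> s)) sequentially"
    proof (rule uniform_limitI)
      fix e :: real assume "e > 0"
      then have "e / L > 0" using L by simp
      from uniform_limitD[OF ulim[of t] this]
      show "\<forall>\<^sub>F n in sequentially. \<forall>s\<in>{0..t}. dist (F (P n s)) (F (\<zeta> s)) < e"
      proof eventually_elim
        case (elim n)
        show ?case
        proof
          fix s assume "s \<in> {0..t}"
          then have "dist (P n s) (\<zeta> s) < e / L" using elim by blast
          then have "L * norm (P n s - \<zeta> s) < e" using L by (simp add: dist_norm field_simps)
          then show "dist (F (P n s)) (F (\<zeta> s)) < e"
            using lip[of "P n s" "\<zeta> s"] by (simp add: dist_norm)
        qed
      qed
    qed
    then obtain I J where I: "\<And>n. ((\<lambda>s. F (P n s)) has_integral I n) {0..t}"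
      and J: "((\<lambda>s. F (\<zeta> s)) has_integral J) {0..t}" and IJ: "I \<longlonglongrightarrow> J"
      by (rule uniform_limit_integral[OF _ contFP]) auto
    have "P (Suc n) t = z0 + I n" for n using integral_unique[OF I[of n]] by (simp add: PS)
    then have "(\<lambda>n. z0 + I n) \<longlonglongrightarrow> \<zeta> t" using LIMSEQ_Suc[OF lim[OF that]] by simp
    moreover have "(\<lambda>n. z0 + I n) \<longlonglongrightarrow> z0 + J" by (intro tendsto_intros IJ)
    ultimately have "\<zeta> t = z0 + J" by (rule LIMSEQ_unique)
    then show ?thesis using J by simp
  qed
  have "norm (\<zeta> t - z0) \<le> 2 * norm (F z0) * t * exp (2 * L * t)" if "t \<ge> 0" for t
  proof -
    have s: "summable (\<lambda>k. M * t * exp (2 * L * t) * (1/2)^k)" by (rule summ)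
    have "norm (\<zeta> t - z0) = norm (\<Sum>i. P (Suc i) t - P i t)" by (simp add: \<zeta>_def)
    also have "\<dots> \<le> (\<Sum>k. M * t * exp (2 * L * t) * (1/2)^k)"
      by (rule norm_suminf_le[OF bound[OF that] s])
    also have "\<dots> = M * t * exp (2 * L * t) * 2"
      by (subst suminf_mult) (auto simp: suminf_geometric intro!: summable_geometric)
    finally show ?thesis by (simp add: M_def mult_ac)
  qed
  with int show ?thesis using that by blast
qed

text \<open>Turns solutions of the reversed equation into solutions of the original one.\<close>

lemma has_integral_time_reversal:
  fixes k :: "real \<Rightarrow> 'a::euclidean_space"
  assumes int: "\<And>t. \<lbrakk>0 \<le> t; t \<le> h\<rbrakk> \<Longrightarrow> (k has_integral (Z t - Z0)) {0..t}" and t: "0 \<le> t" "t \<le> h"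
  shows "((\<lambda>s. - k (h - s)) has_integral (Z (h - t) - Z h)) {0..t}"
proof -
  have 1: "(k has_integral (Z (h-t) - Z0)) {0..h-t}" and 2: "(k has_integral (Z h - Z0)) {0..h}"
    using int t by auto
  have "k integrable_on {h-t..h}"
    using integrable_on_subinterval[of k "{0..h}" "h-t" h] 2 t by auto
  then obtain J where J: "(k has_integral J) {h-t..h}" by blast
  have "(k has_integral (Z (h-t) - Z0 + J)) {0..h}"
    by (rule has_integral_combine[OF _ _ 1 J]) (use t in auto)
  then have Jeq: "J = Z h - Z (h-t)"
    using has_integral_unique[OF 2] by (metis add.commute add_diff_cancel_left' diff_add_eq diff_diff_eq2)
  have "((\<lambda>s. k (s + h)) has_integral J) {h-t-h..h-h}"
    by (rule has_integral_shift_real_ivl[OF J])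
  then have "((\<lambda>s. k (- s + h)) has_integral J) {- (h - h)..- (h-t-h)}"
    by (rule has_integral_reflect_lemma_real)
  then have "((\<lambda>s. k (h - s)) has_integral J) {0..t}" by (simp add: add.commute)
  from has_integral_neg[OF this] show ?thesis by (simp add: Jeq)
qed

lemma has_integral_shift_origin:
  fixes k :: "real \<Rightarrow> 'a::euclidean_space"
  assumes I: "(k has_integral I) {0..s}" and J: "(k has_integral J) {0..s + t}" and "0 \<le> s" "0 \<le> t"
  shows "((\<lambda>u. k (u + s)) has_integral (J - I)) {0..t}"
proof -
  have "k integrable_on {s..s+t}"
    using integrable_on_subinterval[of k "{0..s+t}" s "s+t"] J assms by auto
  then obtain K where K: "(k has_integral K) {s..s+t}" by blast
  have "(k has_integral (I + K)) {0..s+t}"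
    by (rule has_integral_combine[OF _ _ I K]) (use assms in auto)
  then have "K = J - I"
    using has_integral_unique[OF J] by (metis add_diff_cancel_left')
  then show ?thesis using has_integral_shift_real_ivl[OF K, of s] by simp
qed

section \<open>Semicontinuity and semilimits\<close>

lemma usc_on_open_sublevel:
  assumes "usc_on UNIV u"
  shows "open {w. u w < c}"
proof (subst open_subopen, intro ballI)
  fix z assume z: "z \<in> {w. u w < c}"
  then have "\<forall>\<^sub>F w in at z. u w < c" using assms unfolding usc_on_def by auto
  then obtain S where "open S" "z \<in> S" "\<And>w. w \<in> S \<Longrightarrow> w \<noteq> z \<Longrightarrow> u w < c"
    unfolding eventually_at_topological by auto
  then show "\<exists>T. open T \<and> z \<in> T \<and> T \<subseteq> {w. u w < c}" using z by (intro exI[of _ S]) auto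
qed

lemma usc_on_diff_continuous:
  fixes u k :: "'a::topological_space \<Rightarrow> real"
  assumes "usc_on UNIV u" "continuous_on UNIV k"
  shows "usc_on UNIV (\<lambda>w. u w - k w)"
  unfolding usc_on_def
proof (intro ballI allI impI)
  fix z c assume c: "c > u z - k z"
  define e where "e = (c - (u z - k z)) / 2"
  have e: "e > 0" using c by (simp add: e_def)
  have 1: "\<forall>\<^sub>F w in at z. u w < u z + e" using assms(1) e unfolding usc_on_def by simp
  have "(k \<longlongrightarrow> k z) (at z)" using assms(2) by (simp add: continuous_on_def)
  then have 2: "\<forall>\<^sub>F w in at z. k w > k z - e" using e by (intro order_tendstoD) auto
  show "\<forall>\<^sub>F w in at z. u w - k w < c"
    using 1 2 by eventually_elim (simp add: e_def field_simps)
qed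

text \<open>The open sublevel sets \<open>{w. u w < u z}\<close> with \<open>z \<in> K\<close> would otherwise cover \<open>K\<close>; the largest
  set of a finite subcover does not contain its own \<open>z\<close>.\<close>

lemma usc_on_attains_sup:
  fixes u :: "'a::topological_space \<Rightarrow> real"
  assumes u: "usc_on UNIV u" and K: "compact K" "K \<noteq> {}"
  obtains z where "z \<in> K" "\<And>w. w \<in> K \<Longrightarrow> u w \<le> u z"
proof -
  have "\<exists>z\<in>K. \<forall>w\<in>K. u w \<le> u z"
  proof (rule ccontr)
    assume neg: "\<not> ?thesis"
    have *: "\<exists>w\<in>K. u z < u w" if "z \<in> K" for z
      using neg that not_le by blast
    obtain C where C: "C \<subseteq> K" "finite C" "K \<subseteq> (\<Union>c\<in>C. {w. u w < u c})"
      by (rule compactE_image[OF K(1), of K "\<lambda>c. {w. u w < u c}"]) (use * usc_on_open_sublevel[OF u] in auto)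
    then have "C \<noteq> {}" using K by auto
    then obtain c where c: "c \<in> C" "\<And>d. d \<in> C \<Longrightarrow> u d \<le> u c"
      using Max_in[of "u ` C"] Max_ge[of "u ` C"] C(2) by (metis (no_types, lifting) finite_imageI image_iff image_is_empty)
    obtain w where w: "w \<in> K" "u c < u w" using * c(1) C(1) by blast
    then obtain d where "d \<in> C" "u w < u d" using C(3) by blast
    then show False using c(2)[of d] w by simp
  qed
  then show ?thesis using that by blast
qed

text \<open>This lemma and the next one replace the sequences in the definition by neighbourhoods of
  \<open>(0, x, y, t)\<close>.\<close>

lemma lower_semilimit_leI:
  fixes x :: "'x::metric_space" and y :: "'y::metric_space"
  assumes "\<And>d. d > 0 \<Longrightarrow> \<exists>e x' y' t'. 0 < e \<and> e < d \<and> dist x' x < d \<and> dist y' y < d \<and>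
     0 \<le> t' \<and> \<bar>t' - t\<bar> < d \<and> W e x' y' t' \<le> c"
  shows "lower_semilimit W x y t \<le> ereal c"
proof -
  have "\<forall>n. \<exists>e x' y' t'. 0 < e \<and> e < 1 / real (Suc n) \<and> dist x' x < 1 / real (Suc n) \<and>
      dist y' y < 1 / real (Suc n) \<and> 0 \<le> t' \<and> \<bar>t' - t\<bar> < 1 / real (Suc n) \<and> W e x' y' t' \<le> c"
    using assms by simp
  then obtain E X Y T where *: "\<And>n. 0 < E n" "\<And>n. E n < 1 / real (Suc n)" "\<And>n. dist (X n) x < 1 / real (Suc n)"
      "\<And>n. dist (Y n) y < 1 / real (Suc n)" "\<And>n. 0 \<le> T n" "\<And>n. \<bar>T n - t\<bar> < 1 / real (Suc n)"
      "\<And>n. W (E n) (X n) (Y n) (T n) \<le> c"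
    by metis
  have inv: "(\<lambda>n. 1 / real (Suc n)) \<longlonglongrightarrow> 0"
    using LIMSEQ_inverse_real_of_nat by (simp add: inverse_eq_divide)
  have "E \<longlonglongrightarrow> 0"
    by (rule tendsto_sandwich[OF _ _ tendsto_const inv])
      (use *(1,2) in \<open>auto intro!: always_eventually less_imp_le simp del: of_nat_Suc\<close>)
  moreover have "X \<longlonglongrightarrow> x"
    by (rule metric_tendsto_imp_tendsto[OF inv])
      (use *(3) in \<open>auto intro!: always_eventually less_imp_le simp del: of_nat_Suc simp: dist_norm\<close>)
  moreover have "Y \<longlonglongrightarrow> y"
    by (rule metric_tendsto_imp_tendsto[OF inv])
      (use *(4) in \<open>auto intro!: always_eventually less_imp_le simp del: of_nat_Suc simp: dist_norm\<close>)
  moreover have "T \<longlonglongrightarrow> t"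
    by (rule metric_tendsto_imp_tendsto[OF inv])
      (use *(6) in \<open>auto intro!: always_eventually less_imp_le simp del: of_nat_Suc simp: dist_norm\<close>)
  ultimately have "lower_semilimit W x y t \<le> liminf (\<lambda>n. ereal (W (E n) (X n) (Y n) (T n)))"
    unfolding lower_semilimit_def using *(1,5) 
    by (intro Inf_lower CollectI exI[of _ E] exI[of _ X] exI[of _ Y] exI[of _ T]) simp
  also have "\<dots> \<le> liminf (\<lambda>n. ereal c)"
    using *(7) by (intro Liminf_mono always_eventually) auto
  also have "\<dots> = ereal c" by (simp add: Liminf_const)
  finally show ?thesis .
qed

lemma lower_semilimit_lessD:
  fixes x :: "'x::metric_space" and y :: "'y::metric_space"
  assumes "lower_semilimit W x y t < ereal c" and d: "d > 0"
  shows "\<exists>e x' y' t'. 0 < e \<and> e < d \<and> dist x' x < d \<and> dist y' y < d \<and>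
     0 \<le> t' \<and> \<bar>t' - t\<bar> < d \<and> W e x' y' t' < c"
proof -
  obtain E X Y T where *: "\<And>n. E n > 0" "\<And>n. T n \<ge> 0" "E \<longlonglongrightarrow> 0" "X \<longlonglongrightarrow> x" "Y \<longlonglongrightarrow> y" "T \<longlonglongrightarrow> t"
    and lim: "liminf (\<lambda>n. ereal (W (E n) (X n) (Y n) (T n))) < ereal c"
    using assms(1) unfolding lower_semilimit_def Inf_less_iff by blast
  have "\<forall>\<^sub>F n in sequentially. E n < d \<and> dist (X n) x < d \<and> dist (Y n) y < d \<and> \<bar>T n - t\<bar> < d"
    using order_tendstoD(2)[OF *(3) d] tendstoD[OF *(4) d] tendstoD[OF *(5) d] tendstoD[OF *(6) d]
    by eventually_elim (simp add: dist_real_def)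
  moreover have "\<exists>\<^sub>F n in sequentially. W (E n) (X n) (Y n) (T n) < c"
  proof (rule ccontr)
    assume "\<not> ?thesis"
    then have "\<forall>\<^sub>F n in sequentially. ereal c \<le> ereal (W (E n) (X n) (Y n) (T n))"
      by (simp add: frequently_def not_less)
    then have "ereal c \<le> liminf (\<lambda>n. ereal (W (E n) (X n) (Y n) (T n)))" by (rule Liminf_bounded)
    then show False using lim by simp
  qed
  ultimately have "\<exists>\<^sub>F n in sequentially. W (E n) (X n) (Y n) (T n) < c \<and>
      E n < d \<and> dist (X n) x < d \<and> dist (Y n) y < d \<and> \<bar>T n - t\<bar> < d"
    by (elim frequently_rev_mp) (auto elim!: eventually_mono)
  then obtain n where "W (E n) (X n) (Y n) (T n) < c \<and>
      E n < d \<and> dist (X n) x < d \<and> dist (Y n) y < d \<and> \<bar>T n - t\<bar> < d"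
    using frequently_ex by blast
  then show ?thesis using * by blast
qed

lemma lower_semilimit_ge:
  fixes x :: "'x::metric_space" and y :: "'y::metric_space"
  assumes "d > 0" and "\<And>e x' y' t'. \<lbrakk>0 < e; e < d; dist x' x < d; dist y' y < d; 0 \<le> t'; \<bar>t' - t\<bar> < d\<rbrakk>
    \<Longrightarrow> c \<le> W e x' y' t'"
  shows "ereal c \<le> lower_semilimit W x y t"
proof (rule ccontr)
  assume "\<not> ?thesis"
  then have "lower_semilimit W x y t < ereal c" by simp
  from lower_semilimit_lessD[OF this assms(1)] show False using assms(2) by (meson not_less)
qed

lemma lower_semilimit_gtD:
  fixes x :: "'x::metric_space" and y :: "'y::metric_space"
  assumes "ereal c < lower_semilimit W x y t"
  obtains d where "d > 0" "\<And>e x' y' t'. \<lbrakk>0 < e; e < d; dist x' x < d; dist y' y < d; 0 \<le> t'; \<bar>t' - t\<bar> < d\<rbrakk>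
    \<Longrightarrow> c < W e x' y' t'"
proof -
  have "\<not> lower_semilimit W x y t \<le> ereal c" using assms by simp
  then have "\<exists>d>0. \<forall>e x' y' t'. 0 < e \<and> e < d \<and> dist x' x < d \<and> dist y' y < d \<and>
     0 \<le> t' \<and> \<bar>t' - t\<bar> < d \<longrightarrow> c < W e x' y' t'"
    using lower_semilimit_leI[where W=W and x=x and y=y and t=t and c=c] by (meson not_less)
  then show ?thesis using that by blast
qed

text \<open>A strict pointwise lower bound for the semilimit holds on neighbourhoods, for all small \<open>\<epsilon>\<close>;
  finitely many of these cover a compact set.\<close>

lemma semilimit_uniform_on_compact:
  fixes W :: "real \<Rightarrow> 'x::metric_space \<Rightarrow> 'y::metric_space \<Rightarrow> real \<Rightarrow> real"
  assumes K: "compact K" and \<psi>: "continuous_on K \<psi>"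
    and less: "\<And>x y t. (x, y, t) \<in> K \<Longrightarrow> ereal (\<psi> (x, y, t)) < lower_semilimit W x y t"
  obtains \<delta> where "0 < \<delta>" "\<And>\<epsilon> x y t. \<lbrakk>0 < \<epsilon>; \<epsilon> < \<delta>; (x, y, t) \<in> K; 0 \<le> t\<rbrakk> \<Longrightarrow> \<psi> (x, y, t) < W \<epsilon> x y t"
proof -
  have "\<exists>r>0. \<forall>\<epsilon> x y t. 0 < \<epsilon> \<and> \<epsilon> < r \<and> (x, y, t) \<in> K \<inter> ball z r \<and> 0 \<le> t \<longrightarrow> \<psi> (x, y, t) < W \<epsilon> x y t"
    if z: "z \<in> K" for z
  proof -
    obtain x0 y0 t0 where z_eq: "z = (x0, y0, t0)" by (cases z)
    have "ereal (\<psi> z) < lower_semilimit W x0 y0 t0" using less z z_eq by simp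
    then obtain c where c: "\<psi> z < c" "ereal c < lower_semilimit W x0 y0 t0"
      using ereal_dense2 by (metis less_ereal.simps(1))
    obtain d where d: "d > 0" "\<And>e x' y' t'. \<lbrakk>0 < e; e < d; dist x' x0 < d; dist y' y0 < d; 0 \<le> t'; \<bar>t' - t0\<bar> < d\<rbrakk>
      \<Longrightarrow> c < W e x' y' t'" using lower_semilimit_gtD[OF c(2)] by metis
    have "(\<psi> \<longlongrightarrow> \<psi> z) (at z within K)" using \<psi> z by (simp add: continuous_on_def)
    then have "\<forall>\<^sub>F w in at z within K. \<psi> w < c" using c(1) by (rule order_tendstoD)
    then obtain r where r: "r > 0" "\<And>w. \<lbrakk>w \<in> K; w \<noteq> z; dist w z < r\<rbrakk> \<Longrightarrow> \<psi> w < c"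
      unfolding eventually_at by auto
    show ?thesis
    proof (intro exI[of _ "min r d"] conjI allI impI)
      show "0 < min r d" using r d by simp
      fix \<epsilon> x y t assume *: "0 < \<epsilon> \<and> \<epsilon> < min r d \<and> (x, y, t) \<in> K \<inter> ball z (min r d) \<and> 0 \<le> t"
      then have near: "dist (x, y, t) z < min r d" by (simp add: dist_commute)
      have "\<psi> (x, y, t) < c" using r(2)[of "(x, y, t)"] * near c(1) by (cases "(x, y, t) = z") auto
      moreover have "dist x x0 < d" "dist (y, t) (y0, t0) < d"
        using near dist_fst_le[of "(x, y, t)" z] dist_snd_le[of "(x, y, t)" z] by (auto simp: z_eq)
      then have "dist x x0 < d" "dist y y0 < d" "\<bar>t - t0\<bar> < d"
        using dist_fst_le[of "(y, t)" "(y0, t0)"] dist_snd_le[of "(y, t)" "(y0, t0)"]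
        by (auto simp: dist_real_def)
      then have "c < W \<epsilon> x y t" using * by (intro d(2)) auto
      ultimately show "\<psi> (x, y, t) < W \<epsilon> x y t" by simp
    qed
  qed
  then obtain r where r: "\<And>z. z \<in> K \<Longrightarrow> 0 < r z"
    "\<And>z \<epsilon> x y t. \<lbrakk>z \<in> K; 0 < \<epsilon>; \<epsilon> < r z; (x, y, t) \<in> K; (x, y, t) \<in> ball z (r z); 0 \<le> t\<rbrakk> \<Longrightarrow> \<psi> (x, y, t) < W \<epsilon> x y t"
    by (metis IntI)
  obtain C where C: "C \<subseteq> K" "finite C" "K \<subseteq> (\<Union>c\<in>C. ball c (r c))"
    by (rule compactE_image[OF K, of K "\<lambda>c. ball c (r c)"]) (use r(1) in auto)
  define \<delta> where "\<delta> = Min (insert 1 (r ` C))"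
  have "0 < \<delta>" unfolding \<delta>_def using C r(1) by (subst Min_gr_iff) auto
  moreover have "\<psi> (x, y, t) < W \<epsilon> x y t" if "0 < \<epsilon>" "\<epsilon> < \<delta>" "(x, y, t) \<in> K" "0 \<le> t" for \<epsilon> x y t
  proof -
    obtain c where c: "c \<in> C" "(x, y, t) \<in> ball c (r c)" using C(3) \<open>(x, y, t) \<in> K\<close> by blast
    have "\<delta> \<le> r c" unfolding \<delta>_def using c C(2) by (intro Min_le) auto
    then show ?thesis using r(2)[of c \<epsilon> x y t] c C(1) that by auto
  qed
  ultimately show ?thesis by (rule that)
qed

section \<open>Controls and concatenation\<close>

text \<open>At \<open>s = h\<close> the first path wins. For states both choices agree, and for controls a single time is
  irrelevant.\<close>

definition concat_at :: "real \<Rightarrow> (real \<Rightarrow> 'a) \<Rightarrow> (real \<Rightarrow> 'a) \<Rightarrow> real \<Rightarrow> 'a" where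
  "concat_at h u v s = (if s \<le> h then u s else v (s - h))"

lemma has_integral_concat_at:
  fixes u v :: "real \<Rightarrow> 'a::euclidean_space"
  assumes u: "(u has_integral I) {0..h}" and v: "(v has_integral J) {0..t}" and "0 \<le> h" "0 \<le> t"
  shows "(concat_at h u v has_integral (I + J)) {0..h + t}"
proof (rule has_integral_combine[of 0 h "h + t"])
  show "(concat_at h u v has_integral I) {0..h}"
    by (rule has_integral_eq[OF _ u]) (simp add: concat_at_def)
  have "((\<lambda>s. v (s - h)) has_integral J) {h..h + t}"
    using has_integral_shift_real_ivl[OF v, of "-h"] by (simp add: add.commute)
  then show "(concat_at h u v has_integral J) {h..h + t}"
    by (rule has_integral_spike_finite[of "{h}", rotated 2]) (auto simp: concat_at_def)
qed (use assms in auto)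

lemma continuous_on_integral_curve:
  fixes Z :: "real \<Rightarrow> 'a::euclidean_space"
  assumes Z: "\<And>s. \<lbrakk>0 \<le> s; s \<le> t\<rbrakk> \<Longrightarrow> (k has_integral (Z s - z)) {0..s}"
  shows "continuous_on {0..t} Z"
proof (cases "t \<ge> 0")
  case True
  have "continuous_on {0..t} (\<lambda>s. z + integral {0..s} k)"
    using Z[OF True] by (intro continuous_intros indefinite_integral_continuous_1) auto
  moreover have "z + integral {0..s} k = Z s" if "s \<in> {0..t}" for s
    using integral_unique[OF Z[of s]] that by simp
  ultimately show ?thesis by (rule continuous_on_eq)
qed simp

lemma lebesgue_measurable_translation:
  fixes \<beta> :: "real \<Rightarrow> 'a::euclidean_space"
  assumes "\<beta> \<in> borel_measurable lebesgue"
  shows "(\<lambda>s. \<beta> (s + c)) \<in> borel_measurable lebesgue"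
proof -
  have "(\<lambda>s::real. c + s) \<in> lebesgue \<rightarrow>\<^sub>M lebesgue"
    using lebesgue_affine_measurable[of "\<lambda>_::real. 1" c] by simp
  from measurable_compose[OF this assms] show ?thesis by (simp add: add.commute)
qed

lemma const_control: "a \<in> A \<Longrightarrow> (\<lambda>_. a) \<in> controls A"
  by (simp add: controls_def)

text \<open>Extension by \<open>0\<close> gives a function measurable on the whole line, where translation invariance of
  Lebesgue measurability applies.\<close>

lemma controls_extend:
  assumes "\<alpha> \<in> controls A"
  shows "(\<lambda>s. if s \<in> {0..} then \<alpha> s else 0) \<in> borel_measurable lebesgue"
  using assms unfolding controls_def
  by (intro borel_measurable_if_I) auto

lemma shift_control:
  assumes \<alpha>: "\<alpha> \<in> controls A" and h: "0 \<le> h"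
  shows "(\<lambda>s. \<alpha> (s + h)) \<in> controls A"
proof -
  have "(\<lambda>s. if s + h \<in> {0..} then \<alpha> (s + h) else 0) \<in> borel_measurable (lebesgue_on {0..})"
    by (intro measurable_restrict_space1 lebesgue_measurable_translation[OF controls_extend[OF \<alpha>]])
  then have "(\<lambda>s. \<alpha> (s + h)) \<in> borel_measurable (lebesgue_on {0..})"
    by (rule measurable_cong[THEN iffD1, rotated]) (use h in \<open>auto\<close>)
  then show ?thesis using \<alpha> h by (auto simp: controls_def)
qed

lemma concat_control:
  assumes \<alpha>: "\<alpha> \<in> controls A" and h: "0 \<le> h" and a: "a \<in> A"
  shows "concat_at h (\<lambda>_. a) \<alpha> \<in> controls A"
proof -
  have "(\<lambda>s. if s \<le> h then a else (if s + (-h) \<in> {0..} then \<alpha> (s + (-h)) else 0)) \<in> borel_measurable lebesgue"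
  proof (rule measurable_If)
    show "(\<lambda>s. if s + (-h) \<in> {0..} then \<alpha> (s + (-h)) else 0) \<in> borel_measurable lebesgue"
      by (rule lebesgue_measurable_translation[OF controls_extend[OF \<alpha>]])
    have "{x \<in> space lebesgue. x \<le> h} = {..h}" by auto
    then show "{x \<in> space lebesgue. x \<le> h} \<in> sets lebesgue" by simp
  qed simp
  also have "(\<lambda>s. if s \<le> h then a else (if s + (-h) \<in> {0..} then \<alpha> (s + (-h)) else 0)) = concat_at h (\<lambda>_. a) \<alpha>"
    by (auto simp: concat_at_def)
  finally have "concat_at h (\<lambda>_. a) \<alpha> \<in> borel_measurable (lebesgue_on {0..})"
    by (intro measurable_restrict_space1)
  then show ?thesis using \<alpha> a by (auto simp: controls_def concat_at_def)
qed

lemma integrable_along_continuous_path: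
  fixes k :: "'x::euclidean_space \<Rightarrow> 'y::euclidean_space \<Rightarrow> 'c::euclidean_space \<Rightarrow> 'd::euclidean_space"
  assumes k: "continuous_on (UNIV \<times> UNIV \<times> A) (\<lambda>(x, y, a). k x y a)" and A: "compact A"
    and \<alpha>: "\<alpha> \<in> controls A" and \<xi>: "continuous_on {s..t} \<xi>" and \<eta>: "continuous_on {s..t} \<eta>" and s: "0 \<le> s"
  shows "(\<lambda>s. k (\<xi> s) (\<eta> s) (\<alpha> s)) integrable_on {s..t}"
proof -
  let ?z = "\<lambda>s. (\<xi> s, \<eta> s, \<alpha> s)" and ?S = "UNIV \<times> UNIV \<times> A"
  have "\<alpha> \<in> borel_measurable (lebesgue_on {0..})" using \<alpha> by (simp add: controls_def)
  then have "\<alpha> \<in> borel_measurable (lebesgue_on {s..t})"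
    by (rule measurable_restrict_mono) (use s in auto)
  moreover have "\<xi> \<in> borel_measurable (lebesgue_on {s..t})" "\<eta> \<in> borel_measurable (lebesgue_on {s..t})"
    using \<xi> \<eta> by (auto intro: continuous_imp_measurable_on_sets_lebesgue)
  ultimately have "?z \<in> borel_measurable (lebesgue_on {s..t})" by (intro borel_measurable_Pair)
  moreover have "?z \<in> space (lebesgue_on {s..t}) \<rightarrow> ?S" using \<alpha> s by (auto simp: controls_def)
  ultimately have "?z \<in> measurable (lebesgue_on {s..t}) (restrict_space borel ?S)"
    by (intro measurable_restrict_space2)
  from measurable_compose[OF this borel_measurable_continuous_on_restrict[OF k]]
  have meas: "(\<lambda>s. k (\<xi> s) (\<eta> s) (\<alpha> s)) \<in> borel_measurable (lebesgue_on {s..t})" by simp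
  have "compact (\<xi> ` {s..t} \<times> \<eta> ` {s..t} \<times> A)"
    using \<xi> \<eta> A by (intro compact_Times compact_continuous_image) auto
  then have "compact ((\<lambda>(x, y, a). k x y a) ` (\<xi> ` {s..t} \<times> \<eta> ` {s..t} \<times> A))"
    by (intro compact_continuous_image continuous_on_subset[OF k]) auto
  from compact_imp_bounded[OF this] obtain B where
    B: "\<And>v. v \<in> (\<lambda>(x, y, a). k x y a) ` (\<xi> ` {s..t} \<times> \<eta> ` {s..t} \<times> A) \<Longrightarrow> norm v \<le> B"
    unfolding bounded_iff by blast
  show ?thesis
  proof (rule measurable_bounded_by_integrable_imp_integrable[OF meas])
    show "(\<lambda>_. B) integrable_on {s..t}" by (rule integrable_const_ivl)
    fix u assume "u \<in> {s..t}"
    then show "norm (k (\<xi> u) (\<eta> u) (\<alpha> u)) \<le> B"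
      using \<alpha> s by (intro B) (force simp: controls_def)
  qed simp
qed

section \<open>The standing assumptions\<close>

locale slow_fast_system =
  fixes f :: "'x::euclidean_space \<Rightarrow> 'y::euclidean_space \<Rightarrow> 'c::euclidean_space \<Rightarrow> 'x"
    and g :: "'x \<Rightarrow> 'y \<Rightarrow> 'c \<Rightarrow> 'y"
    and l :: "'x \<Rightarrow> 'y \<Rightarrow> 'c \<Rightarrow> real"
    and u0 :: "'x \<Rightarrow> 'y \<Rightarrow> real"
    and A :: "'c set"
    and L0 Q0 :: real
  assumes compact_A: "compact A"
    and cont_f: "continuous_on (UNIV \<times> UNIV \<times> A) (\<lambda>(x, y, a). f x y a)"
    and cont_g: "continuous_on (UNIV \<times> UNIV \<times> A) (\<lambda>(x, y, a). g x y a)"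
    and cont_l: "continuous_on (UNIV \<times> UNIV \<times> A) (\<lambda>(x, y, a). l x y a)"
    and cont_u0: "continuous_on UNIV (\<lambda>(x, y). u0 x y)"
    and L0_pos: "L0 > 0"
    and lipschitz_f: "\<And>x1 y1 x2 y2 a. a \<in> A \<Longrightarrow>
      norm (f x1 y1 a - f x2 y2 a) \<le> L0 * (norm (x1 - x2) + norm (y1 - y2))"
    and lipschitz_g: "\<And>x1 y1 x2 y2 a. a \<in> A \<Longrightarrow>
      norm (g x1 y1 a - g x2 y2 a) \<le> L0 * (norm (x1 - x2) + norm (y1 - y2))"
    and bounded_f: "\<And>x y a. a \<in> A \<Longrightarrow> norm (f x y a) \<le> Q0"
    and controllable: "\<And>K. compact K \<Longrightarrow>
      \<exists>r>0. \<forall>(x, y)\<in>K. ball 0 r \<subseteq> closure (convex hull ((\<lambda>a. g x y a) ` A))"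
    and coercive_l: "\<And>B. compact B \<Longrightarrow> B \<noteq> {} \<Longrightarrow>
      filterlim (\<lambda>y. INF (x, a)\<in>B \<times> A. l x y a) at_top at_infinity"
    and lower_bound_u0: "\<And>x y. u0 x y \<ge> - Q0"
begin

lemma A_nonempty: "A \<noteq> {}"
proof
  assume "A = {}"
  moreover obtain r where "r > 0" "ball 0 r \<subseteq> closure (convex hull ((\<lambda>a. g 0 0 a) ` A))"
    using controllable[of "{(0,0)}"] by auto
  ultimately show False by simp
qed

lemma Q0_nonneg: "0 \<le> Q0"
  using A_nonempty bounded_f norm_ge_zero order_trans by (metis ex_in_conv)

lemma bounded_on_compact:
  fixes k :: "'x \<Rightarrow> 'y \<Rightarrow> 'c \<Rightarrow> 'd::real_normed_vector"
  assumes k: "continuous_on (UNIV \<times> UNIV \<times> A) (\<lambda>(x, y, a). k x y a)" and "compact X" "compact Y"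
  obtains C where "0 \<le> C" "\<And>x y a. \<lbrakk>x \<in> X; y \<in> Y; a \<in> A\<rbrakk> \<Longrightarrow> norm (k x y a) \<le> C"
proof -
  have "compact ((\<lambda>(x, y, a). k x y a) ` (X \<times> Y \<times> A))"
    using assms compact_A by (intro compact_continuous_image continuous_on_subset[OF k] compact_Times) auto
  from compact_imp_bounded[OF this] obtain B where
    B: "\<And>v. v \<in> (\<lambda>(x, y, a). k x y a) ` (X \<times> Y \<times> A) \<Longrightarrow> norm v \<le> B"
    unfolding bounded_iff by blast
  have "norm (k x y a) \<le> \<bar>B\<bar>" if "x \<in> X" "y \<in> Y" "a \<in> A" for x y a
    using B[of "k x y a"] that by force
  then show ?thesis using that[of "\<bar>B\<bar>"] by simp
qed

lemma uniformly_continuous_on_compact: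
  fixes k :: "'x \<Rightarrow> 'y \<Rightarrow> 'c \<Rightarrow> 'd::real_normed_vector"
  assumes k: "continuous_on (UNIV \<times> UNIV \<times> A) (\<lambda>(x, y, a). k x y a)" and XY: "compact X" "compact Y"
    and e: "e > 0"
  obtains d where "0 < d" "\<And>x x' y y' a. \<lbrakk>x \<in> X; x' \<in> X; y \<in> Y; y' \<in> Y; a \<in> A; dist x x' \<le> d; dist y y' \<le> d\<rbrakk>
      \<Longrightarrow> norm (k x y a - k x' y' a) \<le> e"
proof -
  have "uniformly_continuous_on (X \<times> Y \<times> A) (\<lambda>(x, y, a). k x y a)"
    using XY compact_A by (intro compact_uniformly_continuous continuous_on_subset[OF k] compact_Times) auto
  then obtain d where d: "d > 0" "\<And>z z'. \<lbrakk>z \<in> X \<times> Y \<times> A; z' \<in> X \<times> Y \<times> A; dist z' z < d\<rbrakk> \<Longrightarrow>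
      dist ((\<lambda>(x, y, a). k x y a) z') ((\<lambda>(x, y, a). k x y a) z) < e"
    unfolding uniformly_continuous_on_def using e by metis
  have "norm (k x y a - k x' y' a) \<le> e"
    if "x \<in> X" "x' \<in> X" "y \<in> Y" "y' \<in> Y" "a \<in> A" "dist x x' \<le> d/3" "dist y y' \<le> d/3" for x x' y y' a
  proof -
    have "dist (x, y, a) (x', y', a) \<le> dist x x' + dist y y'"
      by (simp add: dist_Pair_Pair sqrt_sum_squares_le_sum)
    then have "dist (x, y, a) (x', y', a) < d" using that d(1) by simp
    then show ?thesis using d(2)[of "(x', y', a)" "(x, y, a)"] that by (simp add: dist_norm)
  qed
  then show ?thesis using that[of "d/3"] d(1) by simp
qed

text \<open>The assumed limit concerns the infimum over a ball, which is a lower bound for each value because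
  the set of values is bounded below by compactness.\<close>

lemma l_coercive:
  obtains R where "0 \<le> R" "\<And>x y a. \<lbrakk>x \<in> cball xc \<rho>; norm y \<ge> R; a \<in> A\<rbrakk> \<Longrightarrow> C \<le> l x y a"
proof (cases "\<rho> \<ge> 0")
  case True
  then have "\<forall>\<^sub>F y in at_infinity. C \<le> (INF (x, a)\<in>cball xc \<rho> \<times> A. l x y a)"
    using coercive_l[of "cball xc \<rho>"] by (simp add: filterlim_at_top)
  then obtain R where R: "\<And>y. norm y \<ge> R \<Longrightarrow> C \<le> (INF (x, a)\<in>cball xc \<rho> \<times> A. l x y a)"
    unfolding eventually_at_infinity by blast
  have "C \<le> l x y a" if xya: "x \<in> cball xc \<rho>" "norm y \<ge> \<bar>R\<bar>" "a \<in> A" for x y a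
  proof -
    obtain B where B: "\<And>x' y' a'. \<lbrakk>x' \<in> cball xc \<rho>; y' \<in> {y}; a' \<in> A\<rbrakk> \<Longrightarrow> norm (l x' y' a') \<le> B"
      by (rule bounded_on_compact[OF cont_l, of "cball xc \<rho>" "{y}"]) auto
    have "C \<le> (INF (x, a)\<in>cball xc \<rho> \<times> A. l x y a)" using R that by simp
    also have "\<dots> \<le> l x y a"
    proof (rule cINF_lower2[of _ _ "(x, a)"])
      show "bdd_below ((\<lambda>(x, a). l x y a) ` (cball xc \<rho> \<times> A))"
        using B by (intro bdd_belowI[of _ "-B"]) (force simp: abs_le_iff)
    qed (use that in auto)
    finally show ?thesis .
  qed
  then show ?thesis using that[of "\<bar>R\<bar>"] by simp
next
  case False
  then show ?thesis using that[of 0] by simp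
qed

lemma l_bounded_below:
  obtains C where "0 \<le> C" "\<And>x y a. \<lbrakk>x \<in> cball xc \<rho>; a \<in> A\<rbrakk> \<Longrightarrow> - C \<le> l x y a"
proof -
  obtain R where R: "\<And>x y a. \<lbrakk>x \<in> cball xc \<rho>; norm y \<ge> R; a \<in> A\<rbrakk> \<Longrightarrow> 0 \<le> l x y a"
    using l_coercive[of xc \<rho> 0] by metis
  obtain C where C: "0 \<le> C" "\<And>x y a. \<lbrakk>x \<in> cball xc \<rho>; y \<in> cball 0 R; a \<in> A\<rbrakk> \<Longrightarrow> norm (l x y a) \<le> C"
    using bounded_on_compact[OF cont_l, of "cball xc \<rho>" "cball 0 R"] by auto
  have "- C \<le> l x y a" if "x \<in> cball xc \<rho>" "a \<in> A" for x y a
    using R[of x y a] C(2)[of x y a] C(1) that by (cases "norm y \<ge> R") (auto simp: abs_le_iff)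
  then show ?thesis using that C(1) by blast
qed

text \<open>Otherwise \<open>v \<bullet> g x y a > - r * norm v\<close> for all \<open>a\<close>, so the closed convex hull of the velocities
  lies in a half-space which misses part of the ball of radius \<open>2 * r\<close> that controllability places in
  this hull. Only the support function matters here, and it is the same for a set and its closed convex
  hull.\<close>

lemma steering:
  assumes "compact K"
  obtains r where "r > 0" "\<And>x y v. (x, y) \<in> K \<Longrightarrow> \<exists>a\<in>A. v \<bullet> g x y a \<le> - r * norm v"
proof -
  obtain r where r: "r > 0" "\<And>x y. (x, y) \<in> K \<Longrightarrow> ball 0 r \<subseteq> closure (convex hull ((\<lambda>a. g x y a) ` A))"
    using controllable[OF assms] by blast
  have "\<exists>a\<in>A. v \<bullet> g x y a \<le> - (r/2) * norm v" if K: "(x, y) \<in> K" for x y v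
  proof (cases "v = 0")
    case True
    then show ?thesis using A_nonempty by auto
  next
    case False
    show ?thesis
    proof (rule ccontr)
      assume "\<not> ?thesis"
      then have "(\<lambda>a. g x y a) ` A \<subseteq> {w. v \<bullet> w \<ge> - (r/2) * norm v}" by force
      then have "convex hull ((\<lambda>a. g x y a) ` A) \<subseteq> {w. v \<bullet> w \<ge> - (r/2) * norm v}"
        by (rule hull_minimal) (rule convex_halfspace_ge)
      then have "closure (convex hull ((\<lambda>a. g x y a) ` A)) \<subseteq> {w. v \<bullet> w \<ge> - (r/2) * norm v}"
        by (rule closure_minimal) (rule closed_halfspace_ge)
      moreover have "- (3 * r / (4 * norm v)) *\<^sub>R v \<in> ball 0 r" using r(1) False by simp
      ultimately have "v \<bullet> (- (3 * r / (4 * norm v)) *\<^sub>R v) \<ge> - (r/2) * norm v"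
        using r(2)[OF K] by blast
      moreover have "v \<bullet> (- (3 * r / (4 * norm v)) *\<^sub>R v) = - (3 * r / 4) * norm v"
        using False by (simp add: dot_square_norm power2_eq_square)
      ultimately have "(r / 4) * norm v \<le> 0" by (simp only:)
      then show False using r(1) False by (simp add: mult_le_0_iff)
    qed
  qed
  then show ?thesis using that[of "r/2"] r(1) by simp
qed

section \<open>Trajectories\<close>

abbreviation along :: "('x \<Rightarrow> 'y \<Rightarrow> 'c \<Rightarrow> 'd) \<Rightarrow> (real \<Rightarrow> 'x) \<Rightarrow> (real \<Rightarrow> 'y) \<Rightarrow> (real \<Rightarrow> 'c) \<Rightarrow> real \<Rightarrow> 'd" where
  "along k \<xi> \<eta> \<alpha> \<equiv> \<lambda>s. k (\<xi> s) (\<eta> s) (\<alpha> s)"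

lemma trajectory_init:
  assumes "trajectory f g \<epsilon> x y \<alpha> \<xi> \<eta>"
  shows "\<xi> 0 = x" "\<eta> 0 = y"
proof -
  have *: "I = 0" if "(k has_integral I) {0..0::real}" for k and I :: "'d::euclidean_space"
    using has_integral_unique[OF that] has_integral_refl(2)[of k 0] by simp
  show "\<xi> 0 = x" "\<eta> 0 = y"
    using assms *[of _ "\<xi> 0 - x"] *[of _ "\<eta> 0 - y"] unfolding trajectory_def by force+
qed

lemma trajectory_continuous:
  assumes "trajectory f g \<epsilon> x y \<alpha> \<xi> \<eta>" and "0 \<le> s"
  shows "continuous_on {s..t} \<xi>" "continuous_on {s..t} \<eta>"
proof -
  have "continuous_on {0..t} \<xi>" "continuous_on {0..t} \<eta>"
    using assms(1) unfolding trajectory_def by (auto intro!: continuous_on_integral_curve)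
  then show "continuous_on {s..t} \<xi>" "continuous_on {s..t} \<eta>"
    using assms(2) by (auto elim!: continuous_on_subset)
qed

lemma trajectory_integrable:
  fixes k :: "'x \<Rightarrow> 'y \<Rightarrow> 'c \<Rightarrow> 'd::euclidean_space"
  assumes k: "continuous_on (UNIV \<times> UNIV \<times> A) (\<lambda>(x, y, a). k x y a)"
    and "trajectory f g \<epsilon> x y \<alpha> \<xi> \<eta>" "\<alpha> \<in> controls A" "0 \<le> s"
  shows "(\<lambda>s. k (\<xi> s) (\<eta> s) (\<alpha> s)) integrable_on {s..t}"
  by (rule integrable_along_continuous_path[OF k compact_A assms(3) trajectory_continuous[OF assms(2,4)] assms(4)])

lemma trajectory_increment:
  assumes "trajectory f g \<epsilon> x y \<alpha> \<xi> \<eta>" "0 \<le> s" "s \<le> t"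
  shows "((\<lambda>s. \<epsilon> *\<^sub>R f (\<xi> s) (\<eta> s) (\<alpha> s)) has_integral (\<xi> t - \<xi> s)) {s..t}"
    and "((\<lambda>s. g (\<xi> s) (\<eta> s) (\<alpha> s)) has_integral (\<eta> t - \<eta> s)) {s..t}"
proof -
  have *: "(k has_integral (Z t - Z s)) {s..t}" if Z: "\<And>s. s \<ge> 0 \<Longrightarrow> (k has_integral (Z s - z)) {0..s}"
    for k Z and z :: "'d::euclidean_space"
  proof -
    have "((\<lambda>u. k (u + s)) has_integral ((Z t - z) - (Z s - z))) {0..t-s}"
      using assms by (intro has_integral_shift_origin Z) (auto intro!: Z)
    from has_integral_shift_real_ivl[OF this, of "-s"] show ?thesis by simp
  qed
  show "((\<lambda>s. \<epsilon> *\<^sub>R f (\<xi> s) (\<eta> s) (\<alpha> s)) has_integral (\<xi> t - \<xi> s)) {s..t}"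
       "((\<lambda>s. g (\<xi> s) (\<eta> s) (\<alpha> s)) has_integral (\<eta> t - \<eta> s)) {s..t}"
    using assms(1) unfolding trajectory_def by (auto intro!: *)
qed

lemma trajectory_slow_speed:
  assumes tr: "trajectory f g \<epsilon> x y \<alpha> \<xi> \<eta>" and \<alpha>: "\<alpha> \<in> controls A" and "0 \<le> s" "s \<le> t" and "0 \<le> \<epsilon>"
  shows "norm (\<xi> t - \<xi> s) \<le> \<epsilon> * Q0 * (t - s)"
proof -
  have "norm (\<xi> t - \<xi> s) \<le> \<epsilon> * Q0 * measure lborel (cbox s t)"
  proof (rule has_integral_bound)
    show "((\<lambda>s. \<epsilon> *\<^sub>R f (\<xi> s) (\<eta> s) (\<alpha> s)) has_integral (\<xi> t - \<xi> s)) (cbox s t)"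
      using trajectory_increment[OF tr assms(3,4)] by simp
    fix u assume "u \<in> cbox s t"
    then have "\<alpha> u \<in> A" using \<alpha> assms(3) by (simp add: controls_def)
    then show "norm (\<epsilon> *\<^sub>R f (\<xi> u) (\<eta> u) (\<alpha> u)) \<le> \<epsilon> * Q0"
      using bounded_f assms by (simp add: mult_left_mono)
  qed (use assms Q0_nonneg in auto)
  then show ?thesis using assms by simp
qed

lemma trajectory_shift:
  assumes tr: "trajectory f g \<epsilon> x y \<alpha> \<xi> \<eta>" and "0 \<le> s"
  shows "trajectory f g \<epsilon> (\<xi> s) (\<eta> s) (\<lambda>u. \<alpha> (u + s)) (\<lambda>u. \<xi> (u + s)) (\<lambda>u. \<eta> (u + s))"
  unfolding trajectory_def
proof (intro allI impI)
  fix t :: real assume t: "0 \<le> t"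
  show "((\<lambda>u. \<epsilon> *\<^sub>R f (\<xi> (u + s)) (\<eta> (u + s)) (\<alpha> (u + s))) has_integral (\<xi> (t + s) - \<xi> s)) {0..t} \<and>
    ((\<lambda>u. g (\<xi> (u + s)) (\<eta> (u + s)) (\<alpha> (u + s))) has_integral (\<eta> (t + s) - \<eta> s)) {0..t}"
    using has_integral_shift_real_ivl[OF trajectory_increment(1)[OF tr assms(2), of "t+s"], of s]
      has_integral_shift_real_ivl[OF trajectory_increment(2)[OF tr assms(2), of "t+s"], of s] t by simp
qed

text \<open>Solutions with constant control, up to time \<open>h\<close>: of the controlled dynamics for \<open>\<sigma> = 1\<close>, of the
  time-reversed dynamics for \<open>\<sigma> = - 1\<close>.\<close>

definition steady_arc :: "real \<Rightarrow> real \<Rightarrow> 'c \<Rightarrow> real \<Rightarrow> 'x \<Rightarrow> 'y \<Rightarrow> (real \<Rightarrow> 'x) \<Rightarrow> (real \<Rightarrow> 'y) \<Rightarrow> bool" where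
  "steady_arc \<sigma> \<epsilon> a h x y \<xi> \<eta> \<longleftrightarrow>
     (\<forall>t. 0 \<le> t \<and> t \<le> h \<longrightarrow> ((\<lambda>s. (\<sigma> * \<epsilon>) *\<^sub>R f (\<xi> s) (\<eta> s) a) has_integral (\<xi> t - x)) {0..t} \<and>
             ((\<lambda>s. \<sigma> *\<^sub>R g (\<xi> s) (\<eta> s) a) has_integral (\<eta> t - y)) {0..t})"

lemma arc_exists:
  assumes a: "a \<in> A" and \<epsilon>: "0 < \<epsilon>" and \<sigma>: "\<bar>\<sigma>\<bar> = 1"
  obtains \<xi> \<eta> where "\<And>h. steady_arc \<sigma> \<epsilon> a h x y \<xi> \<eta>"
    "\<And>t. 0 \<le> t \<Longrightarrow> norm (\<eta> t - y) \<le> 2 * (\<epsilon> * Q0 + norm (g x y a)) * t * exp (4 * (\<epsilon> + 1) * L0 * t)"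
proof -
  define F where "F = (\<lambda>(x, y). ((\<sigma> * \<epsilon>) *\<^sub>R f x y a, \<sigma> *\<^sub>R g x y a))"
  define L where "L = 2 * (\<epsilon> + 1) * L0"
  have L: "L > 0" using \<epsilon> L0_pos by (simp add: L_def)
  have lip: "norm (F z - F w) \<le> L * norm (z - w)" for z w
  proof -
    obtain x1 y1 x2 y2 where zw: "z = (x1, y1)" "w = (x2, y2)" by (cases z; cases w)
    have "norm (F z - F w) \<le> norm ((\<sigma> * \<epsilon>) *\<^sub>R (f x1 y1 a - f x2 y2 a)) + norm (\<sigma> *\<^sub>R (g x1 y1 a - g x2 y2 a))"
      unfolding F_def zw by (simp add: scaleR_diff_right[symmetric] norm_Pair sqrt_sum_squares_le_sum)
    also have "\<dots> = \<epsilon> * norm (f x1 y1 a - f x2 y2 a) + norm (g x1 y1 a - g x2 y2 a)"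
      using \<sigma> \<epsilon> by (simp add: abs_mult)
    also have "\<dots> \<le> \<epsilon> * (L0 * (norm (x1 - x2) + norm (y1 - y2))) + L0 * (norm (x1 - x2) + norm (y1 - y2))"
      using lipschitz_f[OF a] lipschitz_g[OF a] \<epsilon> by (intro add_mono mult_left_mono) auto
    also have "\<dots> = (\<epsilon> + 1) * L0 * (norm (x1 - x2) + norm (y1 - y2))" by (simp add: algebra_simps)
    also have "\<dots> \<le> (\<epsilon> + 1) * L0 * (norm (z - w) + norm (z - w))"
      using \<epsilon> L0_pos norm_fst_le[of "x1 - x2" "y1 - y2"] norm_snd_le[of "y1 - y2" "x1 - x2"] zw
      by (intro mult_left_mono add_mono) auto
    finally show ?thesis by (simp add: L_def algebra_simps)
  qed
  obtain \<zeta> where \<zeta>: "\<And>t. t \<ge> 0 \<Longrightarrow> ((\<lambda>s. F (\<zeta> s)) has_integral (\<zeta> t - (x, y))) {0..t}"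
    "\<And>t. t \<ge> 0 \<Longrightarrow> norm (\<zeta> t - (x, y)) \<le> 2 * norm (F (x, y)) * t * exp (2 * L * t)"
    using lipschitz_ode_global_solution[OF lip L, of "(x, y)"] by blast
  show ?thesis
  proof
    show "steady_arc \<sigma> \<epsilon> a h x y (\<lambda>s. fst (\<zeta> s)) (\<lambda>s. snd (\<zeta> s))" for h
      unfolding steady_arc_def
    proof (intro allI impI)
      fix t assume "0 \<le> t \<and> t \<le> h"
      then have *: "((\<lambda>s. F (\<zeta> s)) has_integral (\<zeta> t - (x, y))) {0..t}" using \<zeta> by simp
      show "((\<lambda>s. (\<sigma> * \<epsilon>) *\<^sub>R f (fst (\<zeta> s)) (snd (\<zeta> s)) a) has_integral (fst (\<zeta> t) - x)) {0..t} \<and>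
             ((\<lambda>s. \<sigma> *\<^sub>R g (fst (\<zeta> s)) (snd (\<zeta> s)) a) has_integral (snd (\<zeta> t) - y)) {0..t}"
        using has_integral_linear[OF * bounded_linear_fst] has_integral_linear[OF * bounded_linear_snd]
        by (simp add: F_def o_def case_prod_unfold)
    qed
    fix t :: real assume t: "0 \<le> t"
    have "norm (F (x, y)) \<le> \<epsilon> * norm (f x y a) + norm (g x y a)"
      using \<sigma> \<epsilon> sqrt_sum_squares_le_sum[of "\<epsilon> * norm (f x y a)" "norm (g x y a)"]
      by (simp add: F_def norm_Pair abs_mult)
    also have "\<dots> \<le> \<epsilon> * Q0 + norm (g x y a)" using bounded_f[OF a] \<epsilon> by simp
    finally have F: "norm (F (x, y)) \<le> \<epsilon> * Q0 + norm (g x y a)" .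
    have "norm (snd (\<zeta> t) - y) \<le> norm (\<zeta> t - (x, y))"
      using norm_snd_le[of "snd (\<zeta> t) - y" "fst (\<zeta> t) - x"] by (cases "\<zeta> t") simp
    also have "\<dots> \<le> 2 * norm (F (x, y)) * t * exp (2 * L * t)" using \<zeta>(2)[OF t] .
    also have "\<dots> \<le> 2 * (\<epsilon> * Q0 + norm (g x y a)) * t * exp (2 * L * t)"
      using F t by (intro mult_right_mono) auto
    also have "2 * L * t = 4 * (\<epsilon> + 1) * L0 * t" by (simp add: L_def)
    finally show "norm (snd (\<zeta> t) - y) \<le> 2 * (\<epsilon> * Q0 + norm (g x y a)) * t * exp (4 * (\<epsilon> + 1) * L0 * t)" .
  qed
qed

lemma trajectory_exists:
  assumes "0 < \<epsilon>"
  obtains \<alpha> \<xi> \<eta> where "\<alpha> \<in> controls A" "trajectory f g \<epsilon> x y \<alpha> \<xi> \<eta>"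
proof -
  obtain a where a: "a \<in> A" using A_nonempty by blast
  obtain \<xi> \<eta> where "\<And>h. steady_arc 1 \<epsilon> a h x y \<xi> \<eta>" using arc_exists[OF a assms, of 1] by (metis abs_one)
  then have "trajectory f g \<epsilon> x y (\<lambda>_. a) \<xi> \<eta>"
    unfolding trajectory_def steady_arc_def by fastforce
  then show ?thesis using that const_control[OF a] by blast
qed

lemma arc_reverse:
  assumes "steady_arc (-1) \<epsilon> a h x y \<xi> \<eta>"
  shows "steady_arc 1 \<epsilon> a h (\<xi> h) (\<eta> h) (\<lambda>s. \<xi> (h - s)) (\<lambda>s. \<eta> (h - s))"
  using assms has_integral_time_reversal[of h "\<lambda>s. (- 1 * \<epsilon>) *\<^sub>R f (\<xi> s) (\<eta> s) a" \<xi> x]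
    has_integral_time_reversal[of h "\<lambda>s. (- 1) *\<^sub>R g (\<xi> s) (\<eta> s) a" \<eta> y]
  unfolding steady_arc_def by simp

lemma arc_slow_speed:
  assumes arc: "steady_arc \<sigma> \<epsilon> a h x y \<xi> \<eta>" and a: "a \<in> A" and \<sigma>: "\<bar>\<sigma>\<bar> = 1" and "0 < \<epsilon>" "0 \<le> t" "t \<le> h"
  shows "norm (\<xi> t - x) \<le> \<epsilon> * Q0 * t"
proof -
  have "norm (\<xi> t - x) \<le> \<epsilon> * Q0 * measure lborel (cbox 0 t)"
  proof (rule has_integral_bound)
    show "((\<lambda>s. (\<sigma> * \<epsilon>) *\<^sub>R f (\<xi> s) (\<eta> s) a) has_integral (\<xi> t - x)) (cbox 0 t)"
      using arc assms unfolding steady_arc_def by simp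
    show "norm ((\<sigma> * \<epsilon>) *\<^sub>R f (\<xi> u) (\<eta> u) a) \<le> \<epsilon> * Q0" for u
      using bounded_f[OF a] assms by (simp add: abs_mult)
  qed (use assms Q0_nonneg in auto)
  then show ?thesis using assms by simp
qed

lemma arc_continuous:
  assumes arc: "steady_arc \<sigma> \<epsilon> a h x y \<xi> \<eta>"
  shows "continuous_on {0..h} \<xi>" "continuous_on {0..h} \<eta>"
  using arc unfolding steady_arc_def by (auto intro!: continuous_on_integral_curve)

lemma trajectory_prepend:
  assumes arc: "steady_arc 1 \<epsilon> a h x y \<xi> \<eta>" and tr: "trajectory f g \<epsilon> (\<xi> h) (\<eta> h) \<alpha> \<xi>' \<eta>'" and h: "0 \<le> h"
  shows "trajectory f g \<epsilon> x y (concat_at h (\<lambda>_. a) \<alpha>) (concat_at h \<xi> \<xi>') (concat_at h \<eta> \<eta>')"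
  unfolding trajectory_def
proof (intro allI impI conjI)
  fix t :: real assume t: "0 \<le> t"
  have *: "(concat_at h u v has_integral (concat_at h Z Z' t - z)) {0..t}"
    if u: "\<And>s. \<lbrakk>0 \<le> s; s \<le> h\<rbrakk> \<Longrightarrow> (u has_integral (Z s - z)) {0..s}"
      and v: "\<And>s. 0 \<le> s \<Longrightarrow> (v has_integral (Z' s - Z h)) {0..s}"
    for u v Z Z' and z :: "'d::euclidean_space"
  proof (cases "t \<le> h")
    case True
    then show ?thesis
      using t by (intro has_integral_eq[OF _ u[of t, THEN back_subst[of "\<lambda>I. (u has_integral I) {0..t}"]]])
        (auto simp: concat_at_def)
  next
    case False
    then have "(concat_at h u v has_integral ((Z h - z) + (Z' (t - h) - Z h))) {0..h + (t - h)}"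
      using h by (intro has_integral_concat_at u v) auto
    then show ?thesis using False by (simp add: concat_at_def)
  qed
  have "concat_at h (\<lambda>s. \<epsilon> *\<^sub>R f (\<xi> s) (\<eta> s) a) (\<lambda>s. \<epsilon> *\<^sub>R f (\<xi>' s) (\<eta>' s) (\<alpha> s)) =
    (\<lambda>s. \<epsilon> *\<^sub>R f (concat_at h \<xi> \<xi>' s) (concat_at h \<eta> \<eta>' s) (concat_at h (\<lambda>_. a) \<alpha> s))"
    by (auto simp: concat_at_def)
  moreover have "(concat_at h (\<lambda>s. \<epsilon> *\<^sub>R f (\<xi> s) (\<eta> s) a) (\<lambda>s. \<epsilon> *\<^sub>R f (\<xi>' s) (\<eta>' s) (\<alpha> s)) has_integral
      (concat_at h \<xi> \<xi>' t - x)) {0..t}"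
    using arc tr unfolding steady_arc_def trajectory_def by (intro *) auto
  ultimately show "((\<lambda>s. \<epsilon> *\<^sub>R f (concat_at h \<xi> \<xi>' s) (concat_at h \<eta> \<eta>' s) (concat_at h (\<lambda>_. a) \<alpha> s)) has_integral
      (concat_at h \<xi> \<xi>' t - x)) {0..t}" by simp
  have "concat_at h (\<lambda>s. g (\<xi> s) (\<eta> s) a) (\<lambda>s. g (\<xi>' s) (\<eta>' s) (\<alpha> s)) =
    (\<lambda>s. g (concat_at h \<xi> \<xi>' s) (concat_at h \<eta> \<eta>' s) (concat_at h (\<lambda>_. a) \<alpha> s))"
    by (auto simp: concat_at_def)
  moreover have "(concat_at h (\<lambda>s. g (\<xi> s) (\<eta> s) a) (\<lambda>s. g (\<xi>' s) (\<eta>' s) (\<alpha> s)) has_integral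
      (concat_at h \<eta> \<eta>' t - y)) {0..t}"
    using arc tr unfolding steady_arc_def trajectory_def by (intro *) auto
  ultimately show "((\<lambda>s. g (concat_at h \<xi> \<xi>' s) (concat_at h \<eta> \<eta>' s) (concat_at h (\<lambda>_. a) \<alpha> s)) has_integral
      (concat_at h \<eta> \<eta>' t - y)) {0..t}" by simp
qed

section \<open>The value functions\<close>

abbreviation W :: "real \<Rightarrow> 'x \<Rightarrow> 'y \<Rightarrow> real \<Rightarrow> real" where
  "W \<equiv> value_function f g l u0 A"

definition cost :: "real \<Rightarrow> real \<Rightarrow> (real \<Rightarrow> 'c) \<Rightarrow> (real \<Rightarrow> 'x) \<Rightarrow> (real \<Rightarrow> 'y) \<Rightarrow> real" where
  "cost \<epsilon> t \<alpha> \<xi> \<eta> = \<epsilon> * integral {0..t / \<epsilon>} (along l \<xi> \<eta> \<alpha>) + u0 (\<xi> (t / \<epsilon>)) (\<eta> (t / \<epsilon>))"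

lemma W_eq: "W \<epsilon> x y t = Inf {cost \<epsilon> t \<alpha> \<xi> \<eta> | \<alpha> \<xi> \<eta>. \<alpha> \<in> controls A \<and> trajectory f g \<epsilon> x y \<alpha> \<xi> \<eta>}"
  by (simp add: value_function_def cost_def)

lemma costs_nonempty:
  assumes "0 < \<epsilon>"
  shows "{cost \<epsilon> t \<alpha> \<xi> \<eta> | \<alpha> \<xi> \<eta>. \<alpha> \<in> controls A \<and> trajectory f g \<epsilon> x y \<alpha> \<xi> \<eta>} \<noteq> {}"
proof -
  obtain \<alpha> \<xi> \<eta> where "\<alpha> \<in> controls A" "trajectory f g \<epsilon> x y \<alpha> \<xi> \<eta>"
    using trajectory_exists[OF assms] .
  then show ?thesis by blast
qed

lemma integral_l_lower:
  assumes tr: "trajectory f g \<epsilon> x y \<alpha> \<xi> \<eta>" and \<alpha>: "\<alpha> \<in> controls A" and \<epsilon>: "0 < \<epsilon>" and s: "0 \<le> s" "s \<le> t"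
    and C: "\<And>x' y' a. \<lbrakk>x' \<in> cball x (\<epsilon> * Q0 * t); a \<in> A\<rbrakk> \<Longrightarrow> - C \<le> l x' y' a"
  shows "- C * (t - s) \<le> integral {s..t} (along l \<xi> \<eta> \<alpha>)"
proof -
  have "integral {s..t} (\<lambda>_. - C) \<le> integral {s..t} (along l \<xi> \<eta> \<alpha>)"
  proof (rule integral_le)
    show "(along l \<xi> \<eta> \<alpha>) integrable_on {s..t}"
      by (rule trajectory_integrable[OF cont_l tr \<alpha> s(1)])
    fix u assume u: "u \<in> {s..t}"
    have "norm (\<xi> u - \<xi> 0) \<le> \<epsilon> * Q0 * (u - 0)"
      using u s \<epsilon> by (intro trajectory_slow_speed[OF tr \<alpha>]) auto
    also have "\<dots> \<le> \<epsilon> * Q0 * t" using u s \<epsilon> Q0_nonneg by (intro mult_left_mono) auto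
    finally have "\<xi> u \<in> cball x (\<epsilon> * Q0 * t)"
      by (simp add: trajectory_init(1)[OF tr] dist_norm norm_minus_commute)
    then show "- C \<le> l (\<xi> u) (\<eta> u) (\<alpha> u)" using C \<alpha> u s by (simp add: controls_def)
  qed (rule integrable_const_ivl)
  then show ?thesis using s by (simp add: mult.commute)
qed

lemma cost_lower:
  assumes tr: "trajectory f g \<epsilon> x y \<alpha> \<xi> \<eta>" and \<alpha>: "\<alpha> \<in> controls A" and \<epsilon>: "0 < \<epsilon>" and t: "0 \<le> t"
    and C: "\<And>x' y' a. \<lbrakk>x' \<in> cball x (Q0 * t); a \<in> A\<rbrakk> \<Longrightarrow> - C \<le> l x' y' a"
    and c: "\<And>x' y'. x' \<in> cball x (Q0 * t) \<Longrightarrow> c \<le> u0 x' y'"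
  shows "- C * t + c \<le> cost \<epsilon> t \<alpha> \<xi> \<eta>"
proof -
  have eq: "\<epsilon> * Q0 * (t / \<epsilon>) = Q0 * t" using \<epsilon> by simp
  have "- C * (t / \<epsilon> - 0) \<le> integral {0..t / \<epsilon>} (along l \<xi> \<eta> \<alpha>)"
    using \<epsilon> t C by (intro integral_l_lower[OF tr \<alpha> \<epsilon>]) (auto simp: eq)
  then have "\<epsilon> * (- C * (t / \<epsilon> - 0)) \<le> \<epsilon> * integral {0..t / \<epsilon>} (along l \<xi> \<eta> \<alpha>)"
    using \<epsilon> by (intro mult_left_mono) auto
  moreover have "norm (\<xi> (t / \<epsilon>) - \<xi> 0) \<le> \<epsilon> * Q0 * (t / \<epsilon> - 0)"
    using t \<epsilon> by (intro trajectory_slow_speed[OF tr \<alpha>]) auto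
  then have "\<xi> (t / \<epsilon>) \<in> cball x (Q0 * t)"
    using \<epsilon> by (simp add: trajectory_init(1)[OF tr] dist_norm norm_minus_commute)
  ultimately show ?thesis using c[of "\<xi> (t / \<epsilon>)" "\<eta> (t / \<epsilon>)"] \<epsilon> unfolding cost_def by simp
qed

text \<open>The slow variable cannot leave \<open>cball x (Q0 * t)\<close> before the final time, whatever \<open>\<epsilon>\<close> is.\<close>

lemma value_lower:
  assumes \<epsilon>: "0 < \<epsilon>" and t: "0 \<le> t"
    and C: "\<And>x' y' a. \<lbrakk>x' \<in> cball x (Q0 * t); a \<in> A\<rbrakk> \<Longrightarrow> - C \<le> l x' y' a"
    and c: "\<And>x' y'. x' \<in> cball x (Q0 * t) \<Longrightarrow> c \<le> u0 x' y'"
  shows "- C * t + c \<le> W \<epsilon> x y t"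
  unfolding W_eq
proof (rule cInf_greatest)
  show "{cost \<epsilon> t \<alpha> \<xi> \<eta> |\<alpha> \<xi> \<eta>. \<alpha> \<in> controls A \<and> trajectory f g \<epsilon> x y \<alpha> \<xi> \<eta>} \<noteq> {}"
    by (rule costs_nonempty[OF \<epsilon>])
qed (use cost_lower[OF _ _ \<epsilon> t C c] in blast)

lemma value_le_cost:
  assumes tr: "trajectory f g \<epsilon> x y \<alpha> \<xi> \<eta>" and \<alpha>: "\<alpha> \<in> controls A" and \<epsilon>: "0 < \<epsilon>" and t: "0 \<le> t"
  shows "W \<epsilon> x y t \<le> cost \<epsilon> t \<alpha> \<xi> \<eta>"
  unfolding W_eq
proof (rule cInf_lower)
  obtain C where C: "\<And>x' y' a. \<lbrakk>x' \<in> cball x (Q0 * t); a \<in> A\<rbrakk> \<Longrightarrow> - C \<le> l x' y' a"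
    using l_bounded_below[of x "Q0 * t"] by metis
  show "bdd_below {cost \<epsilon> t \<alpha> \<xi> \<eta> |\<alpha> \<xi> \<eta>. \<alpha> \<in> controls A \<and> trajectory f g \<epsilon> x y \<alpha> \<xi> \<eta>}"
    using cost_lower[OF _ _ \<epsilon> t C lower_bound_u0] by (intro bdd_belowI[of _ "- C * t + - Q0"]) blast
qed (use tr \<alpha> in blast)

lemma near_optimal_trajectory:
  assumes \<epsilon>: "0 < \<epsilon>" and "W \<epsilon> x y t < c"
  obtains \<alpha> \<xi> \<eta> where "\<alpha> \<in> controls A" "trajectory f g \<epsilon> x y \<alpha> \<xi> \<eta>" "cost \<epsilon> t \<alpha> \<xi> \<eta> < c"
proof -
  have "{cost \<epsilon> t \<alpha> \<xi> \<eta> |\<alpha> \<xi> \<eta>. \<alpha> \<in> controls A \<and> trajectory f g \<epsilon> x y \<alpha> \<xi> \<eta>} \<noteq> {}"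
    by (rule costs_nonempty[OF \<epsilon>])
  from cInf_lessD[OF this assms(2)[unfolded W_eq]] show ?thesis using that by blast
qed

lemma value_at_zero_le:
  assumes "0 < \<epsilon>" shows "W \<epsilon> x y 0 \<le> u0 x y"
proof -
  obtain \<alpha> \<xi> \<eta> where tr: "\<alpha> \<in> controls A" "trajectory f g \<epsilon> x y \<alpha> \<xi> \<eta>"
    using trajectory_exists[OF assms] .
  have "W \<epsilon> x y 0 \<le> cost \<epsilon> 0 \<alpha> \<xi> \<eta>" using value_le_cost[OF tr(2,1) assms] by simp
  then show ?thesis using trajectory_init[OF tr(2)] by (simp add: cost_def)
qed

text \<open>The easy half of dynamic programming: going first along the arc is one of the admissible
  strategies.\<close>

lemma value_prepend_arc:
  assumes arc: "steady_arc 1 \<epsilon> a h x y \<xi> \<eta>" and a: "a \<in> A" and \<epsilon>: "0 < \<epsilon>" and h: "0 \<le> h" and t: "0 \<le> t"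
    and C: "\<And>s. \<lbrakk>0 \<le> s; s \<le> h\<rbrakk> \<Longrightarrow> l (\<xi> s) (\<eta> s) a \<le> C"
  shows "W \<epsilon> x y (t + \<epsilon> * h) \<le> \<epsilon> * h * C + W \<epsilon> (\<xi> h) (\<eta> h) t"
proof (rule field_le_epsilon)
  fix e :: real assume "0 < e"
  then have "W \<epsilon> (\<xi> h) (\<eta> h) t < W \<epsilon> (\<xi> h) (\<eta> h) t + e" by simp
  then obtain \<alpha> \<xi>' \<eta>' where tr: "\<alpha> \<in> controls A" "trajectory f g \<epsilon> (\<xi> h) (\<eta> h) \<alpha> \<xi>' \<eta>'"
    and lt: "cost \<epsilon> t \<alpha> \<xi>' \<eta>' < W \<epsilon> (\<xi> h) (\<eta> h) t + e"
    using near_optimal_trajectory[OF \<epsilon>] by blast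
  let ?I = "integral {0..h} (\<lambda>s. l (\<xi> s) (\<eta> s) a)" and ?J = "integral {0..t/\<epsilon>} (\<lambda>s. l (\<xi>' s) (\<eta>' s) (\<alpha> s))"
  have I: "(\<lambda>s. l (\<xi> s) (\<eta> s) a) integrable_on {0..h}"
    using integrable_along_continuous_path[OF cont_l compact_A const_control[OF a] arc_continuous[OF arc]] by simp
  have "?I \<le> integral {0..h} (\<lambda>_. C)"
    using C by (intro integral_le I) auto
  then have IC: "?I \<le> h * C" using h by simp
  have eq: "(t + \<epsilon> * h) / \<epsilon> = h + t / \<epsilon>" using \<epsilon> by (simp add: field_simps)
  have te: "0 \<le> t / \<epsilon>" using t \<epsilon> by simp
  have "(concat_at h (\<lambda>s. l (\<xi> s) (\<eta> s) a) (\<lambda>s. l (\<xi>' s) (\<eta>' s) (\<alpha> s)) has_integral (?I + ?J)) {0..h + t / \<epsilon>}"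
    using I trajectory_integrable[OF cont_l tr(2,1)] h te
    by (intro has_integral_concat_at) auto
  also have "concat_at h (\<lambda>s. l (\<xi> s) (\<eta> s) a) (\<lambda>s. l (\<xi>' s) (\<eta>' s) (\<alpha> s)) =
    (\<lambda>s. l (concat_at h \<xi> \<xi>' s) (concat_at h \<eta> \<eta>' s) (concat_at h (\<lambda>_. a) \<alpha> s))"
    by (auto simp: concat_at_def)
  finally have int: "integral {0..h + t / \<epsilon>} (\<lambda>s. l (concat_at h \<xi> \<xi>' s) (concat_at h \<eta> \<eta>' s) (concat_at h (\<lambda>_. a) \<alpha> s)) = ?I + ?J"
    by (rule integral_unique)
  have end_x: "concat_at h \<xi> \<xi>' (h + t / \<epsilon>) = \<xi>' (t / \<epsilon>)" and end_y: "concat_at h \<eta> \<eta>' (h + t / \<epsilon>) = \<eta>' (t / \<epsilon>)"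
    using te trajectory_init[OF tr(2)] by (auto simp: concat_at_def)
  have "W \<epsilon> x y (t + \<epsilon> * h) \<le>
      cost \<epsilon> (t + \<epsilon> * h) (concat_at h (\<lambda>_. a) \<alpha>) (concat_at h \<xi> \<xi>') (concat_at h \<eta> \<eta>')"
    using \<epsilon> h t by (intro value_le_cost trajectory_prepend[OF arc tr(2) h] concat_control[OF tr(1) h a]) auto
  also have "\<dots> = \<epsilon> * ?I + cost \<epsilon> t \<alpha> \<xi>' \<eta>'"
    unfolding cost_def eq int end_x end_y by (simp add: algebra_simps)
  also have "\<dots> \<le> \<epsilon> * (h * C) + (W \<epsilon> (\<xi> h) (\<eta> h) t + e)"
    using IC \<epsilon> lt by (intro add_mono mult_left_mono) auto
  finally show "W \<epsilon> x y (t + \<epsilon> * h) \<le> \<epsilon> * h * C + W \<epsilon> (\<xi> h) (\<eta> h) t + e" by simp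
qed

text \<open>The tail of a trajectory competes in the problem that starts where the tail starts.\<close>

lemma cost_splits_at:
  assumes tr: "trajectory f g \<epsilon> x y \<alpha> \<xi> \<eta>" and \<alpha>: "\<alpha> \<in> controls A" and \<epsilon>: "0 < \<epsilon>" and s: "0 \<le> s" "\<epsilon> * s \<le> t"
  shows "\<epsilon> * integral {0..s} (along l \<xi> \<eta> \<alpha>) + W \<epsilon> (\<xi> s) (\<eta> s) (t - \<epsilon> * s) \<le> cost \<epsilon> t \<alpha> \<xi> \<eta>"
proof -
  let ?k = "\<lambda>s. l (\<xi> s) (\<eta> s) (\<alpha> s)"
  have eq: "(t - \<epsilon> * s) / \<epsilon> = t / \<epsilon> - s" using \<epsilon> by (simp add: field_simps)
  have st: "s \<le> t / \<epsilon>" using s \<epsilon> by (simp add: field_simps)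
  have int: "?k integrable_on {u..t / \<epsilon>}" if "0 \<le> u" for u
    by (rule trajectory_integrable[OF cont_l tr \<alpha> that])
  have "integral {0..t / \<epsilon> - s} (\<lambda>u. ?k (u + s)) = integral {s..t / \<epsilon>} ?k"
    using integral_shift_real_ivl[of s s "t / \<epsilon>" ?k] by simp
  then have tail: "cost \<epsilon> (t - \<epsilon> * s) (\<lambda>u. \<alpha> (u + s)) (\<lambda>u. \<xi> (u + s)) (\<lambda>u. \<eta> (u + s)) =
      \<epsilon> * integral {s..t / \<epsilon>} ?k + u0 (\<xi> (t / \<epsilon>)) (\<eta> (t / \<epsilon>))"
    unfolding cost_def eq by simp
  have "W \<epsilon> (\<xi> s) (\<eta> s) (t - \<epsilon> * s) \<le> \<epsilon> * integral {s..t / \<epsilon>} ?k + u0 (\<xi> (t / \<epsilon>)) (\<eta> (t / \<epsilon>))"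
    unfolding tail[symmetric] using s
    by (intro value_le_cost trajectory_shift[OF tr] shift_control[OF \<alpha>] \<epsilon>) auto
  moreover have "integral {0..s} ?k + integral {s..t / \<epsilon>} ?k = integral {0..t / \<epsilon>} ?k"
    using s st int by (intro Henstock_Kurzweil_Integration.integral_combine) auto
  then have "\<epsilon> * integral {0..t / \<epsilon>} ?k = \<epsilon> * integral {0..s} ?k + \<epsilon> * integral {s..t / \<epsilon>} ?k"
    by (simp add: distrib_left[symmetric])
  ultimately show ?thesis unfolding cost_def by simp
qed

section \<open>Steering the fast variable\<close>

text \<open>With the control value chosen at the initial point by the steering lemma, the first-order term of
  \<open>(norm (\<eta> h - yc))\<^sup>2\<close> in \<open>h\<close> is at most \<open>- 2 * r * h * norm (y - yc)\<close>; Lipschitz continuity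
  controls the change of the velocity along the arc, which enters with order \<open>h\<^sup>2\<close>. The constants are
  uniform in \<open>\<epsilon> \<le> 1\<close> and in the direction of time.\<close>

lemma steering_arc:
  assumes D: "0 \<le> D"
  obtains r C where "0 < r" "0 \<le> C" "\<And>\<epsilon> h x y \<sigma>. \<lbrakk>0 < \<epsilon>; \<epsilon> \<le> 1; 0 \<le> h; h \<le> 1; x \<in> cball xc R; y \<in> cball yc D; \<bar>\<sigma>\<bar> = 1\<rbrakk> \<Longrightarrow>
    \<exists>a\<in>A. \<exists>\<xi> \<eta>. steady_arc \<sigma> \<epsilon> a h x y \<xi> \<eta> \<and> (\<forall>s. 0 \<le> s \<and> s \<le> h \<longrightarrow> norm (\<eta> s - y) \<le> C * s) \<and>
      (norm (\<eta> h - yc))\<^sup>2 \<le> (norm (y - yc))\<^sup>2 - r * h * norm (y - yc) + C * h\<^sup>2"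
proof -
  have K: "compact (cball xc R \<times> cball yc D)" by (intro compact_Times) auto
  obtain r where r: "0 < r" "\<And>x y v. (x, y) \<in> cball xc R \<times> cball yc D \<Longrightarrow> \<exists>a\<in>A. v \<bullet> g x y a \<le> - r * norm v"
    using steering[OF K] by blast
  obtain G where G: "0 \<le> G" "\<And>x y a. \<lbrakk>x \<in> cball xc R; y \<in> cball yc D; a \<in> A\<rbrakk> \<Longrightarrow> norm (g x y a) \<le> G"
    by (rule bounded_on_compact[OF cont_g, of "cball xc R" "cball yc D"]) auto
  define B where "B = 2 * (Q0 + G) * exp (8 * L0)"
  have B0: "0 \<le> B" using Q0_nonneg G(1) by (simp add: B_def)
  define E where "E = L0 * (Q0 + B)"
  have E0: "0 \<le> E" using L0_pos Q0_nonneg B0 by (simp add: E_def)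
  define C where "C = B + 2 * D * E + B\<^sup>2"
  have C: "B \<le> C" "2 * D * E + B\<^sup>2 \<le> C" "0 \<le> C" using B0 E0 D by (simp_all add: C_def)
  have step: "\<exists>a\<in>A. \<exists>\<xi> \<eta>. steady_arc \<sigma> \<epsilon> a h x y \<xi> \<eta> \<and> (\<forall>s. 0 \<le> s \<and> s \<le> h \<longrightarrow> norm (\<eta> s - y) \<le> C * s) \<and>
      (norm (\<eta> h - yc))\<^sup>2 \<le> (norm (y - yc))\<^sup>2 - r * h * norm (y - yc) + C * h\<^sup>2"
    if \<epsilon>: "0 < \<epsilon>" "\<epsilon> \<le> 1" and h: "0 \<le> h" "h \<le> 1" and xy: "x \<in> cball xc R" "y \<in> cball yc D" and \<sigma>: "\<bar>\<sigma>\<bar> = 1"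
    for \<epsilon> h x y \<sigma>
  proof -
    obtain a where a: "a \<in> A" "(\<sigma> *\<^sub>R (y - yc)) \<bullet> g x y a \<le> - r * norm (\<sigma> *\<^sub>R (y - yc))"
      using r(2)[of x y "\<sigma> *\<^sub>R (y - yc)"] xy by auto
    then have dec: "(y - yc) \<bullet> (\<sigma> *\<^sub>R g x y a) \<le> - r * norm (y - yc)" using \<sigma> by simp
    obtain \<xi> \<eta> where arc: "\<And>h. steady_arc \<sigma> \<epsilon> a h x y \<xi> \<eta>"
      and est: "\<And>t. 0 \<le> t \<Longrightarrow> norm (\<eta> t - y) \<le> 2 * (\<epsilon> * Q0 + norm (g x y a)) * t * exp (4 * (\<epsilon> + 1) * L0 * t)"
      using arc_exists[OF a(1) \<epsilon>(1) \<sigma>, of x y] by blast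
    have B: "norm (\<eta> s - y) \<le> B * s" if s: "0 \<le> s" "s \<le> h" for s
    proof -
      have "4 * (\<epsilon> + 1) * L0 * s \<le> 4 * (1 + 1) * L0 * 1"
        using s h \<epsilon> L0_pos by (intro mult_mono) auto
      then have 1: "exp (4 * (\<epsilon> + 1) * L0 * s) \<le> exp (8 * L0)" by simp
      have "\<epsilon> * Q0 \<le> Q0" using \<epsilon> Q0_nonneg by (simp add: mult_left_le_one_le)
      then have 2: "2 * (\<epsilon> * Q0 + norm (g x y a)) * s \<le> 2 * (Q0 + G) * s"
        using G(2)[OF xy a(1)] s by (intro mult_right_mono) auto
      have "norm (\<eta> s - y) \<le> 2 * (\<epsilon> * Q0 + norm (g x y a)) * s * exp (4 * (\<epsilon> + 1) * L0 * s)"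
        by (rule est[OF s(1)])
      also have "\<dots> \<le> 2 * (Q0 + G) * s * exp (8 * L0)"
        using 1 2 s Q0_nonneg G(1) \<epsilon> by (intro mult_mono[OF 2 1]) auto
      finally show ?thesis by (simp add: B_def mult_ac)
    qed
    define \<Delta> where "\<Delta> = \<eta> h - y"
    have "norm (\<Delta> - h *\<^sub>R (\<sigma> *\<^sub>R g x y a)) \<le> E * h * measure lborel (cbox 0 h)"
    proof (rule has_integral_bound)
      have "((\<lambda>s. \<sigma> *\<^sub>R g (\<xi> s) (\<eta> s) a) has_integral \<Delta>) {0..h}"
        using arc[of h] h unfolding steady_arc_def \<Delta>_def by auto
      moreover have "((\<lambda>_. \<sigma> *\<^sub>R g x y a) has_integral h *\<^sub>R (\<sigma> *\<^sub>R g x y a)) {0..h}"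
        using has_integral_const_real[of "\<sigma> *\<^sub>R g x y a" 0 h] h by simp
      ultimately show "((\<lambda>s. \<sigma> *\<^sub>R g (\<xi> s) (\<eta> s) a - \<sigma> *\<^sub>R g x y a) has_integral (\<Delta> - h *\<^sub>R (\<sigma> *\<^sub>R g x y a))) (cbox 0 h)"
        by (simp add: has_integral_diff)
      fix s assume "s \<in> cbox 0 h"
      then have s: "0 \<le> s" "s \<le> h" by auto
      have "norm (\<xi> s - x) \<le> \<epsilon> * Q0 * s" by (rule arc_slow_speed[OF arc[of h] a(1) \<sigma> \<epsilon>(1) s])
      also have "\<dots> \<le> 1 * Q0 * h" using \<epsilon> s Q0_nonneg by (intro mult_mono) auto
      finally have 1: "norm (\<xi> s - x) \<le> Q0 * h" by simp
      have "norm (\<eta> s - y) \<le> B * h" using B[OF s] mult_left_mono[OF s(2) B0] by simp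
      have "norm (\<sigma> *\<^sub>R g (\<xi> s) (\<eta> s) a - \<sigma> *\<^sub>R g x y a) = norm (g (\<xi> s) (\<eta> s) a - g x y a)"
        using \<sigma> by (simp add: scaleR_diff_right[symmetric])
      also have "\<dots> \<le> L0 * (norm (\<xi> s - x) + norm (\<eta> s - y))" by (rule lipschitz_g[OF a(1)])
      also have "\<dots> \<le> L0 * (Q0 * h + B * h)"
        using 1 \<open>norm (\<eta> s - y) \<le> B * h\<close> L0_pos by (intro mult_left_mono) auto
      finally show "norm (\<sigma> *\<^sub>R g (\<xi> s) (\<eta> s) a - \<sigma> *\<^sub>R g x y a) \<le> E * h"
        by (simp add: E_def algebra_simps)
    qed (use E0 h in auto)
    then have rest: "norm (\<Delta> - h *\<^sub>R (\<sigma> *\<^sub>R g x y a)) \<le> E * h\<^sup>2" using h by (simp add: power2_eq_square)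
    have "(y - yc) \<bullet> \<Delta> = h * ((y - yc) \<bullet> (\<sigma> *\<^sub>R g x y a)) + (y - yc) \<bullet> (\<Delta> - h *\<^sub>R (\<sigma> *\<^sub>R g x y a))"
      by (simp add: inner_diff_right)
    also have "\<dots> \<le> h * (- r * norm (y - yc)) + norm (y - yc) * norm (\<Delta> - h *\<^sub>R (\<sigma> *\<^sub>R g x y a))"
      using dec h by (intro add_mono mult_left_mono norm_cauchy_schwarz) auto
    also have "\<dots> \<le> h * (- r * norm (y - yc)) + D * (E * h\<^sup>2)"
      using rest xy D by (intro add_mono[OF order_refl] mult_mono) (auto simp: dist_norm norm_minus_commute)
    finally have inner: "(y - yc) \<bullet> \<Delta> \<le> - r * h * norm (y - yc) + D * E * h\<^sup>2" by (simp add: mult_ac)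
    have "norm \<Delta> \<le> B * h" using B[of h] h by (simp add: \<Delta>_def)
    then have \<Delta>2: "(norm \<Delta>)\<^sup>2 \<le> B\<^sup>2 * h\<^sup>2" by (metis norm_ge_zero power_mono power_mult_distrib)
    have "\<eta> h - yc = (y - yc) + \<Delta>" by (simp add: \<Delta>_def)
    then have "(norm (\<eta> h - yc))\<^sup>2 = (norm (y - yc))\<^sup>2 + 2 * ((y - yc) \<bullet> \<Delta>) + (norm \<Delta>)\<^sup>2"
      by (simp only: dot_norm[of "y - yc" \<Delta>]) (simp add: field_simps)
    also have "\<dots> \<le> (norm (y - yc))\<^sup>2 + 2 * (- r * h * norm (y - yc) + D * E * h\<^sup>2) + B\<^sup>2 * h\<^sup>2"
      using inner \<Delta>2 by (intro add_mono mult_left_mono) auto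
    also have "\<dots> = (norm (y - yc))\<^sup>2 - 2 * (r * h * norm (y - yc)) + (2 * D * E + B\<^sup>2) * h\<^sup>2"
      by (simp add: algebra_simps)
    also have "\<dots> \<le> (norm (y - yc))\<^sup>2 - r * h * norm (y - yc) + C * h\<^sup>2"
    proof -
      have "0 \<le> r * h * norm (y - yc)" using r(1) h by simp
      moreover have "(2 * D * E + B\<^sup>2) * h\<^sup>2 \<le> C * h\<^sup>2" using C(2) by (intro mult_right_mono) auto
      ultimately show ?thesis by linarith
    qed
    finally have "(norm (\<eta> h - yc))\<^sup>2 \<le> (norm (y - yc))\<^sup>2 - r * h * norm (y - yc) + C * h\<^sup>2" .
    moreover have "norm (\<eta> s - y) \<le> C * s" if "0 \<le> s \<and> s \<le> h" for s
      using B[of s] that mult_right_mono[OF C(1), of s] by force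
    ultimately show ?thesis using a(1) arc by blast
  qed
  show ?thesis by (rule that[OF r(1) C(3) step])
qed

text \<open>The steering arc in terms of value functions: a forward arc leads from \<open>(x, y)\<close> to \<open>(x', y')\<close>, and a
  backward arc, reversed, from \<open>(x', y')\<close> to \<open>(x, y)\<close>. In both cases \<open>y'\<close> is closer
  to the target, up to an error of order \<open>h\<^sup>2\<close>.\<close>

lemma steering_step:
  assumes D: "0 \<le> D"
  obtains r C Cl where "0 < r" "0 \<le> C" "0 \<le> Cl"
    "\<And>\<epsilon> h x y. \<lbrakk>0 < \<epsilon>; \<epsilon> \<le> 1; 0 \<le> h; h \<le> 1; norm (x - xc) + \<epsilon> * h * Q0 \<le> R; norm (y - yc) \<le> D\<rbrakk> \<Longrightarrow>
      \<exists>x' y'. norm (x' - x) \<le> \<epsilon> * h * Q0 \<and>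
        (norm (y' - yc))\<^sup>2 \<le> (norm (y - yc))\<^sup>2 - r * h * norm (y - yc) + C * h\<^sup>2 \<and>
        (\<forall>t\<ge>0. W \<epsilon> x y (t + \<epsilon> * h) \<le> \<epsilon> * h * Cl + W \<epsilon> x' y' t)"
    "\<And>\<epsilon> h x y. \<lbrakk>0 < \<epsilon>; \<epsilon> \<le> 1; 0 \<le> h; h \<le> 1; norm (x - xc) + \<epsilon> * h * Q0 \<le> R; norm (y - yc) \<le> D\<rbrakk> \<Longrightarrow>
      \<exists>x' y'. norm (x' - x) \<le> \<epsilon> * h * Q0 \<and>
        (norm (y' - yc))\<^sup>2 \<le> (norm (y - yc))\<^sup>2 - r * h * norm (y - yc) + C * h\<^sup>2 \<and>
        (\<forall>t\<ge>0. W \<epsilon> x' y' (t + \<epsilon> * h) \<le> \<epsilon> * h * Cl + W \<epsilon> x y t)"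
proof -
  obtain r C where r: "0 < r" and C: "0 \<le> C" and arcs: "\<And>\<epsilon> h x y \<sigma>. \<lbrakk>0 < \<epsilon>; \<epsilon> \<le> 1; 0 \<le> h; h \<le> 1; x \<in> cball xc R; y \<in> cball yc D; \<bar>\<sigma>\<bar> = 1\<rbrakk> \<Longrightarrow>
    \<exists>a\<in>A. \<exists>\<xi> \<eta>. steady_arc \<sigma> \<epsilon> a h x y \<xi> \<eta> \<and> (\<forall>s. 0 \<le> s \<and> s \<le> h \<longrightarrow> norm (\<eta> s - y) \<le> C * s) \<and>
      (norm (\<eta> h - yc))\<^sup>2 \<le> (norm (y - yc))\<^sup>2 - r * h * norm (y - yc) + C * h\<^sup>2"
    by (rule steering_arc[OF D, of xc R yc]) blast
  obtain Cl where Cl: "0 \<le> Cl" "\<And>x y a. \<lbrakk>x \<in> cball xc R; y \<in> cball yc (D + C); a \<in> A\<rbrakk> \<Longrightarrow> norm (l x y a) \<le> Cl"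
    by (rule bounded_on_compact[OF cont_l, of "cball xc R" "cball yc (D + C)"]) auto
  have step: "\<exists>a\<in>A. \<exists>\<xi> \<eta>. steady_arc \<sigma> \<epsilon> a h x y \<xi> \<eta> \<and> norm (\<xi> h - x) \<le> \<epsilon> * h * Q0 \<and> \<xi> 0 = x \<and> \<eta> 0 = y \<and>
      (norm (\<eta> h - yc))\<^sup>2 \<le> (norm (y - yc))\<^sup>2 - r * h * norm (y - yc) + C * h\<^sup>2 \<and>
      (\<forall>s. 0 \<le> s \<and> s \<le> h \<longrightarrow> l (\<xi> s) (\<eta> s) a \<le> Cl)"
    if \<epsilon>: "0 < \<epsilon>" "\<epsilon> \<le> 1" and h: "0 \<le> h" "h \<le> 1" and x: "norm (x - xc) + \<epsilon> * h * Q0 \<le> R"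
      and y: "norm (y - yc) \<le> D" and \<sigma>: "\<bar>\<sigma>\<bar> = 1" for \<epsilon> h x y \<sigma>
  proof -
    have "0 \<le> \<epsilon> * h * Q0" using \<epsilon> h Q0_nonneg by simp
    then have "x \<in> cball xc R" "y \<in> cball yc D" using x y by (simp_all add: dist_norm norm_minus_commute)
    from arcs[OF \<epsilon> h this \<sigma>] obtain a \<xi> \<eta> where a: "a \<in> A" and arc: "steady_arc \<sigma> \<epsilon> a h x y \<xi> \<eta>"
      and near: "\<And>s. \<lbrakk>0 \<le> s; s \<le> h\<rbrakk> \<Longrightarrow> norm (\<eta> s - y) \<le> C * s"
      and dec: "(norm (\<eta> h - yc))\<^sup>2 \<le> (norm (y - yc))\<^sup>2 - r * h * norm (y - yc) + C * h\<^sup>2" by blast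
    have slow: "norm (\<xi> s - x) \<le> \<epsilon> * h * Q0" if "0 \<le> s" "s \<le> h" for s
    proof -
      have "norm (\<xi> s - x) \<le> \<epsilon> * Q0 * s" by (rule arc_slow_speed[OF arc a \<sigma> \<epsilon>(1) that])
      also have "\<dots> \<le> \<epsilon> * Q0 * h" using \<epsilon> Q0_nonneg that by (intro mult_left_mono) auto
      finally show ?thesis by (simp add: mult_ac)
    qed
    have "l (\<xi> s) (\<eta> s) a \<le> Cl" if s: "0 \<le> s \<and> s \<le> h" for s
    proof -
      have "norm (\<xi> s - xc) \<le> R" using norm_triangle_ineq[of "\<xi> s - x" "x - xc"] slow[of s] s x by simp
      moreover have "C * s \<le> C" using C s h by (simp add: mult_left_le)
      then have "norm (\<eta> s - yc) \<le> D + C"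
        using norm_triangle_ineq[of "\<eta> s - y" "y - yc"] near[of s] s y by simp
      ultimately have "norm (l (\<xi> s) (\<eta> s) a) \<le> Cl"
        using a by (intro Cl(2)) (auto simp: dist_norm norm_minus_commute)
      then show ?thesis by simp
    qed
    moreover have "\<xi> 0 = x" "\<eta> 0 = y"
      using arc_slow_speed[OF arc a \<sigma> \<epsilon>(1), of 0] near[of 0] h by auto
    ultimately show ?thesis using a arc slow[of h] h dec by blast
  qed
  show ?thesis
  proof (rule that[OF r C Cl(1)])
    fix \<epsilon> h x y assume *: "0 < \<epsilon>" "\<epsilon> \<le> 1" "0 \<le> h" "h \<le> 1" "norm (x - xc) + \<epsilon> * h * Q0 \<le> R" "norm (y - yc) \<le> D"
    obtain a \<xi> \<eta> where 1: "a \<in> A" "steady_arc 1 \<epsilon> a h x y \<xi> \<eta>" "norm (\<xi> h - x) \<le> \<epsilon> * h * Q0"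
      "(norm (\<eta> h - yc))\<^sup>2 \<le> (norm (y - yc))\<^sup>2 - r * h * norm (y - yc) + C * h\<^sup>2"
      "\<And>s. \<lbrakk>0 \<le> s; s \<le> h\<rbrakk> \<Longrightarrow> l (\<xi> s) (\<eta> s) a \<le> Cl" using step[OF *, of 1] by auto
    have "W \<epsilon> x y (t + \<epsilon> * h) \<le> \<epsilon> * h * Cl + W \<epsilon> (\<xi> h) (\<eta> h) t" if "0 \<le> t" for t
      by (rule value_prepend_arc[OF 1(2,1) *(1,3) that 1(5)])
    then show "\<exists>x' y'. norm (x' - x) \<le> \<epsilon> * h * Q0 \<and>
        (norm (y' - yc))\<^sup>2 \<le> (norm (y - yc))\<^sup>2 - r * h * norm (y - yc) + C * h\<^sup>2 \<and>
        (\<forall>t\<ge>0. W \<epsilon> x y (t + \<epsilon> * h) \<le> \<epsilon> * h * Cl + W \<epsilon> x' y' t)" using 1(3,4) by blast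
  next
    fix \<epsilon> h x y assume *: "0 < \<epsilon>" "\<epsilon> \<le> 1" "0 \<le> h" "h \<le> 1" "norm (x - xc) + \<epsilon> * h * Q0 \<le> R" "norm (y - yc) \<le> D"
    obtain a \<xi> \<eta> where 1: "a \<in> A" "steady_arc (-1) \<epsilon> a h x y \<xi> \<eta>" "norm (\<xi> h - x) \<le> \<epsilon> * h * Q0" "\<xi> 0 = x" "\<eta> 0 = y"
      "(norm (\<eta> h - yc))\<^sup>2 \<le> (norm (y - yc))\<^sup>2 - r * h * norm (y - yc) + C * h\<^sup>2"
      "\<And>s. \<lbrakk>0 \<le> s; s \<le> h\<rbrakk> \<Longrightarrow> l (\<xi> s) (\<eta> s) a \<le> Cl" using step[OF *, of "-1"] by auto
    have "W \<epsilon> (\<xi> h) (\<eta> h) (t + \<epsilon> * h) \<le> \<epsilon> * h * Cl + W \<epsilon> x y t" if "0 \<le> t" for t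
      using value_prepend_arc[OF arc_reverse[OF 1(2)] 1(1) *(1,3) that, of Cl] 1(4,5,7) by simp
    then show "\<exists>x' y'. norm (x' - x) \<le> \<epsilon> * h * Q0 \<and>
        (norm (y' - yc))\<^sup>2 \<le> (norm (y - yc))\<^sup>2 - r * h * norm (y - yc) + C * h\<^sup>2 \<and>
        (\<forall>t\<ge>0. W \<epsilon> x' y' (t + \<epsilon> * h) \<le> \<epsilon> * h * Cl + W \<epsilon> x y t)" using 1(3,6) by blast
  qed
qed

text \<open>Arcs of equal length \<open>h\<close> are chosen one after the other such that the fast variable never leaves
  \<open>cball yc 1\<close> at the switching times: if it is in the outer half of this ball, the decrease given by
  steering dominates, and otherwise it cannot get out within time \<open>h\<close>. Along such a path the running
  cost is bounded.\<close>

lemma value_bounded_above: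
  assumes t: "0 \<le> t"
  obtains C where "\<And>\<epsilon>. \<lbrakk>0 < \<epsilon>; \<epsilon> \<le> 1\<rbrakk> \<Longrightarrow> W \<epsilon> xc yc t \<le> C"
proof -
  define R where "R = Q0 * t"
  have R0: "0 \<le> R" using Q0_nonneg t by (simp add: R_def)
  obtain r C Cl where r: "0 < r" and C: "0 \<le> C" and Cl: "0 \<le> Cl" and step: "\<And>\<epsilon> h x y. \<lbrakk>0 < \<epsilon>; \<epsilon> \<le> 1; 0 \<le> h; h \<le> 1;
      norm (x - xc) + \<epsilon> * h * Q0 \<le> R; norm (y - yc) \<le> 1\<rbrakk> \<Longrightarrow> \<exists>x' y'. norm (x' - x) \<le> \<epsilon> * h * Q0 \<and>
        (norm (y' - yc))\<^sup>2 \<le> (norm (y - yc))\<^sup>2 - r * h * norm (y - yc) + C * h\<^sup>2 \<and>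
        (\<forall>t\<ge>0. W \<epsilon> x y (t + \<epsilon> * h) \<le> \<epsilon> * h * Cl + W \<epsilon> x' y' t)"
    by (rule steering_step[of 1 xc R yc]) (simp, blast)
  have "compact ((\<lambda>(x, y). u0 x y) ` (cball xc R \<times> cball yc 1))"
    by (intro compact_continuous_image continuous_on_subset[OF cont_u0] compact_Times) auto
  from compact_imp_bounded[OF this] obtain Cu where
    Cu: "\<And>v. v \<in> (\<lambda>(x, y). u0 x y) ` (cball xc R \<times> cball yc 1) \<Longrightarrow> norm v \<le> Cu"
    unfolding bounded_iff by blast
  \<comment> \<open>This makes the error \<open>C * h\<^sup>2\<close> of a step at most \<open>h * r / 2\<close>, the decrease guaranteed at
    distance \<open>1 / 2\<close>, and at most \<open>1 / 2\<close>, so that a step cannot leave the ball from its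
    inner half.\<close>
  define h0 where "h0 = min 1 (min r 1 / (2 * (C + 1)))"
  have h0: "0 < h0" "h0 \<le> 1" using r C by (auto simp: h0_def)
  have Ch0: "C * h0 \<le> r / 2" "C * h0 \<le> 1 / 2"
  proof -
    have "C * h0 \<le> C * (min r 1 / (2 * (C + 1)))" using C by (intro mult_left_mono) (auto simp: h0_def)
    also have "\<dots> = (C / (C + 1)) * (min r 1 / 2)" using C by (simp add: field_simps)
    also have "\<dots> \<le> 1 * (min r 1 / 2)" using C r by (intro mult_right_mono) auto
    finally show "C * h0 \<le> r / 2" "C * h0 \<le> 1 / 2" by auto
  qed
  have iter: "W \<epsilon> x y (real n * (\<epsilon> * h)) \<le> real n * (\<epsilon> * h) * Cl + Cu"
    if \<epsilon>: "0 < \<epsilon>" "\<epsilon> \<le> 1" and h: "0 \<le> h" "h \<le> h0"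
      and "norm (y - yc) \<le> 1" "norm (x - xc) + real n * (\<epsilon> * h) * Q0 \<le> R" for \<epsilon> h x y n
    using that(5,6)
  proof (induction n arbitrary: x y)
    case 0
    have "\<bar>u0 x y\<bar> \<le> Cu" using Cu[of "u0 x y"] 0 by (force simp: dist_norm norm_minus_commute)
    then show ?case using value_at_zero_le[OF \<epsilon>(1), of x y] by simp
  next
    case (Suc n)
    define d where "d = norm (y - yc)"
    have d: "0 \<le> d" "d \<le> 1" using Suc.prems by (auto simp: d_def)
    have nn: "0 \<le> real n * (\<epsilon> * h) * Q0" using \<epsilon> h Q0_nonneg by simp
    have split: "real (Suc n) * (\<epsilon> * h) * Q0 = real n * (\<epsilon> * h) * Q0 + \<epsilon> * h * Q0" by (simp add: algebra_simps)
    have h1: "h \<le> 1" using h h0 by simp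
    have "norm (x - xc) + \<epsilon> * h * Q0 \<le> R" using Suc.prems(2) split nn by simp
    from step[OF \<epsilon> h(1) h1 this Suc.prems(1)] obtain x' y' where slow: "norm (x' - x) \<le> \<epsilon> * h * Q0"
      and dec: "(norm (y' - yc))\<^sup>2 \<le> d\<^sup>2 - r * h * d + C * h\<^sup>2"
      and W: "\<And>t. 0 \<le> t \<Longrightarrow> W \<epsilon> x y (t + \<epsilon> * h) \<le> \<epsilon> * h * Cl + W \<epsilon> x' y' t"
      unfolding d_def by blast
    have Ch: "C * h \<le> r / 2" "C * h \<le> 1 / 2" using Ch0 mult_left_mono[OF h(2) C] by auto
    have Ch2: "C * h\<^sup>2 \<le> h * (r / 2)" "C * h\<^sup>2 \<le> 1 / 2"
    proof -
      show "C * h\<^sup>2 \<le> h * (r / 2)" using mult_left_mono[OF Ch(1) h(1)] by (simp add: power2_eq_square mult_ac)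
      have "C * h\<^sup>2 \<le> C * h" using C h h1 by (intro mult_left_mono) (auto simp: power2_eq_square mult_left_le)
      then show "C * h\<^sup>2 \<le> 1 / 2" using Ch by simp
    qed
    have "(norm (y' - yc))\<^sup>2 \<le> 1\<^sup>2"
    proof (cases "d \<le> 1 / 2")
      case True
      then have "d\<^sup>2 \<le> (1/2)\<^sup>2" using d by (intro power_mono) auto
      moreover have "0 \<le> r * h * d" using r h d by simp
      ultimately show ?thesis using dec Ch2(2) by (simp add: power2_eq_square)
    next
      case False
      have "d\<^sup>2 \<le> 1" using d by (simp add: power_le_one)
      moreover have "r * h * (1/2) \<le> r * h * d" using False r h by (intro mult_left_mono) auto
      ultimately show ?thesis using dec Ch2(1) by (simp add: mult_ac)
    qed
    then have y': "norm (y' - yc) \<le> 1" by (rule power2_le_imp_le) simp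
    have x': "norm (x' - xc) + real n * (\<epsilon> * h) * Q0 \<le> R"
      using norm_triangle_ineq[of "x' - x" "x - xc"] slow Suc.prems(2) split by simp
    have "W \<epsilon> x y (real n * (\<epsilon> * h) + \<epsilon> * h) \<le> \<epsilon> * h * Cl + W \<epsilon> x' y' (real n * (\<epsilon> * h))"
      using \<epsilon> h by (intro W) auto
    also have "\<dots> \<le> \<epsilon> * h * Cl + (real n * (\<epsilon> * h) * Cl + Cu)"
      using Suc.IH[OF y' x'] by simp
    finally show ?case by (simp add: algebra_simps)
  qed
  have "W \<epsilon> xc yc t \<le> t * Cl + Cu" if \<epsilon>: "0 < \<epsilon>" "\<epsilon> \<le> 1" for \<epsilon>
  proof -
    obtain n where n: "t / (\<epsilon> * h0) < real n" "0 < n"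
      using reals_Archimedean2[of "max 1 (t / (\<epsilon> * h0))"] by force
    define h where "h = t / (\<epsilon> * real n)"
    have "h \<le> h0" using n \<epsilon> h0 by (simp add: h_def field_simps)
    moreover have "0 \<le> h" using t \<epsilon> by (simp add: h_def)
    moreover have nh: "real n * (\<epsilon> * h) = t" using n \<epsilon> by (simp add: h_def)
    ultimately show ?thesis using iter[OF \<epsilon>, of h yc xc n] R_def by (simp add: mult_ac)
  qed
  then show ?thesis by (rule that)
qed

section \<open>The semilimit does not depend on the fast variable\<close>

text \<open>Backward steering from a point \<open>(x1, y1, t1)\<close> at which \<open>W\<close> is close to the semilimit at \<open>y'\<close>.
  Each backward arc decreases the squared distance to \<open>y\<close> by a fixed amount, so the number of arcs,
  and with it the fast time used, is bounded independently of \<open>\<epsilon>\<close>. Traversed forward, the arcs lead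
  exactly to \<open>(x1, y1)\<close>.\<close>

lemma semilimit_le_other_fast_point:
  "lower_semilimit W x y t \<le> lower_semilimit W x y' t"
proof (rule ccontr)
  assume "\<not> ?thesis"
  then have "lower_semilimit W x y' t < lower_semilimit W x y t" by simp
  then obtain c where c: "lower_semilimit W x y' t < ereal c" "ereal c < lower_semilimit W x y t"
    using ereal_dense2 by blast
  obtain c1 where c1: "lower_semilimit W x y' t < ereal c1" "ereal c1 < ereal c"
    using ereal_dense2[OF c(1)] by blast
  define \<gamma> where "\<gamma> = c - c1"
  have \<gamma>: "\<gamma> > 0" using c1 by (simp add: \<gamma>_def)
  have "lower_semilimit W x y t \<le> ereal c"
  proof (rule lower_semilimit_leI)
    fix d :: real assume d: "d > 0"
    define D where "D = norm (y' - y) + 1"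
    have D: "0 \<le> D" by (simp add: D_def)
    obtain r C Cl where r: "0 < r" and C: "0 \<le> C" and Cl: "0 \<le> Cl" and step: "\<And>\<epsilon> h x1 y1. \<lbrakk>0 < \<epsilon>; \<epsilon> \<le> 1; 0 \<le> h; h \<le> 1;
        norm (x1 - x) + \<epsilon> * h * Q0 \<le> 2; norm (y1 - y) \<le> D\<rbrakk> \<Longrightarrow> \<exists>x2 y2. norm (x2 - x1) \<le> \<epsilon> * h * Q0 \<and>
          (norm (y2 - y))\<^sup>2 \<le> (norm (y1 - y))\<^sup>2 - r * h * norm (y1 - y) + C * h\<^sup>2 \<and>
          (\<forall>t\<ge>0. W \<epsilon> x2 y2 (t + \<epsilon> * h) \<le> \<epsilon> * h * Cl + W \<epsilon> x1 y1 t)"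
      by (rule steering_step[OF D, of x 2 y]) blast
    define \<kappa> where "\<kappa> = d / 2"
    \<comment> \<open>At distance at least \<open>\<kappa>\<close> a step of length \<open>h\<close> decreases the squared distance by at
      least \<open>\<delta>\<close>, defined below; \<open>N\<close> steps suffice.\<close>
    define h where "h = min 1 (r * \<kappa> / (2 * (C + 1)))"
    have \<kappa>: "0 < \<kappa>" using d by (simp add: \<kappa>_def)
    have h: "0 < h" "h \<le> 1" using r C \<kappa> by (auto simp: h_def)
    have Ch: "C * h \<le> r * \<kappa> / 2"
    proof -
      have "C * h \<le> C * (r * \<kappa> / (2 * (C + 1)))" using C by (intro mult_left_mono) (auto simp: h_def)
      also have "\<dots> = (C / (C + 1)) * (r * \<kappa> / 2)" using C by (simp add: field_simps)
      also have "\<dots> \<le> 1 * (r * \<kappa> / 2)" using C r \<kappa> by (intro mult_right_mono) auto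
      finally show ?thesis by simp
    qed
    define \<delta> where "\<delta> = h * (r * \<kappa> / 2)"
    have \<delta>: "0 < \<delta>" using h r \<kappa> by (simp add: \<delta>_def)
    obtain N where N: "D\<^sup>2 / \<delta> < real N" using reals_Archimedean2 by blast
    have ND: "D\<^sup>2 \<le> \<kappa>\<^sup>2 + real N * \<delta>"
      using N \<delta> by (simp add: field_simps) (smt (verit) zero_le_power2)
    define S where "S = real N * h"
    have S: "0 \<le> S" using h by (simp add: S_def)
    have iter: "\<exists>x2 y2 t2. norm (y2 - y) \<le> \<kappa> \<and> norm (x2 - x1) \<le> real k * (\<epsilon> * h) * Q0 \<and>
        t1 \<le> t2 \<and> t2 \<le> t1 + real k * (\<epsilon> * h) \<and> W \<epsilon> x2 y2 t2 \<le> W \<epsilon> x1 y1 t1 + real k * (\<epsilon> * h) * Cl"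
      if \<epsilon>: "0 < \<epsilon>" "\<epsilon> \<le> 1" and "0 \<le> t1" "norm (y1 - y) \<le> D" "(norm (y1 - y))\<^sup>2 \<le> \<kappa>\<^sup>2 + real k * \<delta>"
        "norm (x1 - x) + real k * (\<epsilon> * h) * Q0 \<le> 2" for \<epsilon> k x1 y1 t1
      using that(3-6)
    proof (induction k arbitrary: x1 y1 t1)
      case 0
      then have "norm (y1 - y) \<le> \<kappa>" using \<kappa> by (simp add: power_mono_iff)
      then show ?case by (intro exI[of _ x1] exI[of _ y1] exI[of _ t1]) simp
    next
      case (Suc k)
      define e where "e = norm (y1 - y)"
      have e: "0 \<le> e" "e \<le> D" using Suc.prems by (auto simp: e_def)
      have pos: "0 \<le> \<epsilon> * h" "0 \<le> \<epsilon> * h * Q0" "0 \<le> real k * (\<epsilon> * h) * Q0" "0 \<le> \<epsilon> * h * Cl"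
          "0 \<le> real k * (\<epsilon> * h) * Cl" "0 \<le> real k * (\<epsilon> * h)"
        using \<epsilon> h Q0_nonneg Cl by auto
      have split: "real (Suc k) * (\<epsilon> * h) * Q0 = real k * (\<epsilon> * h) * Q0 + \<epsilon> * h * Q0"
        "real (Suc k) * (\<epsilon> * h) = real k * (\<epsilon> * h) + \<epsilon> * h"
        "real (Suc k) * (\<epsilon> * h) * Cl = real k * (\<epsilon> * h) * Cl + \<epsilon> * h * Cl" by (simp_all add: algebra_simps)
      show ?case
      proof (cases "e \<le> \<kappa>")
        case True
        then show ?thesis using pos split
          by (intro exI[of _ x1] exI[of _ y1] exI[of _ t1]) (simp add: e_def)
      next
        case False
        have "norm (x1 - x) + \<epsilon> * h * Q0 \<le> 2" using Suc.prems(4) split pos by simp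
        from step[OF \<epsilon> _ h(2) this Suc.prems(2)] h obtain x3 y3 where slow: "norm (x3 - x1) \<le> \<epsilon> * h * Q0"
          and dec: "(norm (y3 - y))\<^sup>2 \<le> e\<^sup>2 - r * h * e + C * h\<^sup>2"
          and W: "W \<epsilon> x3 y3 (t1 + \<epsilon> * h) \<le> \<epsilon> * h * Cl + W \<epsilon> x1 y1 t1"
          unfolding e_def using Suc.prems(1) by (meson less_imp_le)
        have "C * h\<^sup>2 \<le> \<delta>"
          using mult_left_mono[OF Ch, of h] h by (simp add: \<delta>_def power2_eq_square mult_ac)
        moreover have "r * h * \<kappa> \<le> r * h * e" using False r h by (intro mult_left_mono) auto
        moreover have "r * h * \<kappa> = 2 * \<delta>" by (simp add: \<delta>_def)
        ultimately have dec2: "(norm (y3 - y))\<^sup>2 \<le> e\<^sup>2 - \<delta>" using dec by linarith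
        then have "(norm (y3 - y))\<^sup>2 \<le> e\<^sup>2" using \<delta> by simp
        then have y': "norm (y3 - y) \<le> D" using e by (meson order_trans power2_le_imp_le)
        have y'': "(norm (y3 - y))\<^sup>2 \<le> \<kappa>\<^sup>2 + real k * \<delta>"
          using dec2 Suc.prems(3) by (simp add: e_def algebra_simps)
        have x': "norm (x3 - x) + real k * (\<epsilon> * h) * Q0 \<le> 2"
          using norm_triangle_ineq[of "x3 - x1" "x1 - x"] slow Suc.prems(4) split by simp
        from Suc.IH[OF _ y' y'' x', of "t1 + \<epsilon> * h"] Suc.prems(1) pos obtain x2 y2 t2 where
          2: "norm (y2 - y) \<le> \<kappa>" "norm (x2 - x3) \<le> real k * (\<epsilon> * h) * Q0" "t1 + \<epsilon> * h \<le> t2"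
            "t2 \<le> t1 + \<epsilon> * h + real k * (\<epsilon> * h)"
            "W \<epsilon> x2 y2 t2 \<le> W \<epsilon> x3 y3 (t1 + \<epsilon> * h) + real k * (\<epsilon> * h) * Cl" by auto
        have "norm (x2 - x1) \<le> real (Suc k) * (\<epsilon> * h) * Q0"
          using norm_triangle_ineq[of "x2 - x3" "x3 - x1"] 2(2) slow split by simp
        moreover have "t1 \<le> t2" "t2 \<le> t1 + real (Suc k) * (\<epsilon> * h)"
          using 2(3,4) split(2) pos by linarith+
        moreover have "W \<epsilon> x2 y2 t2 \<le> W \<epsilon> x1 y1 t1 + real (Suc k) * (\<epsilon> * h) * Cl"
          using 2(5) W split(3) by linarith
        ultimately show ?thesis using 2(1) by blast
      qed
    qed
    define P where "P = 1 + S + S * Q0 + S * Cl"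
    have P: "1 \<le> P" "S \<le> P" "S * Q0 \<le> P" "S * Cl \<le> P" using S Q0_nonneg Cl by (auto simp: P_def)
    \<comment> \<open>\<open>P\<close> bounds fast time, slow displacement and cost of the connecting path in units of
      \<open>\<epsilon>\<close>.\<close>
    define d' where "d' = min 1 (min (d/2) (min \<gamma> (min (d / 4) 1) / P))"
    have d': "0 < d'" "d' \<le> 1" "d' \<le> d / 2" using d \<gamma> P unfolding d'_def by (simp, simp, linarith)
    have d'P: "e * P < \<gamma>" "e * P < d / 4" "e * P < 1" if "e < d'" for e
    proof -
      have "e < min \<gamma> (min (d / 4) 1) / P" using that by (simp add: d'_def)
      then have "e * P < min \<gamma> (min (d / 4) 1)" using P(1) by (simp add: field_simps)
      then show "e * P < \<gamma>" "e * P < d / 4" "e * P < 1" by auto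
    qed
    obtain \<epsilon> x1 y1 t1 where 1: "0 < \<epsilon>" "\<epsilon> < d'" "dist x1 x < d'" "dist y1 y' < d'" "0 \<le> t1" "\<bar>t1 - t\<bar> < d'" "W \<epsilon> x1 y1 t1 < c1"
      using lower_semilimit_lessD[OF c1(1) d'(1)] by blast
    have \<epsilon>1: "\<epsilon> \<le> 1" using 1 d' by simp
    have eP: "\<epsilon> * S \<le> \<epsilon> * P" "\<epsilon> * (S * Q0) \<le> \<epsilon> * P" "\<epsilon> * (S * Cl) \<le> \<epsilon> * P"
      using P 1(1) by (auto intro!: mult_left_mono)
    have eqs: "real N * (\<epsilon> * h) = \<epsilon> * S" "real N * (\<epsilon> * h) * Q0 = \<epsilon> * (S * Q0)" "real N * (\<epsilon> * h) * Cl = \<epsilon> * (S * Cl)"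
      by (simp_all add: S_def)
    have y1: "norm (y1 - y) \<le> D"
      using norm_triangle_ineq[of "y1 - y'" "y' - y"] 1(4) d'(2) by (simp add: D_def dist_norm)
    then have y1': "(norm (y1 - y))\<^sup>2 \<le> \<kappa>\<^sup>2 + real N * \<delta>"
      using ND power_mono[OF y1, of 2] by simp
    have "norm (x1 - x) + real N * (\<epsilon> * h) * Q0 \<le> 2"
      unfolding eqs using 1(3) d'(2) eP(2) d'P(3)[OF 1(2)] by (simp add: dist_norm)
    from iter[OF 1(1) \<epsilon>1 1(5) y1 y1' this] obtain x2 y2 t2 where
      2: "norm (y2 - y) \<le> \<kappa>" "norm (x2 - x1) \<le> \<epsilon> * (S * Q0)" "t1 \<le> t2" "t2 \<le> t1 + \<epsilon> * S"
        "W \<epsilon> x2 y2 t2 \<le> W \<epsilon> x1 y1 t1 + \<epsilon> * (S * Cl)"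
      unfolding eqs by (auto simp: dist_norm norm_minus_commute mult.assoc)
    have "dist x2 x < d"
      using norm_triangle_ineq[of "x2 - x1" "x1 - x"] 2(2) 1(3) d'(3) eP(2) d'P(2)[OF 1(2)] d by (simp add: dist_norm)
    moreover have "dist y2 y < d" using 2(1) d by (simp add: dist_norm \<kappa>_def)
    moreover have "\<bar>t2 - t\<bar> < d" using 2(3,4) 1(6) d'(3) eP(1) d'P(2)[OF 1(2)] d by linarith
    moreover have "W \<epsilon> x2 y2 t2 \<le> c" using 2(5) 1(7) eP(3) d'P(1)[OF 1(2)] by (simp add: \<gamma>_def)
    moreover have "\<epsilon> < d" "0 \<le> t2" using 1 2(3) d' d by auto
    ultimately show "\<exists>e x' y' t'. 0 < e \<and> e < d \<and> dist x' x < d \<and> dist y' y < d \<and>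
     0 \<le> t' \<and> \<bar>t' - t\<bar> < d \<and> W e x' y' t' \<le> c" using 1(1) by blast
  qed
  then show False using c(2) by simp
qed

section \<open>Semicontinuity and initial values of the limit\<close>

definition lower_value :: "'x \<Rightarrow> real \<Rightarrow> real" where
  "lower_value x t = real_of_ereal (lower_semilimit W x 0 t)"

lemma lower_semilimit_eq:
  assumes t: "0 \<le> t"
  shows "lower_semilimit W x y t = ereal (lower_value x t)"
proof -
  obtain C where C: "\<And>\<epsilon>. \<lbrakk>0 < \<epsilon>; \<epsilon> \<le> 1\<rbrakk> \<Longrightarrow> W \<epsilon> x 0 t \<le> C" using value_bounded_above[OF t] by blast
  have up: "lower_semilimit W x 0 t \<le> ereal C"
  proof (rule lower_semilimit_leI)
    fix d :: real assume "d > 0"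
    then show "\<exists>e x' y' t'. 0 < e \<and> e < d \<and> dist x' x < d \<and> dist y' 0 < d \<and>
     0 \<le> t' \<and> \<bar>t' - t\<bar> < d \<and> W e x' y' t' \<le> C"
      using C[of "min 1 (d/2)"] t
      by (intro exI[of _ "min 1 (d/2)"] exI[of _ x] exI[of _ "0::'y"] exI[of _ t]) auto
  qed
  obtain B where B: "0 \<le> B" "\<And>x' y' a. \<lbrakk>x' \<in> cball x (1 + Q0 * (t + 1)); a \<in> A\<rbrakk> \<Longrightarrow> - B \<le> l x' y' a"
    using l_bounded_below by blast
  have low: "ereal (- B * (t + 1) + - Q0) \<le> lower_semilimit W x 0 t"
  proof (rule lower_semilimit_ge)
    show "(0::real) < 1" by simp
    fix e t' :: real and x' :: 'x and y' :: 'y assume *: "0 < e" "dist x' x < 1" "0 \<le> t'" "\<bar>t' - t\<bar> < 1"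
    have "Q0 * t' \<le> Q0 * (t + 1)" using * Q0_nonneg by (intro mult_left_mono) auto
    then have "cball x' (Q0 * t') \<subseteq> cball x (1 + Q0 * (t + 1))"
      using *(2) by (intro cball_subset_cball_iff[THEN iffD2]) (simp add: dist_commute)
    then have "- B * t' + - Q0 \<le> W e x' y' t'"
      using B lower_bound_u0 by (intro value_lower *) auto
    moreover have "B * t' \<le> B * (t + 1)" using B * by (intro mult_left_mono) auto
    ultimately show "- B * (t + 1) + - Q0 \<le> W e x' y' t'" by simp
  qed
  have "lower_semilimit W x y t = lower_semilimit W x 0 t"
    by (intro antisym semilimit_le_other_fast_point)
  then show ?thesis using up low unfolding lower_value_def
    by (cases "lower_semilimit W x 0 t") auto
qed

lemma lower_value_lsc: "lsc_on (UNIV \<times> {0<..}) (\<lambda>(x, t). lower_value x t)"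
  unfolding lsc_on_def
proof (intro ballI allI impI)
  fix z :: "'x \<times> real" and c assume z: "z \<in> UNIV \<times> {0<..}" and c: "c < (\<lambda>(x, t). lower_value x t) z"
  obtain x t where xt: "z = (x, t)" by (cases z)
  have t: "0 < t" using z xt by simp
  obtain c' where c': "c < c'" "c' < lower_value x t" using c xt dense by auto
  have "ereal c' < lower_semilimit W x 0 t" using c' t by (simp add: lower_semilimit_eq)
  then obtain d where d: "d > 0" "\<And>e x' y' t'. \<lbrakk>0 < e; e < d; dist x' x < d; dist y' 0 < d; 0 \<le> t'; \<bar>t' - t\<bar> < d\<rbrakk>
    \<Longrightarrow> c' < W e x' y' t'" using lower_semilimit_gtD by metis
  show "\<forall>\<^sub>F w in at z within UNIV \<times> {0<..}. c < (\<lambda>(x, t). lower_value x t) w"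
    unfolding eventually_at
  proof (intro exI[of _ "d/2"] conjI ballI impI)
    show "0 < d / 2" using d by simp
    fix w :: "'x \<times> real" assume w: "w \<in> UNIV \<times> {0<..}" "w \<noteq> z \<and> dist w z < d / 2"
    obtain x1 t1 where w_eq: "w = (x1, t1)" by (cases w)
    have t1: "0 < t1" using w w_eq by simp
    have near: "dist x1 x < d / 2" "\<bar>t1 - t\<bar> < d / 2"
      using w(2) dist_fst_le[of w z] dist_snd_le[of w z] by (auto simp: w_eq xt dist_real_def)
    have "ereal c' \<le> lower_semilimit W x1 0 t1"
    proof (rule lower_semilimit_ge[of "d/2"])
      fix e t' :: real and x' :: 'x and y' :: 'y assume *: "0 < e" "e < d/2" "dist x' x1 < d/2" "dist y' 0 < d/2" "0 \<le> t'" "\<bar>t' - t1\<bar> < d/2"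
      have "dist x' x < d" using dist_triangle[of x' x x1] * near by simp
      moreover have "\<bar>t' - t\<bar> < d" using * near by linarith
      ultimately show "c' \<le> W e x' y' t'" using * d by (intro less_imp_le[OF d(2)]) auto
    qed (use d in auto)
    then show "c < (\<lambda>(x, t). lower_value x t) w" using c' t1 by (simp add: lower_semilimit_eq w_eq)
  qed
qed

text \<open>Any lower semicontinuous \<open>\<phi>\<close> below the limit datum is almost \<open>\<ge> \<phi> x0\<close> near \<open>x0\<close>, and the
  trajectories stay there for short slow times, so the estimate of \<open>value_lower\<close> holds uniformly in
  \<open>\<epsilon>\<close> and \<open>y\<close>.\<close>

lemma lower_value_initial:
  "ereal (lsc_envelope (limit_datum u0) x0) \<le>
    Liminf (at (x0, 0) within UNIV \<times> {0<..}) (\<lambda>(x, t). ereal (lower_value x t))"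
proof (rule ccontr)
  assume "\<not> ?thesis"
  then have "Liminf (at (x0, 0) within UNIV \<times> {0<..}) (\<lambda>(x, t). ereal (lower_value x t)) <
      ereal (lsc_envelope (limit_datum u0) x0)" by simp
  then obtain c where c: "Liminf (at (x0, 0) within UNIV \<times> {0<..}) (\<lambda>(x, t). ereal (lower_value x t)) < ereal c"
    "c < lsc_envelope (limit_datum u0) x0" using ereal_dense2 by (metis less_ereal.simps(1))
  have lim_le: "limit_datum u0 x \<le> u0 x y" for x y
    unfolding limit_datum_def using lower_bound_u0 by (intro cINF_lower bdd_belowI[of _ "- Q0"]) auto
  have "{\<phi>. lsc_on UNIV \<phi> \<and> (\<forall>w. \<phi> w \<le> limit_datum u0 w)} \<noteq> {}"
  proof -
    have "lsc_on UNIV (\<lambda>_::'x. - Q0)" by (simp add: lsc_on_def)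
    moreover have "- Q0 \<le> limit_datum u0 w" for w
      unfolding limit_datum_def using lower_bound_u0 by (intro cINF_greatest) auto
    ultimately show ?thesis by blast
  qed
  moreover have "bdd_above ((\<lambda>\<phi>. \<phi> x0) ` {\<phi>. lsc_on UNIV \<phi> \<and> (\<forall>w. \<phi> w \<le> limit_datum u0 w)})"
    by (intro bdd_aboveI[of _ "limit_datum u0 x0"]) auto
  ultimately obtain \<phi> where \<phi>: "lsc_on UNIV \<phi>" "\<And>w. \<phi> w \<le> limit_datum u0 w" "c < \<phi> x0"
    using c(2) unfolding lsc_envelope_def by (subst (asm) less_cSUP_iff) auto
  obtain c' where c': "c < c'" "c' < \<phi> x0" using \<phi>(3) dense by blast
  have "\<forall>\<^sub>F w in at x0. c' < \<phi> w" using \<phi>(1) c'(2) unfolding lsc_on_def by auto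
  then obtain \<rho> where \<rho>: "\<rho> > 0" "\<And>w. w \<noteq> x0 \<Longrightarrow> dist w x0 < \<rho> \<Longrightarrow> c' < \<phi> w"
    unfolding eventually_at by auto
  have \<phi>c: "c' \<le> u0 w y" if "dist w x0 < \<rho>" for w y
    using \<rho>(2)[of w] that c'(2) \<phi>(2)[of w] lim_le[of w y] by (cases "w = x0") auto
  obtain B where B: "0 \<le> B" "\<And>x' y' a. \<lbrakk>x' \<in> cball x0 \<rho>; a \<in> A\<rbrakk> \<Longrightarrow> - B \<le> l x' y' a"
    using l_bounded_below by blast
  define \<delta> where "\<delta> = min (\<rho> / (4 * (Q0 + 1))) ((c' - c) / (2 * (B + 1)))"
  have \<delta>: "0 < \<delta>" using \<rho>(1) Q0_nonneg c' B(1) by (simp add: \<delta>_def)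
  have \<delta>1: "2 * \<delta> + Q0 * (2 * \<delta>) < \<rho>"
  proof -
    have "\<delta> \<le> \<rho> / (4 * (Q0 + 1))" by (simp add: \<delta>_def)
    then have "\<delta> * (4 * (Q0 + 1)) \<le> \<rho>" using Q0_nonneg by (simp add: pos_le_divide_eq)
    moreover have "0 < \<delta> * (2 * (Q0 + 1))" using \<delta> Q0_nonneg by simp
    ultimately show ?thesis by (simp add: algebra_simps)
  qed
  have \<delta>2: "B * (2 * \<delta>) \<le> c' - c"
  proof -
    have "\<delta> \<le> (c' - c) / (2 * (B + 1))" by (simp add: \<delta>_def)
    then have "\<delta> * (2 * (B + 1)) \<le> c' - c" using B(1) by (simp add: pos_le_divide_eq)
    then show ?thesis using \<delta> by (simp add: algebra_simps)
  qed
  have low: "c \<le> W e x' y' t'" if "0 < e" "dist x' x0 < 2 * \<delta>" "0 \<le> t'" "t' < 2 * \<delta>" for e x' y' t'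
  proof -
    have "Q0 * t' \<le> Q0 * (2 * \<delta>)" using that Q0_nonneg by (intro mult_left_mono) auto
    then have sub: "dist w x0 < \<rho>" if "w \<in> cball x' (Q0 * t')" for w
      using that \<delta>1 \<open>dist x' x0 < 2 * \<delta>\<close> dist_triangle[of w x0 x'] by (simp add: dist_commute)
    have "- B * t' + c' \<le> W e x' y' t'"
    proof (rule value_lower)
      show "- B \<le> l x'' y'' a" if "x'' \<in> cball x' (Q0 * t')" "a \<in> A" for x'' y'' a
        using sub[OF that(1)] that(2) B(2)[of x'' a y''] by (simp add: dist_commute)
      show "c' \<le> u0 x'' y''" if "x'' \<in> cball x' (Q0 * t')" for x'' y''
        by (rule \<phi>c[OF sub[OF that]])
    qed (use that in auto)
    moreover have "B * t' \<le> B * (2 * \<delta>)" using that B by (intro mult_left_mono) auto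
    ultimately show ?thesis using \<delta>2 by simp
  qed
  have "\<forall>\<^sub>F w in at (x0, 0) within UNIV \<times> {0<..}. ereal c \<le> (\<lambda>(x, t). ereal (lower_value x t)) w"
    unfolding eventually_at
  proof (intro exI[of _ \<delta>] conjI ballI impI \<delta>)
    fix w :: "'x \<times> real" assume w: "w \<in> UNIV \<times> {0<..}" "w \<noteq> (x0, 0) \<and> dist w (x0, 0) < \<delta>"
    obtain x1 t1 where w_eq: "w = (x1, t1)" by (cases w)
    have t1: "0 < t1" using w w_eq by simp
    have near: "dist x1 x0 < \<delta>" "t1 < \<delta>"
      using w(2) dist_fst_le[of w "(x0, 0)"] dist_snd_le[of w "(x0, 0)"] by (auto simp: w_eq dist_real_def)
    have "ereal c \<le> lower_semilimit W x1 0 t1"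
    proof (rule lower_semilimit_ge[OF \<delta>])
      fix e t' :: real and x' :: 'x and y' :: 'y assume *: "0 < e" "e < \<delta>" "dist x' x1 < \<delta>" "dist y' 0 < \<delta>" "0 \<le> t'" "\<bar>t' - t1\<bar> < \<delta>"
      have "dist x' x0 < 2 * \<delta>" using dist_triangle[of x' x0 x1] * near by simp
      then show "c \<le> W e x' y' t'" using * near by (intro low) auto
    qed
    then show "ereal c \<le> (\<lambda>(x, t). ereal (lower_value x t)) w" using t1 by (simp add: lower_semilimit_eq w_eq)
  qed
  then have "ereal c \<le> Liminf (at (x0, 0) within UNIV \<times> {0<..}) (\<lambda>(x, t). ereal (lower_value x t))"
    by (rule Liminf_bounded)
  then show False using c(1) by simp
qed

end

section \<open>Test functions and sup-convolution\<close>

lemma radial_C1_gradient: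
  fixes y :: "'a::euclidean_space"
  assumes \<theta>: "\<And>r. 0 \<le> r \<Longrightarrow> (\<theta> has_real_derivative \<theta>' r) (at r)" and \<theta>': "continuous_on {0..} \<theta>'"
  shows "C1_gradient UNIV (\<lambda>w. \<theta> ((norm (w - y))\<^sup>2)) (\<lambda>w. (2 * \<theta>' ((norm (w - y))\<^sup>2)) *\<^sub>R (w - y))"
  unfolding C1_gradient_def
proof (intro conjI ballI)
  fix z
  have "GDERIV (\<lambda>w. (norm (w - y))\<^sup>2) z :> 2 *\<^sub>R (z - y)"
    unfolding gderiv_def power2_norm_eq_inner
    by (auto intro!: derivative_eq_intros simp: inner_commute algebra_simps)
  from GDERIV_DERIV_compose[OF this \<theta>[of "(norm (z - y))\<^sup>2"]]
  show "GDERIV (\<lambda>w. \<theta> ((norm (w - y))\<^sup>2)) z :> (2 * \<theta>' ((norm (z - y))\<^sup>2)) *\<^sub>R (z - y)"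
    by (simp add: mult.commute)
next
  show "continuous_on UNIV (\<lambda>w. (2 * \<theta>' ((norm (w - y))\<^sup>2)) *\<^sub>R (w - y))"
    by (intro continuous_intros continuous_on_compose2[OF \<theta>']) auto
qed

lemma C1_gradient_increment:
  assumes \<phi>: "C1_gradient \<Omega> \<phi> D" and S: "convex S" "S \<subseteq> \<Omega>"
    and e: "\<And>w. w \<in> S \<Longrightarrow> norm (D w - d) \<le> e" and ab: "a \<in> S" "b \<in> S"
  shows "\<bar>\<phi> b - \<phi> a - (b - a) \<bullet> d\<bar> \<le> e * norm (b - a)"
proof -
  have "norm ((\<phi> b - b \<bullet> d) - (\<phi> a - a \<bullet> d)) \<le> e * norm (b - a)"
  proof (rule differentiable_bound[OF S(1) _ _ ab(2,1)])
    fix w assume w: "w \<in> S"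
    have "GDERIV \<phi> w :> D w" using \<phi> w S(2) unfolding C1_gradient_def by auto
    then have "(\<phi> has_derivative (\<lambda>h. h \<bullet> D w)) (at w within S)"
      unfolding gderiv_def by (rule has_derivative_at_withinI)
    then have "((\<lambda>w. \<phi> w - w \<bullet> d) has_derivative (\<lambda>h. h \<bullet> D w - h \<bullet> d)) (at w within S)"
      by (auto intro!: derivative_eq_intros)
    then show "((\<lambda>w. \<phi> w - w \<bullet> d) has_derivative (\<lambda>h. h \<bullet> (D w - d))) (at w within S)"
      by (simp add: inner_diff_right)
    show "onorm (\<lambda>h. h \<bullet> (D w - d)) \<le> e"
    proof (rule onorm_le)
      fix h
      have "norm (h \<bullet> (D w - d)) \<le> norm h * norm (D w - d)" by (simp add: Cauchy_Schwarz_ineq2)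
      also have "\<dots> \<le> norm h * e" using e[OF w] by (intro mult_left_mono) auto
      finally show "norm (h \<bullet> (D w - d)) \<le> e * norm h" by (simp add: mult.commute)
    qed
  qed
  then show ?thesis by (simp add: inner_diff_left algebra_simps)
qed

lemma C1_gradient_imp_continuous_on:
  assumes "C1_gradient \<Omega> \<phi> D" shows "continuous_on \<Omega> \<phi>"
  using assms unfolding C1_gradient_def gderiv_def
  by (meson continuous_at_imp_continuous_on has_derivative_continuous)

lemma viscosity_subsolutionD_ball:
  assumes u: "viscosity_subsolution UNIV F u" and \<phi>: "C1_gradient UNIV \<phi> D"
    and z: "z \<in> ball y R" and max: "\<And>w. w \<in> ball y R \<Longrightarrow> u w - \<phi> w \<le> u z - \<phi> z"
  shows "F z (D z) \<le> 0"
proof -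
  have "\<forall>\<^sub>F w in at z. u w - \<phi> w \<le> u z - \<phi> z"
    unfolding eventually_at_topological using z max by (intro exI[of _ "ball y R"]) auto
  then show ?thesis using u \<phi> unfolding viscosity_subsolution_def by auto
qed

text \<open>\<open>v y\<close> is the maximum of \<open>u w - (norm (w - y))\<^sup>2 / (2 * \<kappa>)\<close> over \<open>w\<close> in the ball, attained at
  \<open>\<zeta> y\<close>. Comparing \<open>v y'\<close> with the competitor \<open>\<zeta> y\<close> gives the subgradient
  \<open>(\<zeta> y - y) / \<kappa>\<close> with quadratic error, and this one-sided estimate at all points already implies
  continuity.\<close>

lemma sup_convolution_exists:
  fixes u :: "'a::euclidean_space \<Rightarrow> real"
  assumes u: "usc_on UNIV u" and \<kappa>: "0 < \<kappa>" and R: "0 \<le> R"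
  obtains v \<zeta> where "\<And>y. \<zeta> y \<in> cball 0 R" "\<And>y. v y = u (\<zeta> y) - (norm (\<zeta> y - y))\<^sup>2 / (2 * \<kappa>)"
    "\<And>y w. w \<in> cball 0 R \<Longrightarrow> u w - (norm (w - y))\<^sup>2 / (2 * \<kappa>) \<le> v y"
    "\<And>y y'. v y + ((1/\<kappa>) *\<^sub>R (\<zeta> y - y)) \<bullet> (y' - y) - (norm (y' - y))\<^sup>2 / (2 * \<kappa>) \<le> v y'"
    "continuous_on UNIV v"
proof -
  have "\<exists>z\<in>cball 0 R. \<forall>w\<in>cball 0 R. u w - (norm (w - y))\<^sup>2 / (2 * \<kappa>) \<le> u z - (norm (z - y))\<^sup>2 / (2 * \<kappa>)" for y
  proof -
    have "usc_on UNIV (\<lambda>w. u w - (norm (w - y))\<^sup>2 / (2 * \<kappa>))"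
      by (intro usc_on_diff_continuous u continuous_intros) (use \<kappa> in auto)
    then obtain z where "z \<in> cball 0 R" "\<And>w. w \<in> cball 0 R \<Longrightarrow>
        u w - (norm (w - y))\<^sup>2 / (2 * \<kappa>) \<le> u z - (norm (z - y))\<^sup>2 / (2 * \<kappa>)"
      by (rule usc_on_attains_sup[of _ "cball 0 R"]) (use R in auto)
    then show ?thesis by blast
  qed
  then obtain \<zeta> where \<zeta>: "\<And>y. \<zeta> y \<in> cball 0 R"
    "\<And>y w. w \<in> cball 0 R \<Longrightarrow> u w - (norm (w - y))\<^sup>2 / (2 * \<kappa>) \<le> u (\<zeta> y) - (norm (\<zeta> y - y))\<^sup>2 / (2 * \<kappa>)"
    by metis
  define v where "v y = u (\<zeta> y) - (norm (\<zeta> y - y))\<^sup>2 / (2 * \<kappa>)" for y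
  have semi: "v y + ((1/\<kappa>) *\<^sub>R (\<zeta> y - y)) \<bullet> (y' - y) - (norm (y' - y))\<^sup>2 / (2 * \<kappa>) \<le> v y'" for y y'
  proof -
    have "(norm (\<zeta> y - y'))\<^sup>2 = (norm (\<zeta> y - y))\<^sup>2 - 2 * ((\<zeta> y - y) \<bullet> (y' - y)) + (norm (y' - y))\<^sup>2"
      unfolding power2_norm_eq_inner by (simp add: inner_diff_left inner_diff_right inner_commute)
    then have "(norm (\<zeta> y - y'))\<^sup>2 / (2 * \<kappa>) =
        (norm (\<zeta> y - y))\<^sup>2 / (2 * \<kappa>) - ((\<zeta> y - y) \<bullet> (y' - y)) / \<kappa> + (norm (y' - y))\<^sup>2 / (2 * \<kappa>)"
      using \<kappa> by (simp add: add_divide_distrib diff_divide_distrib)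
    moreover have "u (\<zeta> y) - (norm (\<zeta> y - y'))\<^sup>2 / (2 * \<kappa>) \<le> v y'"
      unfolding v_def using \<zeta> by blast
    ultimately show ?thesis by (simp add: v_def)
  qed
  have cont: "continuous_on UNIV v"
  proof (intro continuous_at_imp_continuous_on ballI)
    fix y :: 'a
    \<comment> \<open>A Lipschitz constant of \<open>v\<close> near \<open>y\<close>.\<close>
    define B where "B = (R + norm y + 1) / \<kappa> + 1 / (2 * \<kappa>)"
    have lower: "v a - B * norm (b - a) \<le> v b" if "norm (b - a) \<le> 1" "norm a \<le> norm y + 1" for a b
    proof -
      have "norm ((1/\<kappa>) *\<^sub>R (\<zeta> a - a)) \<le> (R + norm y + 1) / \<kappa>"
        using \<kappa> \<zeta>(1)[of a] norm_triangle_ineq4[of "\<zeta> a" a] that by (simp add: divide_right_mono)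
      then have "\<bar>((1/\<kappa>) *\<^sub>R (\<zeta> a - a)) \<bullet> (b - a)\<bar> \<le> (R + norm y + 1) / \<kappa> * norm (b - a)"
        by (intro order_trans[OF Cauchy_Schwarz_ineq2] mult_right_mono) auto
      moreover have "(norm (b - a))\<^sup>2 / (2 * \<kappa>) \<le> 1 / (2 * \<kappa>) * norm (b - a)"
        using that \<kappa> by (simp add: divide_right_mono power2_eq_square mult_left_le)
      ultimately show ?thesis using semi[of a b] by (simp add: B_def algebra_simps)
    qed
    have bound: "\<bar>v w - v y\<bar> \<le> B * norm (w - y)" if "norm (w - y) < 1" for w :: 'a
    proof -
      have "norm w \<le> norm y + 1" using norm_triangle_ineq[of "w - y" y] that by simp
      then show ?thesis using lower[of y w] lower[of w y] that by (simp add: norm_minus_commute abs_le_iff)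
    qed
    have "\<forall>\<^sub>F w in at y. norm (v w - v y) \<le> B * norm (w - y)"
      using bound
      unfolding eventually_at by (intro exI[of _ 1]) (auto simp: dist_norm)
    moreover have "((\<lambda>w. B * norm (w - y)) \<longlongrightarrow> 0) (at y)" by (auto intro!: tendsto_eq_intros)
    ultimately have "((\<lambda>w. v w - v y) \<longlongrightarrow> 0) (at y)" by (rule Lim_null_comparison)
    then show "isCont v y" unfolding isCont_def by (simp add: LIM_zero_iff)
  qed
  show ?thesis
    by (rule that[OF \<zeta>(1) v_def _ semi cont]) (use \<zeta>(2) in \<open>simp add: v_def\<close>)
qed

text \<open>The last time at which \<open>m\<close> is at least \<open>m 0\<close> exists by compactness and can only be \<open>T\<close>. A
  single step to the right from every point suffices.\<close>

lemma continuous_nondecreasing_criterion: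
  fixes m :: "real \<Rightarrow> real"
  assumes cont: "continuous_on {0..T} m" and T: "T \<ge> 0"
    and step: "\<And>s. \<lbrakk>0 \<le> s; s < T\<rbrakk> \<Longrightarrow> \<exists>h. 0 < h \<and> s + h \<le> T \<and> m s \<le> m (s + h)"
  shows "m 0 \<le> m T"
proof -
  define S where "S = {s \<in> {0..T}. m 0 \<le> m s}"
  have "closed S" unfolding S_def
    using continuous_closed_preimage[OF cont, of "{m 0..}"] by (simp add: vimage_def Int_def)
  moreover have "S \<subseteq> {0..T}" by (auto simp: S_def)
  ultimately have "compact S" by (metis bounded_closed_interval bounded_subset compact_eq_bounded_closed)
  moreover have "0 \<in> S" using T by (simp add: S_def)
  ultimately obtain s where s: "s \<in> S" "\<And>s'. s' \<in> S \<Longrightarrow> s' \<le> s"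
    by (metis compact_attains_sup empty_iff)
  have "s = T"
  proof (rule ccontr)
    assume "s \<noteq> T"
    then have "0 \<le> s" "s < T" using s by (auto simp: S_def)
    then obtain h where h: "0 < h" "s + h \<le> T" "m s \<le> m (s + h)" using step by blast
    then have "s + h \<in> S" using s(1) by (auto simp: S_def)
    then show False using s(2) h by force
  qed
  then show ?thesis using s by (auto simp: S_def)
qed

lemma bounded_below_on_compact_if_locally:
  fixes u :: "'a::metric_space \<Rightarrow> real"
  assumes K: "compact K" and d: "0 < d" and loc: "\<And>z. z \<in> K \<Longrightarrow> \<exists>m. \<forall>y\<in>ball z d. m \<le> u y"
  obtains m where "\<And>y. y \<in> K \<Longrightarrow> m \<le> u y"
proof -
  obtain m where m: "\<And>z y. z \<in> K \<Longrightarrow> y \<in> ball z d \<Longrightarrow> m z \<le> u y" using loc by metis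
  obtain C where C: "C \<subseteq> K" "finite C" "K \<subseteq> (\<Union>c\<in>C. ball c d)"
    by (rule compactE_image[OF K, of K "\<lambda>c. ball c d"]) (use d in auto)
  have "Min (insert 0 (m ` C)) \<le> u y" if y: "y \<in> K" for y
  proof -
    obtain c where c: "c \<in> C" "y \<in> ball c d" using C y by blast
    then have "Min (insert 0 (m ` C)) \<le> m c" using C(2) by (intro Min_le) auto
    also have "\<dots> \<le> u y" using m c C(1) by blast
    finally show ?thesis .
  qed
  then show ?thesis by (rule that)
qed

context slow_fast_system
begin

section \<open>Correctors from viscosity subsolutions\<close>

abbreviation cell_subsolution :: "'x \<Rightarrow> 'x \<Rightarrow> real \<Rightarrow> ('y \<Rightarrow> real) \<Rightarrow> bool" where
  "cell_subsolution x p b \<equiv> viscosity_subsolution UNIV (\<lambda>y q. hamiltonian f g l A x y p q - b)"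

text \<open>The running cost corrected by the increment of a test function with slope \<open>p\<close> in the slow
  variable.\<close>

definition lagr :: "'x \<Rightarrow> 'x \<Rightarrow> 'y \<Rightarrow> 'c \<Rightarrow> real" where
  "lagr p x y a = l x y a + p \<bullet> f x y a"

lemma cont_lagr: "continuous_on (UNIV \<times> UNIV \<times> A) (\<lambda>(x, y, a). lagr p x y a)"
  using cont_l cont_f unfolding lagr_def case_prod_unfold by (intro continuous_intros)

lemma hamiltonian_leD:
  assumes H: "hamiltonian f g l A x y p q \<le> b" and a: "a \<in> A"
  shows "0 \<le> q \<bullet> g x y a + lagr p x y a + b"
proof -
  have k: "continuous_on (UNIV \<times> UNIV \<times> A) (\<lambda>(x, y, a). - (p \<bullet> f x y a) - q \<bullet> g x y a - l x y a)"
    using cont_l cont_f cont_g unfolding case_prod_unfold by (intro continuous_intros)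
  obtain B where B: "\<And>x' y' a. \<lbrakk>x' \<in> {x}; y' \<in> {y}; a \<in> A\<rbrakk> \<Longrightarrow> norm (- (p \<bullet> f x' y' a) - q \<bullet> g x' y' a - l x' y' a) \<le> B"
    by (rule bounded_on_compact[OF k, of "{x}" "{y}"]) auto
  have "- (p \<bullet> f x y a) - q \<bullet> g x y a - l x y a \<le> hamiltonian f g l A x y p q"
    unfolding hamiltonian_def
  proof (rule cSUP_upper[OF a])
    show "bdd_above ((\<lambda>a. - (p \<bullet> f x y a) - q \<bullet> g x y a - l x y a) ` A)"
      using B by (intro bdd_aboveI[of _ B]) (force simp: abs_le_iff)
  qed
  then show ?thesis using H by (simp add: lagr_def)
qed

text \<open>Coercivity of the Hamiltonian in \<open>q\<close>, locally uniformly in \<open>y\<close>: there is a control with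
  \<open>q \<bullet> g x y a \<le> - r * norm q\<close>.\<close>

lemma gradient_bound:
  assumes Y: "compact Y"
  obtains Cq where "0 \<le> Cq" "\<And>y q. \<lbrakk>y \<in> Y; hamiltonian f g l A x y p q \<le> b\<rbrakk> \<Longrightarrow> norm q \<le> Cq"
proof -
  have "compact ({x} \<times> Y)" using Y by (intro compact_Times) auto
  then obtain r where r: "0 < r" "\<And>x' y q. (x', y) \<in> {x} \<times> Y \<Longrightarrow> \<exists>a\<in>A. q \<bullet> g x' y a \<le> - r * norm q"
    using steering by blast
  obtain B where B: "0 \<le> B" "\<And>x' y a. \<lbrakk>x' \<in> {x}; y \<in> Y; a \<in> A\<rbrakk> \<Longrightarrow> norm (lagr p x' y a) \<le> B"
    by (rule bounded_on_compact[OF cont_lagr, of "{x}" Y p]) (use Y in auto)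
  have "norm q \<le> (B + \<bar>b\<bar>) / r" if y: "y \<in> Y" and H: "hamiltonian f g l A x y p q \<le> b" for y q
  proof -
    obtain a where a: "a \<in> A" "q \<bullet> g x y a \<le> - r * norm q" using r(2)[of x y q] y by auto
    have "r * norm q \<le> lagr p x y a + b" using hamiltonian_leD[OF H a(1)] a(2) by simp
    also have "\<dots> \<le> B + \<bar>b\<bar>" using B(2)[of x y a] y a(1) by simp
    finally show ?thesis using r(1) by (simp add: field_simps)
  qed
  then show ?thesis using that[of "(B + \<bar>b\<bar>) / r"] B(1) r(1) by simp
qed

text \<open>Upper semicontinuity alone does not bound \<open>u\<close> from below. Near a point \<open>y0\<close> with very small
  \<open>u y0\<close>, the function \<open>u\<close> is compared with a smoothed cone with vertex \<open>y0\<close> whose slope exceeds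
  the gradient bound. The difference attains its maximum close to the vertex, so \<open>u\<close> lies below the
  cone: a bound from above at \<open>z0\<close> in terms of \<open>u y0\<close>, that is, a bound from below for \<open>u y0\<close>.\<close>

lemma subsolution_bounded_below:
  assumes u: "cell_subsolution x p b u" and Y: "compact Y"
  obtains m where "\<And>y. y \<in> Y \<Longrightarrow> m \<le> u y"
proof (rule bounded_below_on_compact_if_locally[OF Y, of "1/2" u])
  have usc: "usc_on UNIV u" using u by (simp add: viscosity_subsolution_def)
  fix z0
  obtain zm where zm: "\<And>w. w \<in> cball z0 2 \<Longrightarrow> u w \<le> u zm"
    by (rule usc_on_attains_sup[OF usc, of "cball z0 2"]) auto
  define M where "M = u zm"
  obtain Cq where Cq: "0 \<le> Cq" "\<And>y q. \<lbrakk>y \<in> cball z0 2; hamiltonian f g l A x y p q \<le> b\<rbrakk> \<Longrightarrow> norm q \<le> Cq"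
    using gradient_bound[of "cball z0 2"] by (metis compact_cball)
  define C where "C = Cq + 1"
  have C: "1 \<le> C" using Cq by (simp add: C_def)
  have "4/3 * (u z0 - 1 - 4 * C - (M + 1) / 4) \<le> u y0" if y0: "y0 \<in> ball z0 (1/2)" for y0
  proof -
    have "\<forall>\<^sub>F w in at y0. u w < u y0 + 1" using usc unfolding usc_on_def by simp
    then obtain s0 where s0: "s0 > 0" "\<And>w. w \<noteq> y0 \<Longrightarrow> dist w y0 < s0 \<Longrightarrow> u w < u y0 + 1"
      unfolding eventually_at by auto
    define s where "s = min s0 1"
    have s: "0 < s" "s \<le> 1" "s \<le> s0" using s0 by (auto simp: s_def)
    \<comment> \<open>With this coefficient of the quadratic term the maximum cannot lie on the sphere of
      radius \<open>1\<close>.\<close>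
    define K where "K = M - u y0 + 1"
    have My0: "u y0 \<le> M" unfolding M_def using y0 by (intro zm) auto
    have K: "1 \<le> K" using My0 by (simp add: K_def)
    define \<theta> where "\<theta> r = 2 * C * sqrt (r + s\<^sup>2) + K * r" for r
    define \<theta>' where "\<theta>' r = C / sqrt (r + s\<^sup>2) + K" for r
    have pos: "0 < r + s\<^sup>2" if "0 \<le> r" for r using that s by (simp add: add_nonneg_pos)
    have grad: "C1_gradient UNIV (\<lambda>w. \<theta> ((norm (w - y0))\<^sup>2)) (\<lambda>w. (2 * \<theta>' ((norm (w - y0))\<^sup>2)) *\<^sub>R (w - y0))"
    proof (rule radial_C1_gradient)
      show "(\<theta> has_real_derivative \<theta>' r) (at r)" if "0 \<le> r" for r
        unfolding \<theta>_def \<theta>'_def using pos[OF that] by (auto intro!: derivative_eq_intros simp: field_simps)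
      show "continuous_on {0..} \<theta>'"
        unfolding \<theta>'_def using pos by (intro continuous_intros) (auto simp: less_imp_neq[symmetric])
    qed
    let ?\<phi> = "\<lambda>w. \<theta> ((norm (w - y0))\<^sup>2)"
    have usc\<phi>: "usc_on UNIV (\<lambda>w. u w - ?\<phi> w)"
      by (intro usc_on_diff_continuous usc C1_gradient_imp_continuous_on[OF grad])
    obtain z where z: "z \<in> cball y0 1" "\<And>w. w \<in> cball y0 1 \<Longrightarrow> u w - ?\<phi> w \<le> u z - ?\<phi> z"
      by (rule usc_on_attains_sup[OF usc\<phi>, of "cball y0 1"]) auto
    have sub: "cball y0 1 \<subseteq> cball z0 2"
      using y0 by (intro cball_subset_cball_iff[THEN iffD2]) (simp add: dist_commute)
    have zM: "u z \<le> M" unfolding M_def using z(1) sub by (intro zm) auto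
    have int: "z \<in> ball y0 1"
    proof (rule ccontr)
      assume "z \<notin> ball y0 1"
      then have "norm (z - y0) = 1" using z(1) by (simp add: dist_norm norm_minus_commute)
      then have "?\<phi> z = 2 * C * sqrt (1 + s\<^sup>2) + K" by (simp add: \<theta>_def)
      moreover have "?\<phi> y0 = 2 * C * s" using s by (simp add: \<theta>_def)
      moreover have "u y0 - ?\<phi> y0 \<le> u z - ?\<phi> z" by (rule z(2)) simp
      moreover have "2 * C * s \<le> 2 * C * sqrt (1 + s\<^sup>2)"
        using C s by (intro mult_left_mono real_le_rsqrt) auto
      ultimately show False using zM by (simp add: K_def)
    qed
    have "hamiltonian f g l A x z p ((2 * \<theta>' ((norm (z - y0))\<^sup>2)) *\<^sub>R (z - y0)) \<le> b"
      using viscosity_subsolutionD_ball[OF u grad int] z(2) by force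
    then have "norm ((2 * \<theta>' ((norm (z - y0))\<^sup>2)) *\<^sub>R (z - y0)) \<le> Cq"
      using z(1) sub by (intro Cq(2)) auto
    moreover have \<theta>'0: "0 \<le> \<theta>' ((norm (z - y0))\<^sup>2)"
      using C K by (simp add: \<theta>'_def)
    ultimately have le: "2 * \<theta>' ((norm (z - y0))\<^sup>2) * norm (z - y0) \<le> Cq" by simp
    have near: "norm (z - y0) < s"
    proof (rule ccontr)
      assume "\<not> ?thesis"
      then have ge: "s \<le> norm (z - y0)" by simp
      then have n0: "0 < norm (z - y0)" using s by linarith
      have "s\<^sup>2 \<le> (norm (z - y0))\<^sup>2" using ge s by (intro power_mono) auto
      moreover have "(2 * norm (z - y0))\<^sup>2 = 4 * (norm (z - y0))\<^sup>2" by (simp add: power_mult_distrib)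
      ultimately have "(norm (z - y0))\<^sup>2 + s\<^sup>2 \<le> (2 * norm (z - y0))\<^sup>2"
        using zero_le_power2[of "norm (z - y0)"] by linarith
      then have "sqrt ((norm (z - y0))\<^sup>2 + s\<^sup>2) \<le> sqrt ((2 * norm (z - y0))\<^sup>2)"
        by (rule real_sqrt_le_mono)
      also have "sqrt ((2 * norm (z - y0))\<^sup>2) = 2 * norm (z - y0)" by (intro real_sqrt_unique) auto
      finally have sq: "sqrt ((norm (z - y0))\<^sup>2 + s\<^sup>2) \<le> 2 * norm (z - y0)" .
      have "C / (2 * norm (z - y0)) \<le> C / sqrt ((norm (z - y0))\<^sup>2 + s\<^sup>2)"
        using sq C n0 pos[of "(norm (z - y0))\<^sup>2"] by (intro divide_left_mono) auto
      also have "\<dots> \<le> \<theta>' ((norm (z - y0))\<^sup>2)" using K by (simp add: \<theta>'_def)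
      finally have "2 * (C / (2 * norm (z - y0))) * norm (z - y0) \<le> 2 * \<theta>' ((norm (z - y0))\<^sup>2) * norm (z - y0)"
        by (intro mult_right_mono mult_left_mono) auto
      then have "C \<le> Cq" using le n0 by simp
      then show False by (simp add: C_def)
    qed
    have "u z \<le> u y0 + 1" using s0(2)[of z] near s by (cases "z = y0") (auto simp: dist_norm)
    moreover have "u z0 - ?\<phi> z0 \<le> u z - ?\<phi> z" using y0 by (intro z(2)) (simp add: dist_commute)
    moreover have "0 \<le> ?\<phi> z" using C K by (simp add: \<theta>_def)
    moreover have "?\<phi> z0 \<le> 4 * C + K / 4"
    proof -
      have "norm (z0 - y0) \<le> 1/2" using y0 by (simp add: dist_norm)
      then have n: "(norm (z0 - y0))\<^sup>2 \<le> (1/2)\<^sup>2" by (intro power_mono) auto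
      moreover have "s\<^sup>2 \<le> 1" using s by (simp add: power_le_one)
      ultimately have "sqrt ((norm (z0 - y0))\<^sup>2 + s\<^sup>2) \<le> sqrt (2\<^sup>2)"
        by (intro real_sqrt_le_mono) (simp add: power2_eq_square)
      then have "2 * C * sqrt ((norm (z0 - y0))\<^sup>2 + s\<^sup>2) \<le> 2 * C * 2"
        using C by (intro mult_left_mono) auto
      moreover have "K * (norm (z0 - y0))\<^sup>2 \<le> K * (1/2)\<^sup>2" using K n by (intro mult_left_mono) auto
      ultimately show ?thesis by (simp add: \<theta>_def power2_eq_square)
    qed
    ultimately show ?thesis by (simp add: K_def field_simps)
  qed
  then show "\<exists>m. \<forall>y\<in>ball z0 (1/2). m \<le> u y" by blast
qed (use that in auto)

text \<open>Concavity of the logarithm, in the form \<open>ln t \<le> t - 1\<close>.\<close>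

lemma log_barrier_subgradient:
  fixes y y' :: 'y
  assumes "0 \<le> \<sigma>"
  shows "- \<sigma> * ln (1 + (norm y)\<^sup>2) + ((- 2 * \<sigma> / (1 + (norm y)\<^sup>2)) *\<^sub>R y) \<bullet> (y' - y) - \<sigma> * (norm (y' - y))\<^sup>2
    \<le> - \<sigma> * ln (1 + (norm y')\<^sup>2)"
proof -
  let ?N = "1 + (norm y)\<^sup>2"
  have N: "1 \<le> ?N" by simp
  have N': "0 < 1 + (norm y')\<^sup>2" by (simp add: add_pos_nonneg)
  have "ln (1 + (norm y')\<^sup>2) - ln ?N = ln ((1 + (norm y')\<^sup>2) / ?N)"
    using N N' ln_divide_pos[of "1 + (norm y')\<^sup>2" ?N] by linarith
  also have "\<dots> \<le> (1 + (norm y')\<^sup>2) / ?N - 1" using N N' by (intro ln_le_minus_one divide_pos_pos) linarith+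
  also have "\<dots> = ((norm y')\<^sup>2 - (norm y)\<^sup>2) / ?N"
  proof -
    have "?N / ?N = 1" using N by (intro divide_self) linarith
    then show ?thesis using diff_divide_distrib[of "1 + (norm y')\<^sup>2" ?N ?N] by simp
  qed
  also have "(norm y')\<^sup>2 - (norm y)\<^sup>2 = 2 * (y \<bullet> (y' - y)) + (norm (y' - y))\<^sup>2"
    unfolding power2_norm_eq_inner by (simp add: inner_diff_left inner_diff_right inner_commute)
  also have "(2 * (y \<bullet> (y' - y)) + (norm (y' - y))\<^sup>2) / ?N \<le> 2 * (y \<bullet> (y' - y)) / ?N + (norm (y' - y))\<^sup>2"
  proof -
    have "(norm (y' - y))\<^sup>2 / ?N \<le> (norm (y' - y))\<^sup>2 / 1"
      using N by (intro divide_left_mono) (auto simp: add_pos_nonneg)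
    then show ?thesis by (simp add: add_divide_distrib)
  qed
  finally have "\<sigma> * (ln (1 + (norm y')\<^sup>2) - ln ?N) \<le> \<sigma> * (2 * (y \<bullet> (y' - y)) / ?N + (norm (y' - y))\<^sup>2)"
    using assms by (rule mult_left_mono)
  then have "\<sigma> * ln (1 + (norm y')\<^sup>2) - \<sigma> * ln ?N \<le> \<sigma> * (2 * (y \<bullet> (y' - y)) / ?N) + \<sigma> * (norm (y' - y))\<^sup>2"
    by (simp only: distrib_left right_diff_distrib)
  moreover have "((- 2 * \<sigma> / ?N) *\<^sub>R y) \<bullet> (y' - y) = - (\<sigma> * (2 * (y \<bullet> (y' - y)) / ?N))" by simp
  ultimately show ?thesis by linarith
qed

text \<open>\<open>q\<close> is an admissible gradient at \<open>y\<close> of an approximate subsolution, not only at \<open>x0\<close> but for all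
  slow variables near \<open>x0\<close>.\<close>

definition feasible :: "'x \<Rightarrow> 'x \<Rightarrow> real \<Rightarrow> real \<Rightarrow> real \<Rightarrow> 'y \<Rightarrow> 'y \<Rightarrow> bool" where
  "feasible x0 p b \<mu> \<rho> y q \<longleftrightarrow> (\<forall>x\<in>cball x0 \<rho>. \<forall>a\<in>A. - \<mu> \<le> q \<bullet> g x y a + lagr p x y a + b)"

text \<open>Far out the running cost exceeds \<open>1\<close>, so that constants are strict subsolutions there. The gradient
  of \<open>\<sigma> * ln (1 + (norm y)\<^sup>2)\<close> decays like \<open>2 * \<sigma> / norm y\<close>, which compensates the linear growth
  of \<open>g\<close>; hence the logarithm may be used as well if \<open>\<sigma>\<close> is small.\<close>

lemma far_field:
  obtains R0 \<sigma> where "0 \<le> R0" "0 < \<sigma>"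
    "\<And>x y a. \<lbrakk>x \<in> cball x0 1; R0 \<le> norm y; a \<in> A\<rbrakk> \<Longrightarrow> 1 \<le> lagr p x y a + b"
    "\<And>x y a. \<lbrakk>x \<in> cball x0 1; R0 \<le> norm y; a \<in> A\<rbrakk> \<Longrightarrow>
      0 \<le> ((- 2 * \<sigma> / (1 + (norm y)\<^sup>2)) *\<^sub>R y) \<bullet> g x y a + lagr p x y a + b"
proof -
  obtain R0 where R0: "0 \<le> R0" "\<And>x y a. \<lbrakk>x \<in> cball x0 1; R0 \<le> norm y; a \<in> A\<rbrakk> \<Longrightarrow> 1 + norm p * Q0 + \<bar>b\<bar> \<le> l x y a"
    using l_coercive by blast
  have far: "1 \<le> lagr p x y a + b" if "x \<in> cball x0 1" "R0 \<le> norm y" "a \<in> A" for x y a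
  proof -
    have "\<bar>p \<bullet> f x y a\<bar> \<le> norm p * norm (f x y a)" by (rule Cauchy_Schwarz_ineq2)
    also have "\<dots> \<le> norm p * Q0" using bounded_f[OF that(3)] by (intro mult_left_mono) auto
    finally show ?thesis using R0(2)[OF that] by (simp add: lagr_def)
  qed
  obtain G where G: "0 \<le> G" "\<And>x y a. \<lbrakk>x \<in> cball x0 1; y \<in> {0}; a \<in> A\<rbrakk> \<Longrightarrow> norm (g x y a) \<le> G"
    by (rule bounded_on_compact[OF cont_g, of "cball x0 1" "{0}"]) auto
  define \<sigma> where "\<sigma> = 1 / (G + 2 * L0 + 1)"
  have \<sigma>: "0 < \<sigma>" using G(1) L0_pos by (simp add: \<sigma>_def add_nonneg_pos)
  have "0 \<le> ((- 2 * \<sigma> / (1 + (norm y)\<^sup>2)) *\<^sub>R y) \<bullet> g x y a + lagr p x y a + b"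
    if "x \<in> cball x0 1" "R0 \<le> norm y" "a \<in> A" for x y a
  proof -
    let ?N = "1 + (norm y)\<^sup>2"
    have N: "0 < ?N" by (simp add: add_pos_nonneg)
    have 1: "2 * norm y \<le> ?N" using zero_le_power2[of "norm y - 1"] by (simp add: power2_diff)
    have "norm (g x y a) \<le> norm (g x 0 a) + norm (g x y a - g x 0 a)"
      using norm_triangle_ineq[of "g x 0 a" "g x y a - g x 0 a"] by simp
    also have "\<dots> \<le> G + L0 * norm y" using lipschitz_g[OF that(3), of x y x 0] G(2)[of x 0 a] that by simp
    finally have g: "norm (g x y a) \<le> G + L0 * norm y" .
    have "2 * norm y * norm (g x y a) \<le> 2 * norm y * (G + L0 * norm y)" using g by (intro mult_left_mono) auto
    also have "\<dots> = (2 * norm y) * G + 2 * L0 * (norm y)\<^sup>2" by (simp add: algebra_simps power2_eq_square)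
    also have "\<dots> \<le> ?N * G + 2 * L0 * ?N" using 1 G(1) L0_pos by (intro add_mono mult_right_mono mult_left_mono) auto
    also have "\<dots> \<le> ?N * (G + 2 * L0 + 1)" using N by (simp add: algebra_simps)
    finally have le: "\<sigma> * (2 * norm y * norm (g x y a)) \<le> \<sigma> * (?N * (G + 2 * L0 + 1))"
      using \<sigma> by (intro mult_left_mono) auto
    also have "\<sigma> * (?N * (G + 2 * L0 + 1)) = ?N" using G(1) L0_pos by (simp add: \<sigma>_def)
    finally have le: "2 * \<sigma> / ?N * (norm y * norm (g x y a)) \<le> 1" using N by (simp add: field_simps)
    have "\<bar>((- 2 * \<sigma> / ?N) *\<^sub>R y) \<bullet> g x y a\<bar> \<le> norm ((- 2 * \<sigma> / ?N) *\<^sub>R y) * norm (g x y a)"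
      by (rule Cauchy_Schwarz_ineq2)
    also have "\<dots> = 2 * \<sigma> / ?N * (norm y * norm (g x y a))" using \<sigma> N by simp
    finally show ?thesis using le far[OF that] by linarith
  qed
  with far show ?thesis using that R0(1) \<sigma> by blast
qed

text \<open>At \<open>y\<close> with \<open>norm y \<le> R\<close> the quadratic touches \<open>u\<close> at an interior point \<open>\<zeta> y\<close> of the larger
  ball, and the gradient bound makes \<open>norm (\<zeta> y - y)\<close> of order \<open>\<kappa>\<close>. So the subsolution inequality
  at \<open>(x0, \<zeta> y)\<close> carries over to \<open>(x, y)\<close> with a small error.\<close>

lemma regularized_subsolution:
  assumes u: "cell_subsolution x0 p b u"
    and R: "0 \<le> R" and \<mu>: "0 < \<mu>"
  obtains v q \<rho> C where "continuous_on UNIV v" "0 < \<rho>" "\<rho> \<le> 1" "0 \<le> C"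
    "\<And>y y'. v y + q y \<bullet> (y' - y) - C * (norm (y' - y))\<^sup>2 \<le> v y'"
    "\<And>y. norm y \<le> R \<Longrightarrow> feasible x0 p b \<mu> \<rho> y (q y)"
    "\<And>y. norm y \<le> R \<Longrightarrow> u y \<le> v y"
    "\<And>y. norm y \<le> R \<Longrightarrow> \<exists>z\<in>cball y 1. v y \<le> u z"
proof -
  have usc: "usc_on UNIV u" using u by (simp add: viscosity_subsolution_def)
  define S where "S = R + 1"
  have S: "0 \<le> S" using R by (simp add: S_def)
  obtain zm where zm: "\<And>w. w \<in> cball 0 S \<Longrightarrow> u w \<le> u zm"
    by (rule usc_on_attains_sup[OF usc, of "cball 0 S"]) (use S in auto)
  obtain m where m: "\<And>y. y \<in> cball 0 S \<Longrightarrow> m \<le> u y"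
    using subsolution_bounded_below[OF u, of "cball 0 S"] by (metis compact_cball)
  obtain Cq where Cq: "0 \<le> Cq" "\<And>y q. \<lbrakk>y \<in> cball 0 S; hamiltonian f g l A x0 y p q \<le> b\<rbrakk> \<Longrightarrow> norm q \<le> Cq"
    using gradient_bound[of "cball 0 S"] by (metis compact_cball)
  obtain \<theta> where \<theta>: "0 < \<theta>" "\<And>x x' y y' a. \<lbrakk>x \<in> cball x0 1; x' \<in> cball x0 1; y \<in> cball 0 S; y' \<in> cball 0 S; a \<in> A;
      dist x x' \<le> \<theta>; dist y y' \<le> \<theta>\<rbrakk> \<Longrightarrow> norm (lagr p x y a - lagr p x' y' a) \<le> \<mu> / 2"
    by (rule uniformly_continuous_on_compact[OF cont_lagr, of "cball x0 1" "cball 0 S" "\<mu>/2" p]) (use \<mu> in auto)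
  \<comment> \<open>Half of the error \<open>\<mu>\<close> is reserved for \<open>lagr\<close>, the other half for \<open>q \<bullet> g\<close>.\<close>
  define \<rho> where "\<rho> = min 1 (min \<theta> (\<mu> / (4 * (Cq + 1) * L0)))"
  have \<rho>: "0 < \<rho>" "\<rho> \<le> 1" "\<rho> \<le> \<theta>" using \<theta>(1) \<mu> Cq(1) L0_pos by (auto simp: \<rho>_def)
  have \<rho>\<mu>: "Cq * (L0 * (\<rho> + \<rho>)) \<le> \<mu> / 2"
  proof -
    have "\<rho> \<le> \<mu> / (4 * (Cq + 1) * L0)" by (simp add: \<rho>_def)
    then have "\<rho> * (4 * (Cq + 1) * L0) \<le> \<mu>" using Cq(1) L0_pos by (simp add: pos_le_divide_eq)
    moreover have "0 \<le> \<rho> * L0" using \<rho> L0_pos by simp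
    ultimately show ?thesis by (simp add: algebra_simps)
  qed
  \<comment> \<open>The second bound places \<open>\<zeta> y\<close> in the interior, where the gradient bound applies; then
    the first one yields \<open>norm (\<zeta> y - y) \<le> \<rho>\<close>.\<close>
  define \<kappa> where "\<kappa> = min (\<rho> / (Cq + 1)) (1 / (2 * (\<bar>u zm - m\<bar> + 1)))"
  have \<kappa>: "0 < \<kappa>" using \<rho> Cq(1) abs_ge_zero[of "u zm - m"] unfolding \<kappa>_def by (simp add: add_nonneg_pos)
  have \<kappa>Cq: "\<kappa> * Cq \<le> \<rho>"
  proof -
    have "\<kappa> \<le> \<rho> / (Cq + 1)" by (simp add: \<kappa>_def)
    then have "\<kappa> * (Cq + 1) \<le> \<rho>" using Cq(1) by (simp add: pos_le_divide_eq)
    then show ?thesis using \<kappa> by (simp add: algebra_simps)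
  qed
  have \<kappa>u: "(u zm - m) * (2 * \<kappa>) < 1"
  proof -
    have "\<kappa> \<le> 1 / (2 * (\<bar>u zm - m\<bar> + 1))" by (simp add: \<kappa>_def)
    moreover have "0 < 2 * (\<bar>u zm - m\<bar> + 1)" by (intro mult_pos_pos add_nonneg_pos) auto
    ultimately have "\<kappa> * (2 * (\<bar>u zm - m\<bar> + 1)) \<le> 1" by (simp only: pos_le_divide_eq)
    moreover have "(u zm - m) * (2 * \<kappa>) < (\<bar>u zm - m\<bar> + 1) * (2 * \<kappa>)" using \<kappa> by (intro mult_strict_right_mono) auto
    ultimately show ?thesis by (simp add: algebra_simps)
  qed
  obtain v \<zeta> where \<zeta>: "\<And>y. \<zeta> y \<in> cball 0 S" and v_def: "\<And>y. v y = u (\<zeta> y) - (norm (\<zeta> y - y))\<^sup>2 / (2 * \<kappa>)"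
    and v_ge: "\<And>y w. w \<in> cball 0 S \<Longrightarrow> u w - (norm (w - y))\<^sup>2 / (2 * \<kappa>) \<le> v y"
    and semi: "\<And>y y'. v y + ((1/\<kappa>) *\<^sub>R (\<zeta> y - y)) \<bullet> (y' - y) - (norm (y' - y))\<^sup>2 / (2 * \<kappa>) \<le> v y'"
    and cont: "continuous_on UNIV v"
    using sup_convolution_exists[OF usc \<kappa> S] by metis
  define q where "q y = (1/\<kappa>) *\<^sub>R (\<zeta> y - y)" for y
  have uv: "u y \<le> v y" if "norm y \<le> R" for y using v_ge[of y y] that by (simp add: S_def)
  have close: "norm (\<zeta> y - y) < 1" if y: "norm y \<le> R" for y
  proof -
    have "m \<le> u y" using y by (intro m) (simp add: S_def)
    moreover have "u (\<zeta> y) \<le> u zm" by (rule zm[OF \<zeta>])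
    ultimately have "(norm (\<zeta> y - y))\<^sup>2 / (2 * \<kappa>) \<le> u zm - m" using uv[OF y] v_def[of y] by simp
    then have "(norm (\<zeta> y - y))\<^sup>2 \<le> (u zm - m) * (2 * \<kappa>)" using \<kappa> by (simp add: field_simps)
    then have "(norm (\<zeta> y - y))\<^sup>2 < 1\<^sup>2" using \<kappa>u by simp
    then show ?thesis by (rule power2_less_imp_less) simp
  qed
  have feas: "feasible x0 p b \<mu> \<rho> y (q y)" if y: "norm y \<le> R" for y
    unfolding feasible_def
  proof (intro ballI)
    fix x a assume x: "x \<in> cball x0 \<rho>" and a: "a \<in> A"
    let ?z = "\<zeta> y"
    have z: "?z \<in> ball 0 S"
      using close[OF y] y norm_triangle_ineq[of "?z - y" y] by (simp add: S_def)
    have grad: "C1_gradient UNIV (\<lambda>w. (norm (w - y))\<^sup>2 / (2 * \<kappa>)) (\<lambda>w. (1/\<kappa>) *\<^sub>R (w - y))"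
    proof -
      have "C1_gradient UNIV (\<lambda>w. (norm (w - y))\<^sup>2 / (2 * \<kappa>)) (\<lambda>w. (2 * (1 / (2 * \<kappa>))) *\<^sub>R (w - y))"
        by (rule radial_C1_gradient[of "\<lambda>r. r / (2 * \<kappa>)" "\<lambda>_. 1 / (2 * \<kappa>)"])
          (use \<kappa> in \<open>auto intro!: derivative_eq_intros\<close>)
      then show ?thesis by simp
    qed
    have H: "hamiltonian f g l A x0 ?z p (q y) \<le> b"
      using viscosity_subsolutionD_ball[OF u grad z] v_ge[of _ y] v_def[of y] unfolding q_def by force
    then have qb: "norm (q y) \<le> Cq" using \<zeta> by (intro Cq(2)) auto
    have "?z - y = \<kappa> *\<^sub>R q y" using \<kappa> by (simp add: q_def)
    then have "norm (?z - y) = \<kappa> * norm (q y)" using \<kappa> by simp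
    also have "\<dots> \<le> \<kappa> * Cq" using qb \<kappa> by (intro mult_left_mono) auto
    finally have zy: "norm (?z - y) \<le> \<rho>" using \<kappa>Cq by simp
    have xx: "norm (x - x0) \<le> \<rho>" using x by (simp add: dist_norm norm_minus_commute)
    have "\<bar>q y \<bullet> (g x y a - g x0 ?z a)\<bar> \<le> norm (q y) * norm (g x y a - g x0 ?z a)" by (rule Cauchy_Schwarz_ineq2)
    also have "\<dots> \<le> Cq * (L0 * (norm (x - x0) + norm (y - ?z)))"
      using qb lipschitz_g[OF a] Cq(1) by (intro mult_mono) auto
    also have "\<dots> \<le> Cq * (L0 * (\<rho> + \<rho>))"
      using zy xx L0_pos Cq(1) by (intro mult_left_mono add_mono) (auto simp: norm_minus_commute)
    finally have 1: "\<bar>q y \<bullet> (g x y a - g x0 ?z a)\<bar> \<le> \<mu> / 2" using \<rho>\<mu> by simp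
    have 2: "norm (lagr p x y a - lagr p x0 ?z a) \<le> \<mu> / 2"
      using x \<rho> y \<zeta> a zy by (intro \<theta>(2)) (auto simp: S_def dist_norm norm_minus_commute)
    have 3: "0 \<le> q y \<bullet> g x0 ?z a + lagr p x0 ?z a + b" by (rule hamiltonian_leD[OF H a])
    show "- \<mu> \<le> q y \<bullet> g x y a + lagr p x y a + b"
      using 1 2 3 unfolding inner_diff_right real_norm_def by linarith
  qed
  have "\<exists>z\<in>cball y 1. v y \<le> u z" if y: "norm y \<le> R" for y
    using close[OF y] v_def[of y] \<kappa> by (intro bexI[of _ "\<zeta> y"]) (auto simp: dist_norm norm_minus_commute)
  then show ?thesis
    using that[of v \<rho> "1 / (2 * \<kappa>)" q] cont \<rho> \<kappa> semi feas uv by (simp add: q_def)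
qed

text \<open>Minimum and maximum of approximate subsolutions again satisfy the required inequality, except that
  a minimum may need the subgradients of both functions; therefore two gradients \<open>q1\<close> and \<open>q2\<close> occur.
  The function \<open>w\<close> coincides with the regularized subsolution where the running cost may be small, and
  it is constant where the regularized subsolution is not under control.\<close>

lemma bounded_corrector:
  assumes u: "cell_subsolution x0 p b u" and \<mu>: "0 < \<mu>"
  obtains w \<rho> K C where "continuous_on UNIV w" "0 < \<rho>" "0 \<le> C" "\<And>y. \<bar>w y\<bar> \<le> K"
    "\<And>y. \<exists>q1 q2. feasible x0 p b \<mu> \<rho> y q1 \<and> feasible x0 p b \<mu> \<rho> y q2 \<and>
       (\<forall>y'\<in>ball y 1. w y + min (q1 \<bullet> (y' - y)) (q2 \<bullet> (y' - y)) - C * (norm (y' - y))\<^sup>2 \<le> w y')"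
proof -
  have usc: "usc_on UNIV u" using u by (simp add: viscosity_subsolution_def)
  obtain R0 \<sigma> where R0: "0 \<le> R0" and \<sigma>: "0 < \<sigma>"
    and far: "\<And>x y a. \<lbrakk>x \<in> cball x0 1; R0 \<le> norm y; a \<in> A\<rbrakk> \<Longrightarrow> 1 \<le> lagr p x y a + b"
    and bar: "\<And>x y a. \<lbrakk>x \<in> cball x0 1; R0 \<le> norm y; a \<in> A\<rbrakk> \<Longrightarrow>
      0 \<le> ((- 2 * \<sigma> / (1 + (norm y)\<^sup>2)) *\<^sub>R y) \<bullet> g x y a + lagr p x y a + b"
    using far_field by metis
  obtain zm where zm: "\<And>w. w \<in> cball 0 (R0 + 2) \<Longrightarrow> u w \<le> u zm"
    by (rule usc_on_attains_sup[OF usc, of "cball 0 (R0 + 2)"]) (use R0 in auto)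
  obtain c0 where c0: "\<And>y. y \<in> cball 0 (R0 + 1) \<Longrightarrow> c0 \<le> u y"
    using subsolution_bounded_below[OF u, of "cball 0 (R0 + 1)"] by (metis compact_cball)
  \<comment> \<open>The barrier \<open>B\<close> lies above the regularized subsolution up to radius \<open>R0 + 1\<close> and falls
    below \<open>c0\<close> at radius \<open>R\<close>. The bounds \<open>u zm\<close> and \<open>c0\<close> come from \<open>u\<close>, so \<open>R\<close> can be fixed
    before the regularization, which depends on \<open>R\<close>.\<close>
  define M where "M = u zm + \<sigma> * ln (1 + (R0 + 1)\<^sup>2)"
  define B where "B y = M - \<sigma> * ln (1 + (norm y)\<^sup>2)" for y :: 'y
  define R where "R = R0 + 1 + exp ((M - c0) / \<sigma>)"
  have R: "R0 + 1 \<le> R" "0 \<le> R" using R0 by (auto simp: R_def add_nonneg_nonneg)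
  have B_far: "B y \<le> c0" if "R \<le> norm y" for y
  proof -
    have "exp ((M - c0) / \<sigma>) \<le> norm y" using that R0 by (simp add: R_def)
    also have "norm y \<le> 1 + (norm y)\<^sup>2"
      using zero_le_power2[of "norm y - 1"] by (simp add: power2_diff) (smt (verit) norm_ge_zero)
    finally have "(M - c0) / \<sigma> \<le> ln (1 + (norm y)\<^sup>2)" by (simp add: ln_ge_iff add_pos_nonneg)
    then show ?thesis using \<sigma> by (simp add: B_def field_simps)
  qed
  have B_near: "u zm \<le> B y" if "norm y \<le> R0 + 1" for y
  proof -
    have "(norm y)\<^sup>2 \<le> (R0 + 1)\<^sup>2" using that by (intro power_mono) auto
    then have "ln (1 + (norm y)\<^sup>2) \<le> ln (1 + (R0 + 1)\<^sup>2)" by (simp add: add_pos_nonneg)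
    then show ?thesis using \<sigma> by (simp add: B_def M_def)
  qed
  have B_le: "B y \<le> M" for y using \<sigma> by (simp add: B_def)
  have contB: "continuous_on UNIV B"
    unfolding B_def by (intro continuous_intros) (auto simp: add_nonneg_eq_0_iff)
  obtain v q \<rho> C where v: "continuous_on UNIV v" "0 < \<rho>" "\<rho> \<le> 1" "0 \<le> C"
    and semi: "\<And>y y'. v y + q y \<bullet> (y' - y) - C * (norm (y' - y))\<^sup>2 \<le> v y'"
    and feas: "\<And>y. norm y \<le> R \<Longrightarrow> feasible x0 p b \<mu> \<rho> y (q y)"
    and uv: "\<And>y. norm y \<le> R \<Longrightarrow> u y \<le> v y"
    and vu: "\<And>y. norm y \<le> R \<Longrightarrow> \<exists>z\<in>cball y 1. v y \<le> u z"
    using regularized_subsolution[OF u R(2) \<mu>] by metis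
  define w where "w y = max c0 (min (v y) (B y))" for y
  define C' where "C' = C + \<sigma>"
  have C': "C \<le> C'" "\<sigma> \<le> C'" "0 \<le> C'" using v(4) \<sigma> by (auto simp: C'_def)
  have CC': "C * t \<le> C' * t" "\<sigma> * t \<le> C' * t" if "0 \<le> t" for t using C' that by (auto intro: mult_right_mono)
  have near: "w y = v y" if y: "norm y \<le> R0 + 1" for y
  proof -
    obtain z where z: "z \<in> cball y 1" "v y \<le> u z" using vu[of y] y R by auto
    have "norm z \<le> R0 + 2" using z(1) y norm_triangle_ineq[of "z - y" y] by (simp add: dist_norm norm_minus_commute)
    then have "v y \<le> u zm" using zm[of z] z(2) by simp
    moreover have "c0 \<le> v y" using c0[of y] uv[of y] y R by simp
    ultimately show ?thesis using B_near[OF y] by (simp add: w_def)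
  qed
  have inball: "norm x \<le> norm y + 1" if "x \<in> ball y 1" for x y :: 'y
    using that norm_triangle_ineq[of "x - y" y] by (simp add: dist_norm norm_minus_commute)
  have local: "\<exists>q1 q2. feasible x0 p b \<mu> \<rho> y q1 \<and> feasible x0 p b \<mu> \<rho> y q2 \<and>
       (\<forall>y'\<in>ball y 1. w y + min (q1 \<bullet> (y' - y)) (q2 \<bullet> (y' - y)) - C' * (norm (y' - y))\<^sup>2 \<le> w y')" for y
  proof (cases "norm y \<le> R0")
    case True
    have "w y + min (q y \<bullet> (y' - y)) (q y \<bullet> (y' - y)) - C' * (norm (y' - y))\<^sup>2 \<le> w y'" if "y' \<in> ball y 1" for y'
      using semi[of y y'] CC'(1)[of "(norm (y' - y))\<^sup>2"] near[of y] near[of y'] inball[OF that] True by simp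
    then show ?thesis using feas[of y] True R by (intro exI[of _ "q y"]) auto
  next
    case far_y: False
    have sub: "cball x0 \<rho> \<subseteq> cball x0 1" using v(3) by auto
    show ?thesis
    proof (cases "min (v y) (B y) \<le> c0")
      case True
      have "feasible x0 p b \<mu> \<rho> y 0"
        unfolding feasible_def
      proof (intro ballI)
        fix x a assume "x \<in> cball x0 \<rho>" "a \<in> A"
        then show "- \<mu> \<le> 0 \<bullet> g x y a + lagr p x y a + b" using far[of x y a] sub far_y \<mu> by auto
      qed
      moreover have "w y + min (0 \<bullet> (y' - y)) (0 \<bullet> (y' - y)) - C' * (norm (y' - y))\<^sup>2 \<le> w y'" for y'
      proof -
        have "w y \<le> w y'" using True by (simp add: w_def)
        moreover have "0 \<le> C' * (norm (y' - y))\<^sup>2" using C'(3) by simp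
        ultimately show ?thesis by simp
      qed
      ultimately show ?thesis by (intro exI[of _ 0] conjI ballI)
    next
      case False
      then have "norm y \<le> R" using B_far[of y] by (cases "R \<le> norm y") auto
      then have f1: "feasible x0 p b \<mu> \<rho> y (q y)" by (rule feas)
      let ?q = "(- 2 * \<sigma> / (1 + (norm y)\<^sup>2)) *\<^sub>R y"
      have f2: "feasible x0 p b \<mu> \<rho> y ?q"
        unfolding feasible_def
      proof (intro ballI)
        fix x a assume "x \<in> cball x0 \<rho>" "a \<in> A"
        then show "- \<mu> \<le> ?q \<bullet> g x y a + lagr p x y a + b" using bar[of x y a] sub far_y \<mu> by auto
      qed
      have "w y + min (q y \<bullet> (y' - y)) (?q \<bullet> (y' - y)) - C' * (norm (y' - y))\<^sup>2 \<le> w y'" for y'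
      proof -
        have wy: "w y = min (v y) (B y)" using False by (simp add: w_def)
        have 1: "v y + q y \<bullet> (y' - y) - C' * (norm (y' - y))\<^sup>2 \<le> v y'"
          using semi[of y y'] CC'(1)[of "(norm (y' - y))\<^sup>2"] by simp
        have 2: "B y + ?q \<bullet> (y' - y) - C' * (norm (y' - y))\<^sup>2 \<le> B y'"
          using log_barrier_subgradient[of \<sigma> y y'] \<sigma> CC'(2)[of "(norm (y' - y))\<^sup>2"] by (simp add: B_def)
        have "w y' \<ge> min (v y') (B y')" by (simp add: w_def)
        then show ?thesis using 1 2 wy by linarith
      qed
      then show ?thesis using f1 f2 by blast
    qed
  qed
  have bounded: "\<bar>w y\<bar> \<le> \<bar>c0\<bar> + \<bar>M\<bar>" for y using B_le[of y] by (auto simp: w_def max_def min_def)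
  have "continuous_on UNIV w" unfolding w_def by (intro continuous_intros v(1) contB)
  then show ?thesis using that[OF _ v(2) C'(3) bounded local] by blast
qed

text \<open>Along a trajectory, \<open>w (\<eta> s)\<close> plus the integral of \<open>lagr p + b + \<mu>\<close> up to \<open>s\<close> does not
  decrease: a lower quadratic approximation of \<open>w\<close> at \<open>\<eta> s\<close> is enough for a step to the right, because
  the inner product of a subgradient with the increment of \<open>\<eta>\<close> is the integral of \<open>q \<bullet> g\<close>. As \<open>w\<close> is
  bounded, the estimate follows, with twice the bound of \<open>w\<close> as constant.\<close>

lemma running_cost_lower_bound:
  assumes u: "cell_subsolution x0 p b u" and \<mu>: "0 < \<mu>"
  obtains \<rho> K where "0 < \<rho>" "\<And>\<epsilon> x y \<alpha> \<xi> \<eta> T. \<lbrakk>trajectory f g \<epsilon> x y \<alpha> \<xi> \<eta>; \<alpha> \<in> controls A; 0 \<le> T;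
      \<forall>s\<in>{0..T}. \<xi> s \<in> cball x0 \<rho>\<rbrakk>
      \<Longrightarrow> - K - \<mu> * T \<le> integral {0..T} (\<lambda>s. lagr p (\<xi> s) (\<eta> s) (\<alpha> s) + b)"
proof -
  \<comment> \<open>One third each for the corrector, for the variation of the data within a step, and for
    the quadratic error.\<close>
  define \<nu> where "\<nu> = \<mu> / 3"
  have \<nu>: "0 < \<nu>" using \<mu> by (simp add: \<nu>_def)
  obtain w \<rho> K C where w: "continuous_on UNIV w" and \<rho>: "0 < \<rho>" and C: "0 \<le> C" and wK: "\<And>y. \<bar>w y\<bar> \<le> K"
    and sub: "\<And>y. \<exists>q1 q2. feasible x0 p b \<nu> \<rho> y q1 \<and> feasible x0 p b \<nu> \<rho> y q2 \<and>
       (\<forall>y'\<in>ball y 1. w y + min (q1 \<bullet> (y' - y)) (q2 \<bullet> (y' - y)) - C * (norm (y' - y))\<^sup>2 \<le> w y')"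
    using bounded_corrector[OF u \<nu>] by metis
  have main: "- (2 * K) - \<mu> * T \<le> integral {0..T} (\<lambda>s. lagr p (\<xi> s) (\<eta> s) (\<alpha> s) + b)"
    if tr: "trajectory f g \<epsilon> x y \<alpha> \<xi> \<eta>" and \<alpha>: "\<alpha> \<in> controls A" and T: "0 \<le> T"
      and \<xi>: "\<forall>s\<in>{0..T}. \<xi> s \<in> cball x0 \<rho>" for \<epsilon> x y \<alpha> \<xi> \<eta> T
  proof -
    define k where "k s = lagr p (\<xi> s) (\<eta> s) (\<alpha> s) + b" for s
    have k_int: "k integrable_on {s..t}" if "0 \<le> s" for s t
      unfolding k_def by (intro integrable_add trajectory_integrable[OF cont_lagr tr \<alpha> that] integrable_const_ivl)
    have \<eta>_cont: "continuous_on {s..t} \<eta>" if "0 \<le> s" for s t by (rule trajectory_continuous(2)[OF tr that])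
    define m where "m s = w (\<eta> s) + integral {0..s} (\<lambda>s. k s + 3 * \<nu>)" for s
    have k3_int: "(\<lambda>s. k s + 3 * \<nu>) integrable_on {s..t}" if "0 \<le> s" for s t
      by (intro integrable_add k_int that integrable_const_ivl)
    have "m 0 \<le> m T"
    proof (rule continuous_nondecreasing_criterion[OF _ T])
      show "continuous_on {0..T} m" unfolding m_def
        by (intro continuous_intros continuous_on_compose2[OF w \<eta>_cont] indefinite_integral_continuous_1 k3_int) auto
      fix s assume s: "0 \<le> s" "s < T"
      let ?y = "\<eta> s"
      obtain q1 q2 where q: "feasible x0 p b \<nu> \<rho> ?y q1" "feasible x0 p b \<nu> \<rho> ?y q2"
        and wq: "\<And>y'. y' \<in> ball ?y 1 \<Longrightarrow> w ?y + min (q1 \<bullet> (y' - ?y)) (q2 \<bullet> (y' - ?y)) - C * (norm (y' - ?y))\<^sup>2 \<le> w y'"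
        using sub by blast
      obtain G where G: "0 \<le> G" "\<And>x y a. \<lbrakk>x \<in> cball x0 \<rho>; y \<in> cball ?y 1; a \<in> A\<rbrakk> \<Longrightarrow> norm (g x y a) \<le> G"
        by (rule bounded_on_compact[OF cont_g, of "cball x0 \<rho>" "cball ?y 1"]) auto
      have stable: "\<exists>\<delta>>0. \<forall>x\<in>cball x0 \<rho>. \<forall>y'\<in>cball ?y 1. \<forall>a\<in>A. dist y' ?y \<le> \<delta> \<longrightarrow>
          - 2 * \<nu> \<le> q \<bullet> g x y' a + lagr p x y' a + b" if q: "feasible x0 p b \<nu> \<rho> ?y q" for q
      proof -
        have k: "continuous_on (UNIV \<times> UNIV \<times> A) (\<lambda>(x, y, a). q \<bullet> g x y a + lagr p x y a)"
          using cont_g cont_lagr[of p] unfolding case_prod_unfold by (intro continuous_intros)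
        obtain \<delta> where \<delta>: "0 < \<delta>" "\<And>x x' y y' a. \<lbrakk>x \<in> cball x0 \<rho>; x' \<in> cball x0 \<rho>; y \<in> cball ?y 1; y' \<in> cball ?y 1; a \<in> A;
          dist x x' \<le> \<delta>; dist y y' \<le> \<delta>\<rbrakk> \<Longrightarrow> norm ((q \<bullet> g x y a + lagr p x y a) - (q \<bullet> g x' y' a + lagr p x' y' a)) \<le> \<nu>"
          by (rule uniformly_continuous_on_compact[OF k, of "cball x0 \<rho>" "cball ?y 1" \<nu>]) (use \<nu> in auto)
        show ?thesis
        proof (intro exI[of _ \<delta>] conjI ballI impI \<delta>(1))
          fix x y' a assume *: "x \<in> cball x0 \<rho>" "y' \<in> cball ?y 1" "a \<in> A" "dist y' ?y \<le> \<delta>"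
          have "\<bar>(q \<bullet> g x y' a + lagr p x y' a) - (q \<bullet> g x ?y a + lagr p x ?y a)\<bar> \<le> \<nu>"
            using \<delta>(2)[of x x y' ?y a] * \<delta>(1) by simp
          moreover have "- \<nu> \<le> q \<bullet> g x ?y a + lagr p x ?y a + b" using q * unfolding feasible_def by blast
          ultimately show "- 2 * \<nu> \<le> q \<bullet> g x y' a + lagr p x y' a + b" by linarith
        qed
      qed
      obtain \<delta>1 where \<delta>1: "0 < \<delta>1" "\<And>x y' a. \<lbrakk>x \<in> cball x0 \<rho>; y' \<in> cball ?y 1; a \<in> A; dist y' ?y \<le> \<delta>1\<rbrakk> \<Longrightarrow>
          - 2 * \<nu> \<le> q1 \<bullet> g x y' a + lagr p x y' a + b" using stable[OF q(1)] by metis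
      obtain \<delta>2 where \<delta>2: "0 < \<delta>2" "\<And>x y' a. \<lbrakk>x \<in> cball x0 \<rho>; y' \<in> cball ?y 1; a \<in> A; dist y' ?y \<le> \<delta>2\<rbrakk> \<Longrightarrow>
          - 2 * \<nu> \<le> q2 \<bullet> g x y' a + lagr p x y' a + b" using stable[OF q(2)] by metis
      define \<delta> where "\<delta> = min (1/2) (min \<delta>1 \<delta>2)"
      have \<delta>: "0 < \<delta>" "\<delta> < 1" "\<delta> \<le> \<delta>1" "\<delta> \<le> \<delta>2" using \<delta>1 \<delta>2 by (auto simp: \<delta>_def)
      have "continuous (at s within {0..T}) \<eta>"
        using \<eta>_cont[of 0 T] s by (simp add: continuous_on_eq_continuous_within)
      then obtain h1 where h1: "0 < h1" "\<And>t. \<lbrakk>t \<in> {0..T}; dist t s < h1\<rbrakk> \<Longrightarrow> dist (\<eta> t) ?y < \<delta>"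
        unfolding continuous_within_eps_delta using \<delta>(1) by metis
      \<comment> \<open>The increment of \<open>\<eta>\<close> is at most \<open>G * h\<close>, so the quadratic error is at most \<open>\<nu> * h\<close>.\<close>
      define h where "h = min (h1 / 2) (min (T - s) (\<nu> / (C * G\<^sup>2 + 1)))"
      have CG: "0 \<le> C * G\<^sup>2" using C by simp
      have h: "0 < h" "s + h \<le> T" "h < h1" using h1(1) s \<nu> CG by (auto simp: h_def)
      have hC: "C * G\<^sup>2 * h \<le> \<nu>"
      proof -
        have "h \<le> \<nu> / (C * G\<^sup>2 + 1)" by (simp add: h_def)
        then have "h * (C * G\<^sup>2 + 1) \<le> \<nu>" using CG by (simp add: pos_le_divide_eq)
        then show ?thesis using h(1) by (simp add: algebra_simps)
      qed
      have near: "\<xi> t \<in> cball x0 \<rho>" "\<eta> t \<in> cball ?y 1" "\<alpha> t \<in> A" "dist (\<eta> t) ?y \<le> \<delta>" if "t \<in> {s..s+h}" for t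
      proof -
        have t: "0 \<le> t" "t \<le> T" "dist t s < h1" using that s h by (auto simp: dist_real_def)
        show "\<xi> t \<in> cball x0 \<rho>" using \<xi> t by simp
        show "dist (\<eta> t) ?y \<le> \<delta>" using h1(2)[of t] t by simp
        then show "\<eta> t \<in> cball ?y 1" using \<delta>(2) by (simp add: dist_commute)
        show "\<alpha> t \<in> A" using \<alpha> t by (simp add: controls_def)
      qed
      let ?d = "\<eta> (s + h) - ?y"
      have d_int: "((\<lambda>t. g (\<xi> t) (\<eta> t) (\<alpha> t)) has_integral ?d) {s..s+h}"
        using trajectory_increment(2)[OF tr s(1), of "s + h"] h by simp
      have "norm ?d \<le> G * measure lborel (cbox s (s + h))"
        by (rule has_integral_bound[of _ "\<lambda>t. g (\<xi> t) (\<eta> t) (\<alpha> t)"]) (use G near d_int in auto)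
      then have "norm ?d \<le> G * h" using h by simp
      then have "(norm ?d)\<^sup>2 \<le> (G * h)\<^sup>2" by (intro power_mono) auto
      then have "C * (norm ?d)\<^sup>2 \<le> C * (G * h)\<^sup>2" using C by (intro mult_left_mono)
      also have "\<dots> = h * (C * G\<^sup>2 * h)" by (simp add: power2_eq_square)
      also have "\<dots> \<le> h * \<nu>" using hC h by (intro mult_left_mono) auto
      finally have err: "C * (norm ?d)\<^sup>2 \<le> h * \<nu>" .
      have dir: "- 2 * \<nu> * h \<le> q \<bullet> ?d + integral {s..s+h} k"
        if q: "\<And>t. t \<in> {s..s+h} \<Longrightarrow> - 2 * \<nu> \<le> q \<bullet> g (\<xi> t) (\<eta> t) (\<alpha> t) + k t" for q
      proof -
        have "((\<lambda>t. q \<bullet> g (\<xi> t) (\<eta> t) (\<alpha> t)) has_integral (q \<bullet> ?d)) {s..s+h}"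
          using has_integral_linear[OF d_int bounded_linear_inner_right[of q]] by (simp add: o_def)
        then have I: "((\<lambda>t. q \<bullet> g (\<xi> t) (\<eta> t) (\<alpha> t) + k t) has_integral (q \<bullet> ?d + integral {s..s+h} k)) {s..s+h}"
          by (intro has_integral_add integrable_integral k_int s)
        have J: "((\<lambda>t. - 2 * \<nu>) has_integral (- 2 * \<nu> * h)) {s..s+h}"
          using has_integral_const_real[of "- 2 * \<nu>" s "s + h"] h by (simp add: mult.commute)
        show ?thesis by (rule has_integral_le[OF J I q])
      qed
      have "- 2 * \<nu> * h \<le> q1 \<bullet> ?d + integral {s..s+h} k"
      proof (rule dir)
        fix t assume t: "t \<in> {s..s+h}"
        show "- 2 * \<nu> \<le> q1 \<bullet> g (\<xi> t) (\<eta> t) (\<alpha> t) + k t"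
          using \<delta>1(2)[of "\<xi> t" "\<eta> t" "\<alpha> t"] near[OF t] \<delta> by (simp add: k_def)
      qed
      moreover have "- 2 * \<nu> * h \<le> q2 \<bullet> ?d + integral {s..s+h} k"
      proof (rule dir)
        fix t assume t: "t \<in> {s..s+h}"
        show "- 2 * \<nu> \<le> q2 \<bullet> g (\<xi> t) (\<eta> t) (\<alpha> t) + k t"
          using \<delta>2(2)[of "\<xi> t" "\<eta> t" "\<alpha> t"] near[OF t] \<delta> by (simp add: k_def)
      qed
      moreover have "w ?y + min (q1 \<bullet> ?d) (q2 \<bullet> ?d) - C * (norm ?d)\<^sup>2 \<le> w (\<eta> (s + h))"
        using near(4)[of "s + h"] h \<delta>(2) by (intro wq) (simp add: dist_commute)
      moreover have "integral {0..s+h} (\<lambda>s. k s + 3 * \<nu>) = integral {0..s} (\<lambda>s. k s + 3 * \<nu>) + (integral {s..s+h} k + 3 * \<nu> * h)"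
      proof -
        have "integral {s..s+h} (\<lambda>s. k s + 3 * \<nu>) = integral {s..s+h} k + 3 * \<nu> * h"
          using h by (subst integral_add) (auto intro: k_int[OF s(1)] simp: mult.commute)
        then show ?thesis
          using Henstock_Kurzweil_Integration.integral_combine[of 0 s "s+h" "\<lambda>s. k s + 3 * \<nu>"] s h k3_int by simp
      qed
      ultimately have "m s \<le> m (s + h)"
        using err unfolding m_def by (simp add: min_def algebra_simps split: if_splits)
      then show "\<exists>h>0. s + h \<le> T \<and> m s \<le> m (s + h)" using h by blast
    qed
    moreover have "integral {0..T} (\<lambda>s. k s + 3 * \<nu>) = integral {0..T} k + \<mu> * T"
      using T by (subst integral_add) (auto intro: k_int simp: mult.commute \<nu>_def)
    ultimately have "w (\<eta> 0) \<le> w (\<eta> T) + (integral {0..T} k + \<mu> * T)" by (simp add: m_def)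
    then show ?thesis using wK[of "\<eta> 0"] wK[of "\<eta> T"] unfolding k_def by linarith
  qed
  show ?thesis by (rule that[OF \<rho> main])
qed

section \<open>The supersolution property\<close>

text \<open>Ensures that the effective Hamiltonian is the infimum of a nonempty set; for the empty set the
  infimum of reals would be an arbitrary default value.\<close>

lemma constant_subsolution_exists:
  "\<exists>b u. cell_subsolution x p b u"
proof -
  obtain B where B: "0 \<le> B" "\<And>x' y a. \<lbrakk>x' \<in> cball x 0; a \<in> A\<rbrakk> \<Longrightarrow> - B \<le> l x' y a"
    using l_bounded_below by blast
  have H: "hamiltonian f g l A x y p 0 \<le> norm p * Q0 + B" for y
    unfolding hamiltonian_def
  proof (rule cSUP_least[OF A_nonempty])
    fix a assume a: "a \<in> A"
    have "\<bar>p \<bullet> f x y a\<bar> \<le> norm p * norm (f x y a)" by (rule Cauchy_Schwarz_ineq2)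
    also have "\<dots> \<le> norm p * Q0" using bounded_f[OF a] by (intro mult_left_mono) auto
    finally show "- (p \<bullet> f x y a) - 0 \<bullet> g x y a - l x y a \<le> norm p * Q0 + B"
      using B(2)[of x a y] a by simp
  qed
  have "viscosity_subsolution UNIV (\<lambda>y q. hamiltonian f g l A x y p q - (norm p * Q0 + B)) (\<lambda>_. 0)"
    unfolding viscosity_subsolution_def
  proof (intro conjI allI impI ballI)
    show "usc_on UNIV (\<lambda>_. 0::real)" by (simp add: usc_on_def)
    fix \<phi> D and z :: 'y assume \<phi>: "C1_gradient UNIV \<phi> D" and max: "\<forall>\<^sub>F w in at z within UNIV. 0 - \<phi> w \<le> 0 - \<phi> z"
    have "(\<phi> has_derivative (\<lambda>h. h \<bullet> D z)) (at z)"
      using \<phi> unfolding C1_gradient_def gderiv_def by simp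
    moreover have "\<forall>\<^sub>F w in at z. \<phi> z \<le> \<phi> w" using max by simp
    ultimately have "(\<lambda>h. h \<bullet> D z) = (\<lambda>h. 0)" by (rule has_derivative_local_min)
    then have "D z \<bullet> D z = 0" by metis
    then have "D z = 0" by simp
    then show "hamiltonian f g l A x z p (D z) - (norm p * Q0 + B) \<le> 0" using H by simp
  qed
  then show ?thesis by blast
qed

text \<open>If \<open>\<eta>\<close> stayed outside the ball of radius \<open>R\<close> during the slow time interval \<open>[\<tau> / 2, \<tau>]\<close>, the
  running cost on this interval alone would exceed the given bound on the total cost.\<close>

lemma fast_variable_returns:
  assumes \<tau>: "0 < \<tau>"
  obtains R where "0 \<le> R" "\<And>\<epsilon> x y t \<alpha> \<xi> \<eta>. \<lbrakk>0 < \<epsilon>; dist x x0 \<le> 1; \<tau> \<le> t; t \<le> t1; \<alpha> \<in> controls A; trajectory f g \<epsilon> x y \<alpha> \<xi> \<eta>;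
      cost \<epsilon> t \<alpha> \<xi> \<eta> < c\<rbrakk> \<Longrightarrow> \<exists>s. \<tau> / 2 \<le> s \<and> s \<le> \<tau> \<and> norm (\<eta> (s / \<epsilon>)) \<le> R"
proof -
  define \<rho> where "\<rho> = 1 + Q0 * t1"
  obtain B where B: "0 \<le> B" "\<And>x y a. \<lbrakk>x \<in> cball x0 \<rho>; a \<in> A\<rbrakk> \<Longrightarrow> - B \<le> l x y a"
    using l_bounded_below by blast
  define C where "C = 2 * (\<bar>c\<bar> + B * t1 + Q0) / \<tau>"
  obtain R where R: "0 \<le> R" "\<And>x y a. \<lbrakk>x \<in> cball x0 \<rho>; R \<le> norm y; a \<in> A\<rbrakk> \<Longrightarrow> C \<le> l x y a"
    using l_coercive by blast
  have "\<exists>s. \<tau> / 2 \<le> s \<and> s \<le> \<tau> \<and> norm (\<eta> (s / \<epsilon>)) \<le> R"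
    if \<epsilon>: "0 < \<epsilon>" and x: "dist x x0 \<le> 1" and t: "\<tau> \<le> t" "t \<le> t1" and \<alpha>: "\<alpha> \<in> controls A"
      and tr: "trajectory f g \<epsilon> x y \<alpha> \<xi> \<eta>" and lt: "cost \<epsilon> t \<alpha> \<xi> \<eta> < c" for \<epsilon> x y t \<alpha> \<xi> \<eta>
  proof (rule ccontr)
    assume "\<not> ?thesis"
    then have out: "R < norm (\<eta> (s / \<epsilon>))" if "\<tau> / 2 \<le> s" "s \<le> \<tau>" for s using that by (meson not_less)
    have inball: "cball x (Q0 * t') \<subseteq> cball x0 \<rho>" if "t' \<le> t" for t'
    proof -
      have "Q0 * t' \<le> Q0 * t1" using that t Q0_nonneg by (intro mult_left_mono) auto
      then show ?thesis using x by (intro cball_subset_cball_iff[THEN iffD2]) (simp add: \<rho>_def dist_commute)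
    qed
    let ?k = "\<lambda>s. l (\<xi> s) (\<eta> s) (\<alpha> s)"
    have k_int: "?k integrable_on {s..s'}" if "0 \<le> s" for s s' by (rule trajectory_integrable[OF cont_l tr \<alpha> that])
    have \<xi>: "\<xi> s \<in> cball x (Q0 * (\<epsilon> * s))" if "0 \<le> s" for s
      using trajectory_slow_speed[OF tr \<alpha>, of 0 s] that \<epsilon>
      by (simp add: trajectory_init(1)[OF tr] dist_norm norm_minus_commute mult_ac)
    have 1: "- B * (\<tau> / 2 / \<epsilon>) \<le> integral {0..\<tau> / 2 / \<epsilon>} ?k"
    proof -
      have sub: "cball x (\<epsilon> * Q0 * (\<tau> / 2 / \<epsilon>)) \<subseteq> cball x0 \<rho>" using inball[of "\<tau> / 2"] t \<tau> \<epsilon> by simp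
      have "- B * (\<tau> / 2 / \<epsilon> - 0) \<le> integral {0..\<tau> / 2 / \<epsilon>} ?k"
        by (rule integral_l_lower[OF tr \<alpha> \<epsilon>]) (use sub B(2) \<tau> \<epsilon> in auto)
      then show ?thesis by simp
    qed
    have 2: "C * (\<tau> / 2 / \<epsilon>) \<le> integral {\<tau> / 2 / \<epsilon>..\<tau> / \<epsilon>} ?k"
    proof -
      have "integral {\<tau> / 2 / \<epsilon>..\<tau> / \<epsilon>} (\<lambda>_. C) \<le> integral {\<tau> / 2 / \<epsilon>..\<tau> / \<epsilon>} ?k"
      proof (rule integral_le)
        show "?k integrable_on {\<tau> / 2 / \<epsilon>..\<tau> / \<epsilon>}" using \<tau> \<epsilon> by (intro k_int) auto
        fix s assume s: "s \<in> {\<tau> / 2 / \<epsilon>..\<tau> / \<epsilon>}"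
        then have s': "\<tau> / 2 \<le> \<epsilon> * s" "\<epsilon> * s \<le> \<tau>" using \<epsilon> by (auto simp: field_simps)
        have s0: "0 \<le> s" using s \<tau> \<epsilon> by (auto intro: order_trans[rotated])
        have "R \<le> norm (\<eta> s)" using out[OF s'] \<epsilon> by simp
        moreover have "\<xi> s \<in> cball x0 \<rho>" using \<xi>[OF s0] inball[of "\<epsilon> * s"] s' t by auto
        ultimately show "C \<le> ?k s" using \<alpha> s0 by (intro R(2)) (auto simp: controls_def)
      qed (rule integrable_const_ivl)
      moreover have "\<tau> / \<epsilon> - \<tau> / 2 / \<epsilon> = \<tau> / 2 / \<epsilon>" by (simp add: field_simps)
      ultimately show ?thesis using \<tau> \<epsilon> by (simp add: field_simps)
    qed
    have "integral {0..\<tau> / \<epsilon>} ?k = integral {0..\<tau> / 2 / \<epsilon>} ?k + integral {\<tau> / 2 / \<epsilon>..\<tau> / \<epsilon>} ?k"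
      using \<tau> \<epsilon> k_int by (intro Henstock_Kurzweil_Integration.integral_combine[symmetric]) (auto simp: field_simps)
    then have "(C - B) * (\<tau> / 2 / \<epsilon>) \<le> integral {0..\<tau> / \<epsilon>} ?k" using 1 2 unfolding left_diff_distrib by linarith
    then have "\<epsilon> * ((C - B) * (\<tau> / 2 / \<epsilon>)) \<le> \<epsilon> * integral {0..\<tau> / \<epsilon>} ?k" using \<epsilon> by (intro mult_left_mono) auto
    then have early: "(C - B) * (\<tau> / 2) \<le> \<epsilon> * integral {0..\<tau> / \<epsilon>} ?k" using \<epsilon> by simp
    have late: "- B * (t - \<tau>) + - Q0 \<le> W \<epsilon> (\<xi> (\<tau> / \<epsilon>)) (\<eta> (\<tau> / \<epsilon>)) (t - \<epsilon> * (\<tau> / \<epsilon>))"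
    proof -
      have "\<xi> (\<tau> / \<epsilon>) \<in> cball x (Q0 * \<tau>)" using \<xi>[of "\<tau> / \<epsilon>"] \<tau> \<epsilon> by simp
      then have "cball (\<xi> (\<tau> / \<epsilon>)) (Q0 * (t - \<tau>)) \<subseteq> cball x (Q0 * t)"
        using \<open>\<xi> (\<tau> / \<epsilon>) \<in> cball x (Q0 * \<tau>)\<close>
        by (intro cball_subset_cball_iff[THEN iffD2]) (simp add: dist_commute right_diff_distrib)
      then have "cball (\<xi> (\<tau> / \<epsilon>)) (Q0 * (t - \<tau>)) \<subseteq> cball x0 \<rho>" using inball[of t] by auto
      then have "- B * (t - \<tau>) + - Q0 \<le> W \<epsilon> (\<xi> (\<tau> / \<epsilon>)) (\<eta> (\<tau> / \<epsilon>)) (t - \<tau>)"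
        using B(2) lower_bound_u0 t by (intro value_lower \<epsilon>) auto
      then show ?thesis using \<epsilon> by simp
    qed
    have "\<epsilon> * integral {0..\<tau> / \<epsilon>} ?k + W \<epsilon> (\<xi> (\<tau> / \<epsilon>)) (\<eta> (\<tau> / \<epsilon>)) (t - \<epsilon> * (\<tau> / \<epsilon>)) \<le> cost \<epsilon> t \<alpha> \<xi> \<eta>"
      using \<tau> \<epsilon> t by (intro cost_splits_at[OF tr \<alpha> \<epsilon>]) auto
    then have "(C - B) * (\<tau> / 2) - B * (t - \<tau>) - Q0 < c" using early late lt by linarith
    moreover have "C * (\<tau> / 2) = \<bar>c\<bar> + B * t1 + Q0" using \<tau> by (simp add: C_def)
    moreover have "B * t \<le> B * t1" "0 \<le> B * \<tau>" using B(1) t \<tau> by (auto intro: mult_left_mono)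
    moreover have "(C - B) * (\<tau> / 2) = C * (\<tau> / 2) - B * \<tau> / 2" "B * (t - \<tau>) = B * t - B * \<tau>"
      by (simp_all add: field_simps)
    ultimately show False using abs_ge_self[of c] by linarith
  qed
  then show ?thesis by (rule that[OF R(1)])
qed

text \<open>If \<open>q0 + b\<close> were equal to \<open>- \<Lambda> < 0\<close>, a near-optimal trajectory, followed for the slow time \<open>s\<close>,
  would undercut the value at the starting point by \<open>\<Lambda> * s / 2\<close>, up to errors which are small
  compared with \<open>\<Lambda> * \<tau>\<close> where \<open>\<tau> / 2 \<le> s \<le> \<tau>\<close>. The bounded corrector contributes only the
  term \<open>\<epsilon> * K\<close>, because \<open>K\<close> is multiplied by the ratio \<open>\<epsilon>\<close> of the time scales.\<close>

lemma supersolution_inequality: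
  assumes t0: "0 < t0" and \<phi>: "C1_gradient (UNIV \<times> {0<..}) \<phi> D" and D0: "D (x0, t0) = (p, q0)"
    and min: "\<forall>\<^sub>F w in at (x0, t0) within UNIV \<times> {0<..}.
      (\<lambda>(x, t). lower_value x t) w - \<phi> w \<ge> lower_value x0 t0 - \<phi> (x0, t0)"
    and u: "cell_subsolution x0 p b u"
  shows "0 \<le> q0 + b"
proof (rule ccontr)
  assume "\<not> ?thesis"
  define \<Lambda> where "\<Lambda> = - (q0 + b)"
  have \<Lambda>: "0 < \<Lambda>" using \<open>\<not> 0 \<le> q0 + b\<close> by (simp add: \<Lambda>_def)
  then have \<Lambda>4: "0 < \<Lambda> / 4" by simp
  let ?V0 = "lower_value x0 t0" and ?\<Omega> = "UNIV \<times> {0<..} :: ('x \<times> real) set" and ?z = "(x0, t0)"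
  have z: "?z \<in> ?\<Omega>" using t0 by simp
  obtain \<rho> K where \<rho>: "0 < \<rho>" and run: "\<And>\<epsilon> x y \<alpha> \<xi> \<eta> T. \<lbrakk>trajectory f g \<epsilon> x y \<alpha> \<xi> \<eta>; \<alpha> \<in> controls A; 0 \<le> T;
      \<forall>s\<in>{0..T}. \<xi> s \<in> cball x0 \<rho>\<rbrakk>
      \<Longrightarrow> - K - \<Lambda> / 4 * T \<le> integral {0..T} (\<lambda>s. lagr p (\<xi> s) (\<eta> s) (\<alpha> s) + b)"
    by (rule running_cost_lower_bound[OF u \<Lambda>4]) (rule that, assumption, blast)
  obtain r0 where r0: "0 < r0" "\<And>w. \<lbrakk>w \<in> ?\<Omega>; w \<noteq> ?z; dist w ?z < r0\<rbrakk> \<Longrightarrow>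
      (\<lambda>(x, t). lower_value x t) w - \<phi> w \<ge> ?V0 - \<phi> ?z"
    using min unfolding eventually_at by auto
  \<comment> \<open>In slow time the point \<open>(\<xi>, t)\<close> moves with speed at most \<open>Q0 + 1\<close>, so linearizing \<open>\<phi>\<close>
    costs at most \<open>\<Lambda> / 4\<close> per unit of slow time.\<close>
  define e where "e = \<Lambda> / (4 * (Q0 + 1))"
  have e: "0 < e" using \<Lambda> Q0_nonneg by (simp add: e_def)
  have "continuous_on ?\<Omega> D" using \<phi> by (simp add: C1_gradient_def)
  then obtain r1 where r1: "0 < r1" "\<And>w. \<lbrakk>w \<in> ?\<Omega>; dist w ?z < r1\<rbrakk> \<Longrightarrow> dist (D w) (D ?z) < e"
    unfolding continuous_on_iff using z e by metis
  define r where "r = min (min r0 r1) (min \<rho> (min t0 1))"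
  have r: "0 < r" "r \<le> r0" "r \<le> r1" "r \<le> \<rho>" "r \<le> t0" "r \<le> 1" using r0 r1 \<rho> t0 by (auto simp: r_def)
  have ball_sub: "ball ?z r \<subseteq> ?\<Omega>"
  proof
    fix w assume w: "w \<in> ball ?z r"
    have "dist (snd ?z) (snd w) \<le> dist ?z w" by (rule dist_snd_le)
    then have "\<bar>t0 - snd w\<bar> < t0" using w r(5) by (simp add: dist_real_def)
    then show "w \<in> ?\<Omega>" by (cases w) auto
  qed
  have ballI': "(x, t) \<in> ball ?z r" if "norm (x - x0) + \<bar>t - t0\<bar> < r" for x t
  proof -
    have "dist ?z (x, t) \<le> dist x0 x + dist t0 t" by (simp add: dist_Pair_Pair sqrt_sum_squares_le_sum)
    then show ?thesis using that by (simp add: dist_norm norm_minus_commute)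
  qed
  have minV: "\<phi> (x, t) + ?V0 - \<phi> ?z \<le> lower_value x t" if "(x, t) \<in> ball ?z r" for x t
  proof (cases "(x, t) = ?z")
    case False
    have "(x, t) \<in> ?\<Omega>" using that ball_sub by blast
    moreover have "dist (x, t) ?z < r0" using that r(2) by (simp add: dist_commute)
    ultimately show ?thesis using r0(2)[of "(x, t)"] False by simp
  qed simp
  have inc: "\<bar>\<phi> w' - \<phi> w - (w' - w) \<bullet> (p, q0)\<bar> \<le> e * norm (w' - w)" if "w \<in> ball ?z r" "w' \<in> ball ?z r" for w w'
  proof (rule C1_gradient_increment[OF \<phi> convex_ball ball_sub _ that])
    fix v assume "v \<in> ball ?z r"
    then have "dist (D v) (D ?z) < e" using ball_sub r(3) by (intro r1(2)) (auto simp: dist_commute)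
    then show "norm (D v - (p, q0)) \<le> e" by (simp add: D0 dist_norm)
  qed
  define \<tau> where "\<tau> = r / (8 * (Q0 + 1))"
  have \<tau>: "0 < \<tau>" using r(1) Q0_nonneg by (simp add: \<tau>_def)
  have \<tau>r: "Q0 * \<tau> + \<tau> = r / 8"
  proof -
    have "\<tau> * (8 * (Q0 + 1)) = r" using Q0_nonneg by (simp add: \<tau>_def)
    then show ?thesis by (simp add: algebra_simps)
  qed
  have \<tau>r': "\<tau> \<le> r / 8" "Q0 * \<tau> \<le> r / 8" using \<tau>r \<tau> Q0_nonneg by (auto simp: mult_nonneg_nonneg)
  obtain R where R: "0 \<le> R" "\<And>\<epsilon> x y t \<alpha> \<xi> \<eta>. \<lbrakk>0 < \<epsilon>; dist x x0 \<le> 1; \<tau> \<le> t; t \<le> t0 + 1; \<alpha> \<in> controls A; trajectory f g \<epsilon> x y \<alpha> \<xi> \<eta>;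
      cost \<epsilon> t \<alpha> \<xi> \<eta> < ?V0 + \<Lambda>\<rbrakk> \<Longrightarrow> \<exists>s. \<tau> / 2 \<le> s \<and> s \<le> \<tau> \<and> norm (\<eta> (s / \<epsilon>)) \<le> R"
    by (rule fast_variable_returns[OF \<tau>, of x0 "t0 + 1" "?V0 + \<Lambda>"]) (rule that, assumption, blast)
  \<comment> \<open>The error \<open>\<eta>'\<close> enters three times, for a total of \<open>\<Lambda> * \<tau> / 8\<close>; the term with \<open>\<epsilon> * K\<close> is
    less than another \<open>\<Lambda> * \<tau> / 8\<close>, and the gain is at least \<open>\<Lambda> * s / 2 \<ge> \<Lambda> * \<tau> / 4\<close>.\<close>
  define \<eta>' where "\<eta>' = \<Lambda> * \<tau> / 24"
  have \<eta>': "0 < \<eta>'" using \<Lambda> \<tau> by (simp add: \<eta>'_def)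
  have \<eta>'\<Lambda>: "\<eta>' \<le> \<Lambda>" using \<tau>r' r \<Lambda> by (simp add: \<eta>'_def)
  define Kc where "Kc = cball x0 (r/4) \<times> cball (0::'y) R \<times> cball t0 (r/4)"
  have near_Kc: "(x, t) \<in> ball ?z r" if "(x, y, t) \<in> Kc" for x y t
  proof (rule ballI')
    have "dist x0 x \<le> r / 4" "dist t0 t \<le> r / 4" using that by (auto simp: Kc_def)
    then show "norm (x - x0) + \<bar>t - t0\<bar> < r"
      unfolding dist_norm real_norm_def using r(1) norm_minus_commute[of x0 x] abs_minus_commute[of t0 t] by linarith
  qed
  have cont\<phi>: "continuous_on ?\<Omega> \<phi>" by (rule C1_gradient_imp_continuous_on[OF \<phi>])
  obtain \<epsilon>1 where \<epsilon>1: "0 < \<epsilon>1" "\<And>\<epsilon> x y t. \<lbrakk>0 < \<epsilon>; \<epsilon> < \<epsilon>1; (x, y, t) \<in> Kc; 0 \<le> t\<rbrakk> \<Longrightarrow>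
      \<phi> (x, t) + ?V0 - \<phi> ?z - \<eta>' < W \<epsilon> x y t"
  proof (rule semilimit_uniform_on_compact[of Kc "\<lambda>(x, y, t). \<phi> (x, t) + ?V0 - \<phi> ?z - \<eta>'" W])
    show "compact Kc" unfolding Kc_def by (intro compact_Times) auto
    show "continuous_on Kc (\<lambda>(x, y, t). \<phi> (x, t) + ?V0 - \<phi> ?z - \<eta>')"
      unfolding case_prod_unfold
      by (intro continuous_intros continuous_on_compose2[OF cont\<phi>]) (use near_Kc ball_sub in force)
    fix x y t assume K: "(x, y, t) \<in> Kc"
    have "t > 0" using near_Kc[OF K] ball_sub by auto
    then show "ereal ((\<lambda>(x, y, t). \<phi> (x, t) + ?V0 - \<phi> ?z - \<eta>') (x, y, t)) < lower_semilimit W x y t"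
      using minV[OF near_Kc[OF K]] \<eta>' by (simp add: lower_semilimit_eq)
  qed auto
  have "continuous (at ?z within ?\<Omega>) \<phi>" using cont\<phi> z by (simp add: continuous_on_eq_continuous_within)
  then obtain r2 where r2: "0 < r2" "\<And>w. \<lbrakk>w \<in> ?\<Omega>; dist w ?z < r2\<rbrakk> \<Longrightarrow> dist (\<phi> w) (\<phi> ?z) < \<eta>'"
    unfolding continuous_within_eps_delta using \<eta>' by metis
  define \<delta> where "\<delta> = min (min (r/8) (r2/2)) (min \<epsilon>1 (\<Lambda> * \<tau> / (8 * (\<bar>K\<bar> + 1))))"
  have \<delta>: "0 < \<delta>" "\<delta> \<le> r/8" "\<delta> \<le> r2/2" "\<delta> \<le> \<epsilon>1" "\<delta> \<le> \<Lambda> * \<tau> / (8 * (\<bar>K\<bar> + 1))"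
  proof -
    have "0 < \<Lambda> * \<tau> / (8 * (\<bar>K\<bar> + 1))" using \<Lambda> \<tau> by (intro divide_pos_pos mult_pos_pos add_nonneg_pos) auto
    then show "0 < \<delta>" using r(1) r2(1) \<epsilon>1(1) by (simp add: \<delta>_def)
    show "\<delta> \<le> r/8" "\<delta> \<le> r2/2" "\<delta> \<le> \<epsilon>1" "\<delta> \<le> \<Lambda> * \<tau> / (8 * (\<bar>K\<bar> + 1))"
      unfolding \<delta>_def by linarith+
  qed
  have "lower_semilimit W x0 0 t0 < ereal (?V0 + \<eta>')" using \<eta>' t0 by (simp add: lower_semilimit_eq)
  from lower_semilimit_lessD[OF this \<delta>(1)] obtain \<epsilon> x1 y1 t1 where
    \<epsilon>: "0 < \<epsilon>" "\<epsilon> < \<delta>" and x1: "dist x1 x0 < \<delta>" and t1: "0 \<le> t1" "\<bar>t1 - t0\<bar> < \<delta>" and lt: "W \<epsilon> x1 y1 t1 < ?V0 + \<eta>'"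
    by blast
  obtain \<alpha> \<xi> \<eta> where \<alpha>: "\<alpha> \<in> controls A" and tr: "trajectory f g \<epsilon> x1 y1 \<alpha> \<xi> \<eta>" and cost: "cost \<epsilon> t1 \<alpha> \<xi> \<eta> < ?V0 + \<eta>'"
    using near_optimal_trajectory[OF \<epsilon>(1) lt] .
  have \<tau>t1: "\<tau> \<le> t1" "t1 \<le> t0 + 1" "dist x1 x0 \<le> 1" using \<tau>r' r \<delta>(2) t1 x1 by auto
  obtain s where s: "\<tau> / 2 \<le> s" "s \<le> \<tau>" and \<eta>R: "norm (\<eta> (s / \<epsilon>)) \<le> R"
    using R(2)[OF \<epsilon>(1) \<tau>t1(3,1,2) \<alpha> tr] cost \<eta>'\<Lambda> by auto
  define T where "T = s / \<epsilon>"
  have T: "0 \<le> T" "\<epsilon> * T = s" using s \<tau> \<epsilon>(1) by (auto simp: T_def)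
  let ?x = "\<xi> T" and ?t = "t1 - s"
  have slow: "norm (\<xi> s' - x1) \<le> Q0 * s" if "0 \<le> s'" "s' \<le> T" for s'
  proof -
    have "norm (\<xi> s' - \<xi> 0) \<le> \<epsilon> * Q0 * (s' - 0)" using that \<epsilon> by (intro trajectory_slow_speed[OF tr \<alpha>]) auto
    also have "\<dots> \<le> \<epsilon> * Q0 * T" using that \<epsilon> Q0_nonneg by (intro mult_left_mono) auto
    finally show ?thesis by (simp add: trajectory_init(1)[OF tr] T(2)[symmetric] mult_ac)
  qed
  have Q0s: "Q0 * s \<le> r / 8" using mult_left_mono[OF s(2) Q0_nonneg] \<tau>r' by simp
  have close: "norm (\<xi> s' - x0) \<le> r / 4" if "0 \<le> s'" "s' \<le> T" for s'
    using norm_triangle_ineq[of "\<xi> s' - x1" "x1 - x0"] slow[OF that] Q0s x1 \<delta>(2) by (simp add: dist_norm)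
  have t_close: "\<bar>?t - t0\<bar> \<le> r / 4" using t1(2) s \<tau> \<tau>r' \<delta>(2) by linarith
  have K: "(?x, \<eta> T, ?t) \<in> Kc"
    using close[of T] T(1) \<eta>R t_close abs_minus_commute[of ?t t0] by (simp add: Kc_def T_def dist_norm norm_minus_commute dist_real_def)
  have "0 \<le> ?t" using s(2) \<tau>t1(1) by simp
  then have Wlow: "\<phi> (?x, ?t) + ?V0 - \<phi> ?z - \<eta>' < W \<epsilon> ?x (\<eta> T) ?t"
    using \<epsilon> \<delta>(4) K by (intro \<epsilon>1(2)) auto
  have split: "\<epsilon> * integral {0..T} (along l \<xi> \<eta> \<alpha>) + W \<epsilon> ?x (\<eta> T) ?t \<le> cost \<epsilon> t1 \<alpha> \<xi> \<eta>"
    using cost_splits_at[OF tr \<alpha> \<epsilon>(1) T(1), of t1] T(2) s(2) \<tau>t1(1) by simp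
  have w1: "(x1, t1) \<in> ball ?z r" using x1 t1 \<delta>(2) r(1) by (intro ballI') (simp add: dist_norm)
  have inc1: "(?x - x1) \<bullet> p - s * q0 - \<Lambda> / 4 * s \<le> \<phi> (?x, ?t) - \<phi> (x1, t1)"
  proof -
    have "norm ((?x, ?t) - (x1, t1)) \<le> norm (?x - x1) + \<bar>s\<bar>"
      using sqrt_sum_squares_le_sum[of "norm (?x - x1)" "\<bar>s\<bar>"] by (simp add: norm_Pair)
    also have "\<dots> \<le> Q0 * s + s" using slow[of T] T(1) s \<tau> by simp
    finally have "e * norm ((?x, ?t) - (x1, t1)) \<le> e * (Q0 * s + s)" using e by (intro mult_left_mono) auto
    also have "\<dots> = \<Lambda> / 4 * s"
    proof -
      have "e * (4 * (Q0 + 1)) = \<Lambda>" using Q0_nonneg by (simp add: e_def)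
      then have "\<Lambda> / 4 * s = e * (4 * (Q0 + 1)) / 4 * s" by simp
      then show ?thesis by (simp add: algebra_simps)
    qed
    finally show ?thesis using inc[OF w1 near_Kc[OF K]] by (simp add: inner_Pair)
  qed
  have \<phi>1: "\<phi> ?z - \<eta>' \<le> \<phi> (x1, t1)"
  proof -
    have "dist (x1, t1) ?z \<le> dist x1 x0 + dist t1 t0" by (simp add: dist_Pair_Pair sqrt_sum_squares_le_sum)
    also have "\<dots> < r2" using x1 t1 \<delta>(3) by (simp add: dist_real_def)
    finally have "dist (\<phi> (x1, t1)) (\<phi> ?z) < \<eta>'" using w1 ball_sub by (intro r2(2)) auto
    then show ?thesis by (simp add: dist_real_def)
  qed
  have x_int: "\<epsilon> * integral {0..T} (\<lambda>s. lagr p (\<xi> s) (\<eta> s) (\<alpha> s) + b) =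
      \<epsilon> * integral {0..T} (along l \<xi> \<eta> \<alpha>) + (?x - x1) \<bullet> p + b * s"
  proof -
    have "((\<lambda>s. \<epsilon> *\<^sub>R f (\<xi> s) (\<eta> s) (\<alpha> s)) has_integral (?x - x1)) {0..T}"
      using tr T(1) unfolding trajectory_def by simp
    from has_integral_linear[OF this bounded_linear_inner_right[of p]]
    have 1: "((\<lambda>s. \<epsilon> * (p \<bullet> f (\<xi> s) (\<eta> s) (\<alpha> s))) has_integral ((?x - x1) \<bullet> p)) {0..T}"
      by (simp add: o_def inner_commute)
    have 2: "((\<lambda>s. \<epsilon> * l (\<xi> s) (\<eta> s) (\<alpha> s)) has_integral (\<epsilon> * integral {0..T} (along l \<xi> \<eta> \<alpha>))) {0..T}"
      by (intro has_integral_mult_right integrable_integral trajectory_integrable[OF cont_l tr \<alpha>]) simp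
    have 3: "((\<lambda>_. \<epsilon> * b) has_integral (b * s)) {0..T}"
      unfolding T(2)[symmetric] using has_integral_const_real[of "\<epsilon> * b" 0 T] T(1) by (simp add: mult_ac)
    have "((\<lambda>s. \<epsilon> * l (\<xi> s) (\<eta> s) (\<alpha> s) + \<epsilon> * (p \<bullet> f (\<xi> s) (\<eta> s) (\<alpha> s)) + \<epsilon> * b) has_integral
       (\<epsilon> * integral {0..T} (along l \<xi> \<eta> \<alpha>) + (?x - x1) \<bullet> p + b * s)) {0..T}"
      by (intro has_integral_add 1 2 3)
    then have "((\<lambda>s. \<epsilon> * (lagr p (\<xi> s) (\<eta> s) (\<alpha> s) + b)) has_integral
       (\<epsilon> * integral {0..T} (along l \<xi> \<eta> \<alpha>) + (?x - x1) \<bullet> p + b * s)) {0..T}"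
      by (simp add: lagr_def distrib_left)
    from integral_unique[OF this] show ?thesis by simp
  qed
  have "- K - \<Lambda> / 4 * T \<le> integral {0..T} (\<lambda>s. lagr p (\<xi> s) (\<eta> s) (\<alpha> s) + b)"
  proof (rule run[OF tr \<alpha> T(1)], intro ballI)
    fix s' assume "s' \<in> {0..T}"
    then show "\<xi> s' \<in> cball x0 \<rho>" using close[of s'] r(1,4) by (simp add: dist_norm norm_minus_commute)
  qed
  then have "\<epsilon> * (- K - \<Lambda> / 4 * T) \<le> \<epsilon> * integral {0..T} (\<lambda>s. lagr p (\<xi> s) (\<eta> s) (\<alpha> s) + b)"
    using \<epsilon> by (intro mult_left_mono) auto
  moreover have "\<epsilon> * (- K - \<Lambda> / 4 * T) = - (\<epsilon> * K) - \<Lambda> / 4 * s"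
    unfolding T(2)[symmetric] by (simp add: algebra_simps)
  ultimately have run': "- (\<epsilon> * K) - \<Lambda> / 4 * s \<le>
      \<epsilon> * integral {0..T} (along l \<xi> \<eta> \<alpha>) + (?x - x1) \<bullet> p + b * s" by (simp add: x_int)
  have \<epsilon>K: "\<epsilon> * K < \<Lambda> * \<tau> / 8"
  proof -
    have "\<epsilon> < \<Lambda> * \<tau> / (8 * (\<bar>K\<bar> + 1))" using \<epsilon> \<delta>(5) by simp
    moreover have "0 < 8 * (\<bar>K\<bar> + 1)" by (intro mult_pos_pos add_nonneg_pos) auto
    ultimately have "\<epsilon> * (8 * (\<bar>K\<bar> + 1)) < \<Lambda> * \<tau>" by (simp only: pos_less_divide_eq)
    moreover have "\<epsilon> * K \<le> \<epsilon> * (\<bar>K\<bar> + 1)" using \<epsilon> by (intro mult_left_mono) auto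
    ultimately show ?thesis by (simp add: algebra_simps)
  qed
  have "\<Lambda> * (\<tau> / 2) \<le> \<Lambda> * s" using s \<Lambda> by (intro mult_left_mono) auto
  moreover have "s * q0 = - (b * s) - \<Lambda> * s" by (simp add: \<Lambda>_def algebra_simps)
  ultimately show False
    using Wlow split cost inc1 \<phi>1 run' \<epsilon>K by (simp add: \<eta>'_def)
qed

lemma lower_value_supersolution:
  "viscosity_supersolution (UNIV \<times> {0<..})
     (\<lambda>(x, t) (p, q). q + effective_hamiltonian f g l A x p) (\<lambda>(x, t). lower_value x t)"
  unfolding viscosity_supersolution_def
proof (intro conjI allI impI ballI lower_value_lsc)
  fix \<phi> D and z :: "'x \<times> real"
  assume \<phi>: "C1_gradient (UNIV \<times> {0<..}) \<phi> D" and z: "z \<in> UNIV \<times> {0<..}"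
    and min: "\<forall>\<^sub>F w in at z within UNIV \<times> {0<..}.
      (\<lambda>(x, t). lower_value x t) w - \<phi> w \<ge> (\<lambda>(x, t). lower_value x t) z - \<phi> z"
  obtain x t where xt: "z = (x, t)" by (cases z)
  obtain p q where pq: "D z = (p, q)" by (cases "D z")
  have "- q \<le> effective_hamiltonian f g l A x p"
    unfolding effective_hamiltonian_def
  proof (rule cInf_greatest)
    show "{b. \<exists>u. cell_subsolution x p b u} \<noteq> {}"
      using constant_subsolution_exists[of x p] by blast
    fix b assume "b \<in> {b. \<exists>u. cell_subsolution x p b u}"
    then obtain u where "cell_subsolution x p b u" by blast
    then have "0 \<le> q + b"
      using z pq min by (intro supersolution_inequality[OF _ \<phi>]) (auto simp: xt)
    then show "- q \<le> b" by simp
  qed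
  then show "(\<lambda>(x, t) (p, q). q + effective_hamiltonian f g l A x p) z (D z) \<ge> 0"
    by (simp add: xt pq[unfolded xt])
qed

end

theorem theorem4p4:
  fixes f :: "real ^ 'n \<Rightarrow> real ^ 'm \<Rightarrow> 'c::euclidean_space \<Rightarrow> real ^ 'n"
    and g :: "real ^ 'n \<Rightarrow> real ^ 'm \<Rightarrow> 'c \<Rightarrow> real ^ 'm"
    and l :: "real ^ 'n \<Rightarrow> real ^ 'm \<Rightarrow> 'c \<Rightarrow> real"
    and u0 :: "real ^ 'n \<Rightarrow> real ^ 'm \<Rightarrow> real"
    and A :: "'c set"
    and L0 Q0 :: real
  assumes compact_A: "compact A"
    and cont_f: "continuous_on (UNIV \<times> UNIV \<times> A) (\<lambda>(x, y, a). f x y a)"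
    and cont_g: "continuous_on (UNIV \<times> UNIV \<times> A) (\<lambda>(x, y, a). g x y a)"
    and cont_l: "continuous_on (UNIV \<times> UNIV \<times> A) (\<lambda>(x, y, a). l x y a)"
    and cont_u0: "continuous_on UNIV (\<lambda>(x, y). u0 x y)"
    and L0_pos: "L0 > 0"
    and lipschitz_f: "\<forall>x1 y1 x2 y2. \<forall>a\<in>A.
      norm (f x1 y1 a - f x2 y2 a) \<le> L0 * (norm (x1 - x2) + norm (y1 - y2))"
    and lipschitz_g: "\<forall>x1 y1 x2 y2. \<forall>a\<in>A.
      norm (g x1 y1 a - g x2 y2 a) \<le> L0 * (norm (x1 - x2) + norm (y1 - y2))"
    and bounded_f: "\<forall>x y. \<forall>a\<in>A. norm (f x y a) \<le> Q0"
    and controllable: "\<forall>K. compact K \<longrightarrow>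
      (\<exists>r>0. \<forall>(x, y)\<in>K. ball 0 r \<subseteq> closure (convex hull ((\<lambda>a. g x y a) ` A)))"
    and coercive_l: "\<forall>B. compact B \<and> B \<noteq> {} \<longrightarrow>
      filterlim (\<lambda>y. INF (x, a)\<in>B \<times> A. l x y a) at_top at_infinity"
    and lower_bound_u0: "\<forall>x y. u0 x y \<ge> - Q0"
  shows "\<exists>V :: real ^ 'n \<Rightarrow> real \<Rightarrow> real.
    (\<forall>x y t. t > 0 \<longrightarrow> lower_semilimit (value_function f g l u0 A) x y t = ereal (V x t)) \<and>
    viscosity_supersolution (UNIV \<times> {0<..})
      (\<lambda>(x, t) (p, q). q + effective_hamiltonian f g l A x p) (\<lambda>(x, t). V x t) \<and>
    (\<forall>x0. Liminf (at (x0, 0) within UNIV \<times> {0<..}) (\<lambda>(x, t). ereal (V x t))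
      \<ge> ereal (lsc_envelope (limit_datum u0) x0))"
proof -
  interpret slow_fast_system f g l u0 A L0 Q0
    by unfold_locales (use assms in blast)+
  show ?thesis
    using lower_semilimit_eq lower_value_supersolution lower_value_initial
    by (intro exI[of _ lower_value] conjI allI impI) auto
qed

end
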